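(* (1) For any $n\ge1$ and any unit interval graph $\Gamma=\Gamma_{\mathsf e}$ corresponding to $\mathsf e\in\mathbb E_n$, $$\lim_{q\to\infty}\mathbf X_\Gamma(q,t)=t^{n(n-1)/2-|\mathsf e|}\,[n]_t!\,e_n(X),\qquad |\mathsf e|=\mathsf e(1)+\cdots+\mathsf e(n).$$ (2) For any partition $\lambda=(\lambda_1,\dots,\lambda_l)$ of $n$, $$\lim_{q\to\infty}e^{(q,t)}_\lambda(X)=\frac{[n]_t!}{\prod_{i=1}^l[\lambda_i]_t!}\,e_n(X).$$ (3) For any unit interval graph $\Gamma=\Gamma_{\mathsf e}$ corresponding to $\mathsf e\in\mathbb E_n$, $$\sum_{\lambda\vdash n}t^{|\mathsf e|-|\mathsf e_\lambda|}\,\frac{c_\lambda(\Gamma;t)}{\prod_{i}[\lambda_i]_t!}=1,\qquad |\mathsf e_\lambda|=\sum_{i<j}\lambda_i\lambda_j,$$ where $c_\lambda(\Gamma;t)$ are the coefficients of the expansion $\mathbf X_\Gamma(t)=\sum_{\lambda\vdash n}c_\lambda(\Gamma;t)\,e_\lambda(X)$ of the chromatic quasisymmetric function of $\Gamma$ in elementary symmetric functions.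
   Context: $[n]_t=\frac{1-t^n}{1-t}$, $[n]_t!=\prod_{i=1}^n[i]_t$. Let $q,t$ be indeterminates and $\mathbb Q_{q,t}=\mathbb Q(q,t)$. For $m\ge1$ put $\mathbb Q_{q,t}[X]_{(m)}=\mathbb Q_{q,t}[X_1,\dots,X_m]\subset\mathbb Q_{q,t}[X^{\pm1}]_{(m)}=\mathbb Q_{q,t}[X_1^{\pm1},\dots,X_m^{\pm1}]$, with the convention $X_{i+km}=q^{-k}X_i$ for $1\le i\le m$, $k\in\mathbb Z$ (so $X_0=qX_m$, $X_{m+1}=q^{-1}X_1$). Affine Hecke algebra: $\mathscr H_m$ is the $\mathbb Q_{q,t}$-algebra generated by $T_i$ ($i\in\mathbb Z/m\mathbb Z$) and $\Pi^{\pm1}$ with relations $(T_i-t)(T_i+1)=0$; $T_iT_{i+1}T_i=T_{i+1}T_iT_{i+1}$ if $m>2$; $T_iT_j=T_jT_i$ if $j\ne i\pm1$; $\Pi T_i=T_{i+1}\Pi$. (For $m=1$ no $T_i$ are present: $\mathscr H_1$ is generated by $\Pi^{\pm1}$.) It acts (action denoted $\bullet$) on $\mathbb Q_{q,t}[X^{\pm1}]_{(m)}$ by $$T_i\bullet F=t\,s_i(F)+(t-1)\frac{F-s_i(F)}{1-X_iX_{i+1}^{-1}},\qquad \Pi\bullet F=X_1F(X_2,\dots,X_m,X_{m+1}),$$ where for $1\le i\le m-1$ $s_i$ swaps $X_i$ and $X_{i+1}$, and $s_0(F)=X_1X_0^{-1}F(X_0,X_2,\dots,X_{m-1},X_{m+1})$.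 For $1\le i\le m$, $Y_i:=t^{m-i}T_{i-1}\cdots T_1\,\Pi\,T_{m-1}^{-1}\cdots T_i^{-1}\in\mathscr H_m$; these commute and generate a Laurent polynomial subalgebra with polynomial part $\mathbb Q_{q,t}[Y]_{(m)}$. The map $\mathsf q_{(m)}:\mathbb Q_{q,t}[Y]_{(m)}\to\mathbb Q_{q,t}[X]_{(m)}$, $F(Y)\mapsto F(Y)\bullet1$, is a linear isomorphism, and one sets $F\star G=\mathsf q_{(m)}(\mathsf q_{(m)}^{-1}(F)\cdot\mathsf q_{(m)}^{-1}(G))$ on $\mathbb Q_{q,t}[X]_{(m)}$. This commutative associative product preserves symmetric polynomials and is compatible with the truncation maps $\pi_{m,m'}$ ($X_{m'+1}=\dots=X_m=0$), hence defines a product $\star$ on the ring of symmetric functions $\Lambda_{q,t}=\bigoplus_{d\ge0}\varprojlim_m(\mathbb Q_{q,t}[X]_{(m)})_d^{\mathfrak S_m}$ ($d$ = degree). With $e_r(X)$ the $r$-th elementary symmetric function and $e_\lambda=\prod_ie_{\lambda_i}$, define $e^{(q,t)}_\lambda(X):=e_{\lambda_1}(X)\star\cdots\star e_{\lambda_l}(X)$. $\mathbb E_n=\{\mathsf e:\{1,\dots,n\}\to\mathbb Z\mid 0\le\mathsf e(i)<i,\ \mathsf e(i)\le\mathsf e(i+1)\}$. The unit interval graph $\Gamma_{\mathsf e}$ has vertex set $\{1,\dots,n\}$ and an oriented edge $j\to i$ exactly when $\mathsf e(i)<j<i$. For integers $i,e$ with $e<i$, $\mathsf S^{(m)}_{i,e}:=1+T_i^{-1}+T_{i+1}^{-1}T_i^{-1}+\cdots+T_{m+e-1}^{-1}\cdots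 T_i^{-1}\in\mathscr H_m$ if $e\ge i-m$ ($m+e-i+1$ terms, indices modulo $m$), and $\mathsf S^{(m)}_{i,e}:=0$ if $e<i-m$. For $\Gamma=\Gamma_{\mathsf e}$, $\mathbf X_\Gamma^{(m)}(q,t):=t^{n(m-1)}\mathsf S^{(m)}_{1,\mathsf e(1)}\cdots\mathsf S^{(m)}_{n,\mathsf e(n)}\Pi^n\bullet1$. These are symmetric polynomials compatible under $\pi_{m,m'}$, and $\mathbf X_\Gamma(q,t)\in\Lambda_{q,t}$ is the symmetric function whose $m$-variable truncation is $\mathbf X_\Gamma^{(m)}(q,t)$ for all $m\ge1$. The chromatic quasisymmetric function of an oriented graph $\Gamma$ is $\mathbf X_\Gamma(t)=\sum_\kappa t^{\mathrm{asc}(\kappa)}\prod_{v}X_{\kappa(v)}$, the sum over proper colorings $\kappa$ from vertices to $\mathbb Z_{>0}$, with $\mathrm{asc}(\kappa)$ the number of edges $v\to w$ with $\kappa(v)<\kappa(w)$; it is known to be symmetric for unit interval graphs. $\lim_{q\to\infty}$ means: the coefficients are polynomials in $q^{-1}$ over $\mathbb Q(t)$ and one sets $q^{-1}=0$. $\lambda\vdash n$ means $\lambda$ is a partition of $n$. *)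

theory Defs
  imports
    Complex_Main
    "HOL-Library.Poly_Mapping"
    "HOL-Library.FuncSet"
    "HOL-Computational_Algebra.Polynomial_Factorial"
begin

section \<open>The coefficient fields\<close>

text \<open>
  The field of rational functions in \<open>q\<close> and \<open>t\<close> is built as \<open>\<rat>(t)(q)\<close>, so that polynomials in
  the inverse of \<open>q\<close> with coefficients in \<open>\<rat>(t)\<close> make sense.
\<close>

type_synonym Qt = "rat poly fract"
type_synonym Qqt = "Qt poly fract"

definition t_Qt :: Qt where
  "t_Qt = to_fract [:0, 1:]"

definition embed :: "Qt \<Rightarrow> Qqt" where
  "embed c = to_fract [:c:]"

definition tt :: Qqt where
  "tt = embed t_Qt"

definition qq :: Qqt where
  "qq = to_fract [:0, 1:]"

text \<open>\<open>lim_q_inf x c\<close>: \<open>x\<close> is a polynomial in the inverse of \<open>q\<close> over \<open>\<rat>(t)\<close>, and its value at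
  \<open>1/q = 0\<close> is \<open>c\<close>.\<close>

definition lim_q_inf :: "Qqt \<Rightarrow> Qt \<Rightarrow> bool" where
  "lim_q_inf x c \<longleftrightarrow>
     (\<exists>p :: Qt poly. x = poly (map_poly embed p) (inverse qq) \<and> c = poly p 0)"

definition t_int :: "nat \<Rightarrow> Qt" where
  "t_int n = (1 - t_Qt ^ n) / (1 - t_Qt)"

definition t_fact :: "nat \<Rightarrow> Qt" where
  "t_fact n = (\<Prod>i=1..n. t_int i)"

section \<open>Laurent polynomials\<close>

text \<open>
  A Laurent polynomial is a finitely supported map from exponent vectors to coefficients; it lies in
  \<open>laurent m\<close> if it involves only the variables \<open>X\<^sub>1, \<dots>, X\<^sub>m\<close>. Polynomials are the Laurent
  polynomials without negative exponents.
\<close>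

type_synonym 'a lpoly = "(nat \<Rightarrow>\<^sub>0 int) \<Rightarrow>\<^sub>0 'a"

definition laurent :: "nat \<Rightarrow> 'a::zero lpoly set" where
  "laurent m = {F. \<forall>\<alpha>\<in>Poly_Mapping.keys F. Poly_Mapping.keys \<alpha> \<subseteq> {1..m}}"

definition scal :: "'a::comm_ring_1 \<Rightarrow> 'a lpoly \<Rightarrow> 'a lpoly" where
  "scal c F = Poly_Mapping.single 0 c * F"

text \<open>\<open>Xpow m j k\<close> is the \<open>k\<close>-th power of \<open>X\<^sub>j\<close> for an arbitrary integer index \<open>j\<close>, where
  \<open>X\<close> with index \<open>i + r m\<close> means \<open>X\<^sub>i\<close> divided by the \<open>r\<close>-th power of \<open>q\<close>, for \<open>1 \<le> i \<le> m\<close>.\<close>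

definition Xpow :: "nat \<Rightarrow> int \<Rightarrow> int \<Rightarrow> Qqt lpoly" where
  "Xpow m j k =
     Poly_Mapping.single
       (Poly_Mapping.single (nat ((j - 1) mod int m + 1)) k)
       ((qq powi (- ((j - 1) div int m))) powi k)"

text \<open>The ring endomorphism \<open>X\<^sub>i \<mapsto> X\<^bsub>\<sigma>(i)\<^esub>\<close>, for \<open>1 \<le> i \<le> m\<close>.\<close>

definition subst :: "nat \<Rightarrow> (int \<Rightarrow> int) \<Rightarrow> Qqt lpoly \<Rightarrow> Qqt lpoly" where
  "subst m \<sigma> F =
     (\<Sum>\<alpha>\<in>Poly_Mapping.keys F. scal (Poly_Mapping.lookup F \<alpha>)
        (\<Prod>i=1..m. Xpow m (\<sigma> (int i)) (Poly_Mapping.lookup \<alpha> i)))"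

section \<open>The affine Hecke algebra acting on Laurent polynomials\<close>

text \<open>
  Elements of the affine Hecke algebra occur only through their action on Laurent polynomials,
  so each of them is written as the operator by which it acts; products become compositions.
  Indices of \<open>s\<^sub>i\<close> and \<open>T\<^sub>i\<close> are integers read modulo \<open>m\<close>.
\<close>

definition s_op :: "nat \<Rightarrow> int \<Rightarrow> Qqt lpoly \<Rightarrow> Qqt lpoly" where
  "s_op m i F =
     (let r = i mod int m in
      if r = 0 then
        Xpow m 1 1 * Xpow m 0 (-1) *
        subst m (\<lambda>j. if j = 1 then 0 else if j = int m then int m + 1 else j) F
      else subst m (\<lambda>j. if j = r then r + 1 else if j = r + 1 then r else j) F)"

text \<open>The divided difference is the exact quotient by \<open>1 - X\<^sub>i/X\<^bsub>i+1\<^esub>\<close>. It is unique since Laurent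
  polynomials form an integral domain.\<close>

definition div_diff :: "nat \<Rightarrow> int \<Rightarrow> Qqt lpoly \<Rightarrow> Qqt lpoly" where
  "div_diff m i F =
     (THE D. D \<in> laurent m \<and> (1 - Xpow m i 1 * Xpow m (i + 1) (-1)) * D = F - s_op m i F)"

definition T_op :: "nat \<Rightarrow> int \<Rightarrow> Qqt lpoly \<Rightarrow> Qqt lpoly" where
  "T_op m i F = scal tt (s_op m i F) + scal (tt - 1) (div_diff m i F)"

definition Tinv_op :: "nat \<Rightarrow> int \<Rightarrow> Qqt lpoly \<Rightarrow> Qqt lpoly" where
  "Tinv_op m i = inv_into (laurent m) (T_op m i)"

definition Pi_op :: "nat \<Rightarrow> Qqt lpoly \<Rightarrow> Qqt lpoly" where
  "Pi_op m F = Xpow m 1 1 * subst m (\<lambda>j. j + 1) F"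

definition compose :: "('a \<Rightarrow> 'a) list \<Rightarrow> 'a \<Rightarrow> 'a" where
  "compose fs = foldr (\<circ>) fs id"

definition Y_op :: "nat \<Rightarrow> nat \<Rightarrow> Qqt lpoly \<Rightarrow> Qqt lpoly" where
  "Y_op m i F =
     scal (tt ^ (m - i))
       (compose (map (T_op m) (rev [1..int i - 1]))
         (Pi_op m
           (compose (map (Tinv_op m) (rev [int i..int m - 1])) F)))"

section \<open>The product \<open>\<star>\<close>\<close>

text \<open>
  The \<open>Y\<^sub>i\<close> commute and are algebraically independent, so their polynomials are represented by formal
  polynomials in \<open>m\<close> variables; \<open>q_map\<close> evaluates such a polynomial at the \<open>Y\<^sub>i\<close> and applies it to \<open>1\<close>.
\<close>

definition Y_polys :: "nat \<Rightarrow> ((nat \<Rightarrow>\<^sub>0 nat) \<Rightarrow>\<^sub>0 Qqt) set" where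
  "Y_polys m = {P. \<forall>\<alpha>\<in>Poly_Mapping.keys P. Poly_Mapping.keys \<alpha> \<subseteq> {1..m}}"

definition Y_monom :: "nat \<Rightarrow> (nat \<Rightarrow>\<^sub>0 nat) \<Rightarrow> Qqt lpoly \<Rightarrow> Qqt lpoly" where
  "Y_monom m \<alpha> = compose (map (\<lambda>i. Y_op m i ^^ Poly_Mapping.lookup \<alpha> i) [1..<m + 1])"

definition q_map :: "nat \<Rightarrow> ((nat \<Rightarrow>\<^sub>0 nat) \<Rightarrow>\<^sub>0 Qqt) \<Rightarrow> Qqt lpoly" where
  "q_map m P =
     (\<Sum>\<alpha>\<in>Poly_Mapping.keys P. scal (Poly_Mapping.lookup P \<alpha>) (Y_monom m \<alpha> 1))"

definition star :: "nat \<Rightarrow> Qqt lpoly \<Rightarrow> Qqt lpoly \<Rightarrow> Qqt lpoly" where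
  "star m F G =
     q_map m (inv_into (Y_polys m) (q_map m) F * inv_into (Y_polys m) (q_map m) G)"

section \<open>Symmetric functions\<close>

text \<open>
  The ring of symmetric functions is a graded inverse limit, so a symmetric function is given by the
  family of its truncations to \<open>m\<close> variables, \<open>m \<ge> 1\<close>; the entry at \<open>m = 0\<close> carries no information.
  Sums, scalar multiples, products and \<open>\<star>\<close> are taken in each truncation.
  A monomial in \<open>m\<close> variables has the same coefficient in a symmetric function and in its truncation.
\<close>

type_synonym 'a symfun = "nat \<Rightarrow> 'a lpoly"

definition symfun_eq :: "'a::zero symfun \<Rightarrow> 'a symfun \<Rightarrow> bool" where
  "symfun_eq F G \<longleftrightarrow> (\<forall>m\<ge>1. F m = G m)"

definition symfun_lim :: "Qqt symfun \<Rightarrow> Qt symfun \<Rightarrow> bool" where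
  "symfun_lim F G \<longleftrightarrow>
     (\<forall>m\<ge>1. \<forall>\<alpha>. lim_q_inf (Poly_Mapping.lookup (F m) \<alpha>) (Poly_Mapping.lookup (G m) \<alpha>))"

definition e_sym :: "nat \<Rightarrow> 'a::comm_ring_1 symfun" where
  "e_sym r m = (\<Sum>A | A \<subseteq> {1..m} \<and> card A = r.
     \<Prod>i\<in>A. Poly_Mapping.single (Poly_Mapping.single i 1) 1)"

definition partitions :: "nat \<Rightarrow> nat list set" where
  "partitions n = {\<nu>. sorted_wrt (\<ge>) \<nu> \<and> (\<forall>k\<in>set \<nu>. 0 < k) \<and> sum_list \<nu> = n}"

definition e_part :: "nat list \<Rightarrow> 'a::comm_ring_1 symfun" where
  "e_part \<nu> m = (\<Prod>r\<leftarrow>\<nu>. e_sym r m)"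

definition e_qt :: "nat list \<Rightarrow> Qqt symfun" where
  "e_qt \<nu> m = foldr (\<lambda>r. star m (e_sym r m)) \<nu> 1"

definition t_fact_part :: "nat list \<Rightarrow> Qt" where
  "t_fact_part \<nu> = (\<Prod>r\<leftarrow>\<nu>. t_fact r)"

section \<open>Unit interval graphs and chromatic functions\<close>

definition EE :: "nat \<Rightarrow> (nat \<Rightarrow> int) set" where
  "EE n = {e. (\<forall>i\<in>{1..n}. 0 \<le> e i \<and> e i < int i) \<and> (\<forall>i\<in>{1..<n}. e i \<le> e (i + 1))}"

definition e_size :: "nat \<Rightarrow> (nat \<Rightarrow> int) \<Rightarrow> int" where
  "e_size n e = (\<Sum>i=1..n. e i)"

definition part_size :: "nat list \<Rightarrow> nat" where
  "part_size \<nu> = (\<Sum>j<length \<nu>. \<Sum>i<j. \<nu> ! i * \<nu> ! j)"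

text \<open>A pair \<open>(j, i)\<close> stands for an edge oriented from \<open>j\<close> to \<open>i\<close>.\<close>

definition unit_interval_edges :: "nat \<Rightarrow> (nat \<Rightarrow> int) \<Rightarrow> (nat \<times> nat) set" where
  "unit_interval_edges n e = {(j, i). j \<in> {1..n} \<and> i \<in> {1..n} \<and> e i < int j \<and> j < i}"

definition proper_colorings :: "'v set \<Rightarrow> ('v \<times> 'v) set \<Rightarrow> nat \<Rightarrow> ('v \<Rightarrow> nat) set" where
  "proper_colorings V E m = {\<kappa> \<in> V \<rightarrow>\<^sub>E {1..m}. \<forall>(v, w)\<in>E. \<kappa> v \<noteq> \<kappa> w}"

definition asc :: "('v \<times> 'v) set \<Rightarrow> ('v \<Rightarrow> nat) \<Rightarrow> nat" where
  "asc E \<kappa> = card {(v, w) \<in> E. \<kappa> v < \<kappa> w}"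

text \<open>Setting \<open>X\<^sub>j = 0\<close> for \<open>j > m\<close> in the sum over all proper colorings by positive integers keeps
  exactly the colorings with values in \<open>{1..m}\<close>.\<close>

definition chromatic :: "'v set \<Rightarrow> ('v \<times> 'v) set \<Rightarrow> Qt symfun" where
  "chromatic V E m =
     (\<Sum>\<kappa>\<in>proper_colorings V E m. scal (t_Qt ^ asc E \<kappa>)
        (\<Prod>v\<in>V. Poly_Mapping.single (Poly_Mapping.single (\<kappa> v) 1) 1))"

definition S_op :: "nat \<Rightarrow> int \<Rightarrow> int \<Rightarrow> Qqt lpoly \<Rightarrow> Qqt lpoly" where
  "S_op m i e F =
     (if e \<ge> i - int m
      then \<Sum>j\<in>{i - 1..int m + e - 1}. compose (map (Tinv_op m) (rev [i..j])) F
      else 0)"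

definition X_qt :: "nat \<Rightarrow> (nat \<Rightarrow> int) \<Rightarrow> Qqt symfun" where
  "X_qt n e m =
     scal (tt ^ (n * (m - 1)))
       (compose (map (\<lambda>i. S_op m (int i) (e i)) [1..<n + 1]) ((Pi_op m ^^ n) 1))"

end

theory Submission
  imports Defs
begin

text \<open>
  Everything is computed modulo \<open>1/q\<close>, on the span of the multilinear monomials \<open>X\<^sub>I\<close>. Conjugating
  by \<open>\<Pi>\<close> turns \<open>X\<^sub>\<Gamma>(q,t)\<close> into a product of the operators \<open>B\<^sub>a = S\<^bsub>1,-a\<^esub> \<Pi>\<close> with \<open>a = i - 1 - e(i)\<close>. With
  \<open>p = m - a\<close>, if the coefficients \<open>f(I)\<close> are invariant under permutations of \<open>{1..p-1}\<close>, then
  \<open>B\<^sub>a\<close> maps them to \<open>t\<^sup>1\<^sup>-\<^sup>p [|K \<inter> {1..p}|]\<^sub>t f((K - min K) - 1)\<close>, which is invariant under permutations of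
  \<open>{1..p}\<close>; iterating gives the factorial. For the \<open>\<star>\<close>-products, the braid relations imply that the
  \<open>Y\<^sub>i\<close> commute, and \<open>e\<^sub>r\<close> is the image of a multiple of \<open>e\<^sub>r(Y)\<close>; modulo \<open>1/q\<close> one has
  \<open>e\<^sub>1 \<star> e\<^sub>n = [n+1]\<^sub>t e\<^bsub>n+1\<^esub>\<close>, and commutativity does the rest.
  The identity for the coefficients \<open>c\<^sub>\<lambda>\<close> needs no Hecke algebra: at \<open>X\<^sub>i = t\<^bsup>m-i\<^esup>\<close> the chromatic
  function factors over the vertices and both sides become polynomials in \<open>t\<^sup>m\<close>, whose constant
  terms are compared.
\<close>

text \<open>The limit makes sense only if no positive power of q ever arises. For 1 \<le> i < m, T_i
  and its inverse involve t alone on polynomials, and Pi brings in q only through X_{m+1} = X_1/q.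
  Hence these operators respect coefficients in Q(t)[1/q] as well as those divisible by 1/q, and
  congruence modulo 1/q survives every composition. Modulo 1/q, Pi kills X_I if m is in I; otherwise
  it raises I by one and adds the element 1. This turns the Hecke algebra computation into
  combinatorics of subsets of {1..m}.

  Each factor enlarges the range of symmetry by one because the minimum of K is dropped: a swap that
  only moves the minimum is not seen. Monotonicity of e, in the form a(i+1) \<le> a(i) + 1, says
  that this is just the symmetry which the factor for i requires of the result for i+1.

  Indices outside {1..m-1} are reached by conjugating T_1 with Pi, so s_0 is treated only once. The
  \<star>-product rests on chosen preimages under \<open>q_map\<close>; commuting Y_i make the
  choice harmless.\<close>

abbreviation "lookup \<equiv> Poly_Mapping.lookup"
abbreviation "single \<equiv> Poly_Mapping.single"
abbreviation "keys \<equiv> Poly_Mapping.keys"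

section \<open>Linear extension\<close>

text \<open>The common form of three constructions: substitution of variables
  (\<open>subst\<close>), polynomials in the Y_i applied to a fixed vector (\<open>q_op\<close>) and
  principal specialization (\<open>t_eval\<close>). The map \<phi> places coefficients in the target
  ring.\<close>

definition lext :: "('a \<Rightarrow> 'b) \<Rightarrow> ('k \<Rightarrow> 'b) \<Rightarrow> ('k \<Rightarrow>\<^sub>0 'a::comm_ring_1) \<Rightarrow> 'b::comm_ring_1" where
  "lext \<phi> h F = (\<Sum>\<alpha>\<in>keys F. \<phi> (lookup F \<alpha>) * h \<alpha>)"

definition ring_hom :: "('a::comm_ring_1 \<Rightarrow> 'b::comm_ring_1) \<Rightarrow> bool" where
  "ring_hom \<phi> \<longleftrightarrow> \<phi> 1 = 1 \<and> (\<forall>a b. \<phi> (a + b) = \<phi> a + \<phi> b) \<and> (\<forall>a b. \<phi> (a * b) = \<phi> a * \<phi> b)"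

lemma ring_homI:
  assumes "\<phi> 1 = 1" "\<And>a b. \<phi> (a + b) = \<phi> a + \<phi> b" "\<And>a b. \<phi> (a * b) = \<phi> a * \<phi> b"
  shows "ring_hom \<phi>"
  using assms by (simp add: ring_hom_def)

lemma
  assumes "ring_hom \<phi>"
  shows ring_hom_1: "\<phi> 1 = 1" and ring_hom_add: "\<phi> (a + b) = \<phi> a + \<phi> b"
    and ring_hom_mult: "\<phi> (a * b) = \<phi> a * \<phi> b"
    and ring_hom_0: "\<phi> 0 = 0" and ring_hom_uminus: "\<phi> (- a) = - \<phi> a"
    and ring_hom_diff: "\<phi> (a - b) = \<phi> a - \<phi> b"
proof -
  show "\<phi> 1 = 1" and add: "\<And>a b. \<phi> (a + b) = \<phi> a + \<phi> b" and "\<phi> (a * b) = \<phi> a * \<phi> b"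
    using assms by (auto simp: ring_hom_def)
  show 0: "\<phi> 0 = 0" using add[of 0 0] by simp
  show um: "\<phi> (- a) = - \<phi> a" for a using add[of "- a" a] 0 by (simp add: eq_neg_iff_add_eq_0)
  show "\<phi> (a - b) = \<phi> a - \<phi> b" using add[of a "- b"] um by simp
qed

lemma ring_hom_sum: "ring_hom \<phi> \<Longrightarrow> \<phi> (sum f A) = (\<Sum>x\<in>A. \<phi> (f x))"
  by (induction A rule: infinite_finite_induct) (auto simp: ring_hom_0 ring_hom_add)

lemma ring_hom_prod: "ring_hom \<phi> \<Longrightarrow> \<phi> (prod f A) = (\<Prod>x\<in>A. \<phi> (f x))"
  by (induction A rule: infinite_finite_induct) (auto simp: ring_hom_1 ring_hom_mult)

lemma ring_hom_power: "ring_hom \<phi> \<Longrightarrow> \<phi> (a ^ n) = \<phi> a ^ n"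
  by (induction n) (auto simp: ring_hom_1 ring_hom_mult)

lemma ring_hom_prod_list: "ring_hom \<phi> \<Longrightarrow> \<phi> (prod_list xs) = prod_list (map \<phi> xs)"
  by (induction xs) (auto simp: ring_hom_1 ring_hom_mult)

lemma lext_superset:
  assumes "ring_hom \<phi>" "finite K" "keys F \<subseteq> K"
  shows "lext \<phi> h F = (\<Sum>\<alpha>\<in>K. \<phi> (lookup F \<alpha>) * h \<alpha>)"
  unfolding lext_def using assms
  by (intro sum.mono_neutral_left) (auto simp: in_keys_iff ring_hom_0)

lemma lext_add:
  assumes "ring_hom \<phi>"
  shows "lext \<phi> h (F + G) = lext \<phi> h F + lext \<phi> h G"
  by (subst (1 2 3) lext_superset[OF assms, of "keys F \<union> keys G"])
    (use keys_add[of F G] in \<open>auto simp: lookup_add ring_hom_add[OF assms] algebra_simps sum.distrib\<close>)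

lemma lext_0 [simp]: "lext \<phi> h 0 = 0"
  by (simp add: lext_def)

lemma lext_sum:
  assumes "ring_hom \<phi>"
  shows "lext \<phi> h (sum F A) = (\<Sum>x\<in>A. lext \<phi> h (F x))"
  by (induction A rule: infinite_finite_induct) (auto simp: lext_add[OF assms])

lemma lext_single:
  assumes "ring_hom \<phi>"
  shows "lext \<phi> h (single \<alpha> c) = \<phi> c * h \<alpha>"
  by (cases "c = 0") (auto simp: lext_def ring_hom_0[OF assms])

lemma poly_mapping_decomp:
  "F = (\<Sum>\<alpha>\<in>keys F. single \<alpha> (lookup F \<alpha>))"
  by (rule poly_mapping_eqI)
    (auto simp: lookup_sum lookup_single when_def in_keys_iff)

text \<open>Single terms range over those of \<open>F\<close> itself, so that knowledge about the
  support and the coefficients of \<open>F\<close> can be used there.\<close>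

lemma poly_mapping_add_induct:
  fixes F :: "'k \<Rightarrow>\<^sub>0 'a::comm_monoid_add"
  assumes "P 0" "\<And>F G. P F \<Longrightarrow> P G \<Longrightarrow> P (F + G)"
    "\<And>\<alpha>. \<alpha> \<in> keys F \<Longrightarrow> P (single \<alpha> (lookup F \<alpha>))"
  shows "P F"
proof -
  have "P (\<Sum>\<alpha>\<in>K. single \<alpha> (lookup F \<alpha>))"
    if "finite K" "K \<subseteq> keys F" for K
    using that by (induction K rule: finite_induct) (auto intro: assms)
  from this[OF _ order_refl] show ?thesis by (subst poly_mapping_decomp) auto
qed

lemma lext_mult:
  assumes \<phi>: "ring_hom \<phi>"
  shows "lext \<phi> h (P * Q) = lext \<phi> (\<lambda>\<alpha>. lext \<phi> (\<lambda>\<beta>. h (\<alpha> + \<beta>)) Q) P"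
proof (induction P rule: poly_mapping_add_induct)
  case (3 \<alpha>)
  show ?case
  proof (induction Q rule: poly_mapping_add_induct)
    case (3 \<beta>)
    then show ?case by (simp add: mult_single lext_single[OF \<phi>] ring_hom_mult[OF \<phi>])
  qed (auto simp: algebra_simps lext_add[OF \<phi>] lext_single[OF \<phi>])
qed (auto simp: algebra_simps lext_add[OF \<phi>])

lemma lext_ring_hom:
  assumes \<phi>: "ring_hom \<phi>" and "h 0 = 1" "\<And>\<alpha> \<beta>. h (\<alpha> + \<beta>) = h \<alpha> * h \<beta>"
  shows "ring_hom (lext \<phi> h)"
proof (rule ring_homI)
  show "lext \<phi> h 1 = 1"
    using lext_single[OF \<phi>, of h 0 1] assms by (simp add: ring_hom_1)
  fix P Q
  have "lext \<phi> h (P * Q) = lext \<phi> (\<lambda>\<alpha>. h \<alpha> * lext \<phi> h Q) P"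
    by (simp add: lext_mult[OF \<phi>]) (simp add: lext_def assms sum_distrib_left mult_ac)
  then show "lext \<phi> h (P * Q) = lext \<phi> h P * lext \<phi> h Q"
    by (simp add: lext_def sum_distrib_right mult_ac)
qed (rule lext_add[OF \<phi>])

section \<open>Scalars and Laurent polynomials\<close>

lemma ring_hom_single0: "ring_hom (single (0 :: 'k::comm_monoid_add))"
  by (rule ring_homI) (simp_all add: single_add mult_single)

lemma lookup_scal: "lookup (scal c F) \<alpha> = c * lookup F \<alpha>"
  unfolding scal_def mult_map_scale_conv_mult[symmetric] by transfer (simp add: when_def)

lemma scal_single: "scal c (single \<alpha> d) = single \<alpha> (c * d)"
  by (simp add: scal_def mult_single)

lemma scal_add: "scal c (F + G) = scal c F + scal c G"
  by (simp add: scal_def algebra_simps)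

lemma scal_diff: "scal c (F - G) = scal c F - scal c G"
  by (simp add: scal_def algebra_simps)

lemma scal_uminus: "scal c (- F) = - scal c F"
  by (simp add: scal_def)

lemma scal_add_left: "scal (c + d) F = scal c F + scal d F"
  by (simp add: scal_def single_add algebra_simps)

lemma scal_diff_left: "scal (c - d) F = scal c F - scal d F"
  by (simp add: scal_def single_diff algebra_simps)

lemma scal_0 [simp]: "scal 0 F = 0" "scal c 0 = 0"
  by (simp_all add: scal_def)

lemma scal_1 [simp]: "scal 1 F = F"
  by (simp add: scal_def)

lemma scal_scal [simp]: "scal c (scal d F) = scal (c * d) F"
  by (simp add: scal_def mult_single flip: mult.assoc)

lemma scal_mult_left: "scal c F * G = scal c (F * G)"
  by (simp add: scal_def mult_ac)

lemma scal_mult_right: "F * scal c G = scal c (F * G)"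
  by (simp add: scal_def mult_ac)

lemma scal_sum: "scal c (sum f A) = (\<Sum>x\<in>A. scal c (f x))"
  by (simp add: scal_def sum_distrib_left)

lemma zero_in_laurent [simp]: "0 \<in> laurent m"
  by (simp add: laurent_def)

lemma one_in_laurent [simp]: "1 \<in> laurent m"
  by (simp add: laurent_def)

lemma add_in_laurent: "F \<in> laurent m \<Longrightarrow> G \<in> laurent m \<Longrightarrow> F + G \<in> laurent m"
  using keys_add[of F G] by (fastforce simp: laurent_def)

lemma mult_in_laurent: "F \<in> laurent m \<Longrightarrow> G \<in> laurent m \<Longrightarrow> F * G \<in> laurent m"
proof -
  assume F: "F \<in> laurent m" and G: "G \<in> laurent m"
  have "keys (a + b) \<subseteq> {1..m}" if "a \<in> keys F" "b \<in> keys G" for a b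
    using keys_add[of a b] F G that unfolding laurent_def by blast
  with keys_mult[of F G] show ?thesis unfolding laurent_def by blast
qed

lemma single_in_laurent: "keys \<alpha> \<subseteq> {1..m} \<Longrightarrow> single \<alpha> c \<in> laurent m"
  by (auto simp: laurent_def)

lemma scal_in_laurent: "F \<in> laurent m \<Longrightarrow> scal c F \<in> laurent m"
  unfolding scal_def by (intro mult_in_laurent single_in_laurent) auto

lemma uminus_in_laurent: "F \<in> laurent m \<Longrightarrow> - F \<in> laurent m"
  for F :: "'a::comm_ring_1 lpoly"
  by (auto simp: laurent_def in_keys_iff)

lemma diff_in_laurent: "F \<in> laurent m \<Longrightarrow> G \<in> laurent m \<Longrightarrow> F - G \<in> laurent m"
  for F :: "'a::comm_ring_1 lpoly"
  using add_in_laurent[of F m "- G"] uminus_in_laurent[of G m] by simp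

lemma sum_in_laurent: "(\<And>x. x \<in> A \<Longrightarrow> f x \<in> laurent m) \<Longrightarrow> sum f A \<in> laurent m"
  by (induction A rule: infinite_finite_induct) (auto intro: add_in_laurent)

lemma prod_in_laurent: "(\<And>x. x \<in> A \<Longrightarrow> f x \<in> laurent m) \<Longrightarrow> prod f A \<in> laurent m"
  by (induction A rule: infinite_finite_induct) (auto intro: mult_in_laurent)

lemmas laurent_closed = add_in_laurent mult_in_laurent scal_in_laurent uminus_in_laurent
  diff_in_laurent sum_in_laurent prod_in_laurent

section \<open>Powers of the variables and substitutions\<close>

lemma tt_nonzero [simp]: "tt \<noteq> 0"
  by (simp add: tt_def embed_def t_Qt_def)

lemma qq_nonzero [simp]: "qq \<noteq> 0"
  by (simp add: qq_def)

lemma Xpow_0 [simp]: "Xpow m j 0 = 1"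
  by (simp add: Xpow_def)

lemma Xpow_add: "Xpow m j (a + b) = Xpow m j a * Xpow m j b"
  by (simp add: Xpow_def mult_single single_add power_int_add)

lemma Xpow_inverse: "Xpow m j (- k) * Xpow m j k = 1"
  using Xpow_add[of m j "- k" k] by simp

lemma Xpow_in_laurent [simp]:
  assumes "m \<ge> 1"
  shows "Xpow m j k \<in> laurent m"
proof -
  have "(j - 1) mod int m < int m" "(j - 1) mod int m \<ge> 0" using assms by simp_all
  then have "nat ((j - 1) mod int m + 1) \<in> {1..m}" by (auto simp: nat_le_iff)
  then show ?thesis unfolding Xpow_def
    by (intro single_in_laurent) (simp add: keys_single)
qed

lemma Xpow_shift:
  assumes "m \<ge> 1"
  shows "Xpow m (j + int m * d) k = scal ((qq powi (- d)) powi k) (Xpow m j k)"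
proof -
  have "(j + int m * d - 1) div int m = d + (j - 1) div int m"
       "(j + int m * d - 1) mod int m = (j - 1) mod int m"
    using assms div_mult_self2[of "int m" "j - 1" d] mod_mult_self2[of "j - 1" "int m" d]
    by (simp_all add: algebra_simps)
  then show ?thesis
    by (simp add: Xpow_def scal_single power_int_diff power_int_minus power_int_divide_distrib
        power_int_inverse power_int_mult_distrib power_int_add field_simps)
qed

lemma Xpow_small:
  assumes "1 \<le> j" "j \<le> m"
  shows "Xpow m (int j) k = single (single j k) 1"
proof -
  have "(int j - 1) mod int m = int j - 1" "(int j - 1) div int m = 0" using assms by auto
  then show ?thesis by (simp add: Xpow_def)
qed

abbreviation coef :: "Qqt \<Rightarrow> Qqt lpoly" where
  "coef \<equiv> single 0"

lemma subst_lext: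
  "subst m \<sigma> = lext coef (\<lambda>\<alpha>. \<Prod>i=1..m. Xpow m (\<sigma> (int i)) (lookup \<alpha> i))"
  by (rule ext) (simp add: subst_def lext_def scal_def)

lemma subst_ring_hom: "ring_hom (subst m \<sigma>)"
  unfolding subst_lext
  by (rule lext_ring_hom) (auto simp: ring_hom_single0 lookup_add Xpow_add prod.distrib)

lemmas subst_simps = ring_hom_1[OF subst_ring_hom] ring_hom_add[OF subst_ring_hom]
  ring_hom_mult[OF subst_ring_hom] ring_hom_0[OF subst_ring_hom]
  ring_hom_uminus[OF subst_ring_hom] ring_hom_diff[OF subst_ring_hom]

lemma subst_scal: "subst m \<sigma> (scal c F) = scal c (subst m \<sigma> F)"
proof -
  have "subst m \<sigma> (coef c) = coef c"
    unfolding subst_lext by (simp add: lext_single ring_hom_single0)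
  then show ?thesis by (simp add: scal_def subst_simps)
qed

lemma subst_in_laurent: "m \<ge> 1 \<Longrightarrow> subst m \<sigma> F \<in> laurent m"
  unfolding subst_def by (auto intro!: laurent_closed)

text \<open>The extension of an index map from \<open>{1..m}\<close> to all integers that is compatible with
  \<open>X\<^bsub>i+m\<^esub> = X\<^sub>i/q\<close>.\<close>

definition ext_index :: "nat \<Rightarrow> (int \<Rightarrow> int) \<Rightarrow> int \<Rightarrow> int" where
  "ext_index m \<sigma> j = \<sigma> ((j - 1) mod int m + 1) + int m * ((j - 1) div int m)"

lemma ext_index_small: "1 \<le> j \<Longrightarrow> j \<le> int m \<Longrightarrow> ext_index m \<sigma> j = \<sigma> j"
  by (simp add: ext_index_def)

lemma ext_index_next:
  assumes "1 \<le> m"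
  shows "ext_index m \<sigma> (int m + 1) = \<sigma> 1 + int m"
  using assms by (simp add: ext_index_def)

lemma subst_Xpow_small:
  assumes "1 \<le> j" "j \<le> m"
  shows "subst m \<sigma> (Xpow m (int j) k) = Xpow m (\<sigma> (int j)) k"
proof -
  have "(\<Prod>i=1..m. Xpow m (\<sigma> (int i)) (lookup (single j k) i)) =
        (\<Prod>i\<in>{1..m}. if i = j then Xpow m (\<sigma> (int i)) k else 1)"
    by (intro prod.cong) (auto simp: lookup_single when_def)
  also have "\<dots> = Xpow m (\<sigma> (int j)) k" using assms by (simp add: prod.delta)
  finally show ?thesis unfolding subst_lext Xpow_small[OF assms]
    by (simp add: lext_single ring_hom_single0)
qed

lemma subst_Xpow:
  assumes "1 \<le> m"
  shows "subst m \<sigma> (Xpow m j k) = Xpow m (ext_index m \<sigma> j) k"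
proof -
  define j' d where "j' = nat ((j - 1) mod int m + 1)" and "d = (j - 1) div int m"
  have m0: "(j - 1) mod int m < int m" "(j - 1) mod int m \<ge> 0" using assms by simp_all
  have j': "1 \<le> j'" "j' \<le> m" using m0 by (auto simp: j'_def nat_le_iff)
  have ij: "int j' = (j - 1) mod int m + 1" using m0 by (simp add: j'_def)
  have j: "j = int j' + int m * d"
    using mult_div_mod_eq[of "int m" "j - 1"] by (simp add: ij d_def algebra_simps)
  have "subst m \<sigma> (Xpow m j k) = Xpow m (\<sigma> (int j') + int m * d) k"
    unfolding j Xpow_shift[OF assms] subst_scal subst_Xpow_small[OF j'] ..
  then show ?thesis by (simp add: ext_index_def ij d_def)
qed

text \<open>The inner map may leave {1..m}, so the outer one acts through its quasi-periodic
  extension.\<close>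

lemma subst_subst:
  assumes "1 \<le> m"
  shows "subst m \<sigma> (subst m \<tau> F) = subst m (\<lambda>j. ext_index m \<sigma> (\<tau> j)) F"
  unfolding subst_def[of m \<tau>] subst_def[of m "\<lambda>j. ext_index m \<sigma> (\<tau> j)"]
  by (simp add: ring_hom_sum[OF subst_ring_hom] ring_hom_prod[OF subst_ring_hom] subst_scal
      subst_Xpow[OF assms])

lemma subst_cong:
  "(\<And>j. 1 \<le> j \<Longrightarrow> j \<le> int m \<Longrightarrow> \<sigma> j = \<tau> j) \<Longrightarrow> subst m \<sigma> F = subst m \<tau> F"
  by (simp add: subst_def)

lemma single_eq_prod_Xpow:
  assumes "keys \<alpha> \<subseteq> {1..m}"
  shows "(single \<alpha> c :: Qqt lpoly) =
    scal c (\<Prod>i=1..m. Xpow m (int i) (lookup \<alpha> i))"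
proof -
  have "(\<Prod>i\<in>B. Xpow m (int i) (lookup \<alpha> i)) =
      single (\<Sum>i\<in>B. single i (lookup \<alpha> i)) (1::Qqt)"
    if "finite B" "B \<subseteq> {1..m}" for B
    using that by (induction B rule: finite_induct) (auto simp: Xpow_small mult_single)
  note this[of "{1..m}"]
  moreover have "(\<Sum>i=1..m. single i (lookup \<alpha> i)) = \<alpha>"
    using assms by (intro poly_mapping_eqI) (auto simp: lookup_sum lookup_single when_def in_keys_iff)
  ultimately show ?thesis by (simp add: scal_single)
qed

lemma subst_id:
  assumes "F \<in> laurent m"
  shows "subst m (\<lambda>j. j) F = F"
proof -
  have "subst m (\<lambda>j. j) F = (\<Sum>\<alpha>\<in>keys F. single \<alpha> (lookup F \<alpha>))"
    unfolding subst_def using assms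
    by (intro sum.cong refl single_eq_prod_Xpow[symmetric]) (auto simp: laurent_def)
  then show ?thesis by (simp flip: poly_mapping_decomp)
qed

section \<open>The operators \<open>T\<^sub>i\<close> and \<open>\<Pi>\<close>\<close>

definition Xratio :: "nat \<Rightarrow> int \<Rightarrow> Qqt lpoly" where
  "Xratio m i = Xpow m i 1 * Xpow m (i + 1) (-1)"

text \<open>Relational form of \<open>div_diff\<close>: quotients are exhibited and manipulated
  freely, and uniqueness identifies them afterwards with the value of the description
  operator.\<close>

definition is_div_diff :: "nat \<Rightarrow> int \<Rightarrow> Qqt lpoly \<Rightarrow> Qqt lpoly \<Rightarrow> bool" where
  "is_div_diff m i F D \<longleftrightarrow> D \<in> laurent m \<and> (1 - Xratio m i) * D = F - s_op m i F"

text \<open>The indices i and i+1 have different residues modulo m, so the ratio has a nonzero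
  exponent vector.\<close>

lemma Xratio_neq_1:
  assumes "m \<ge> 2"
  shows "Xratio m i \<noteq> 1"
proof
  assume eq: "Xratio m i = 1"
  define a b where "a = nat ((i - 1) mod int m + 1)" and "b = nat (i mod int m + 1)"
  have "(i - 1) mod int m \<noteq> i mod int m"
    using assms by (simp add: mod_eq_dvd_iff)
  moreover have "(i - 1) mod int m \<ge> 0" "i mod int m \<ge> 0" using assms by simp_all
  ultimately have "a \<noteq> b" by (simp add: a_def b_def)
  define \<beta> :: "nat \<Rightarrow>\<^sub>0 int" where "\<beta> = single a 1 + single b (-1)"
  have "lookup \<beta> a = 1" using \<open>a \<noteq> b\<close> by (simp add: \<beta>_def lookup_add lookup_single)
  then have "\<beta> \<noteq> 0" by auto
  obtain c where "Xratio m i = single \<beta> c" "c \<noteq> 0"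
    by (simp add: Xratio_def Xpow_def mult_single a_def b_def \<beta>_def)
  with eq have "single \<beta> c = single 0 (1::Qqt)" by simp
  then have "keys (single \<beta> c) = keys (single (0::nat \<Rightarrow>\<^sub>0 int) (1::Qqt))"
    by simp
  with \<open>c \<noteq> 0\<close> \<open>\<beta> \<noteq> 0\<close> show False by simp
qed

lemma div_diff_eqI:
  assumes "m \<ge> 2" "is_div_diff m i F D"
  shows "div_diff m i F = D"
  unfolding div_diff_def
proof (rule the_equality)
  show "D \<in> laurent m \<and> (1 - Xpow m i 1 * Xpow m (i + 1) (- 1)) * D = F - s_op m i F"
    using assms by (simp add: is_div_diff_def Xratio_def)
next
  fix D' assume "D' \<in> laurent m \<and> (1 - Xpow m i 1 * Xpow m (i + 1) (- 1)) * D' = F - s_op m i F"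
  then have "(1 - Xratio m i) * D' = (1 - Xratio m i) * D"
    using assms by (simp add: is_div_diff_def Xratio_def)
  then show "D' = D" using Xratio_neq_1[OF assms(1), of i] by simp
qed

lemma ext_index_Suc [simp]: "ext_index m (\<lambda>j. j + 1) j = j + 1"
  using mult_div_mod_eq[of "int m" "j - 1"] by (simp add: ext_index_def)

lemma ext_index_pred [simp]: "ext_index m (\<lambda>j. j - 1) j = j - 1"
  using mult_div_mod_eq[of "int m" "j - 1"] by (simp add: ext_index_def)

lemma Pi_op_in_laurent: "m \<ge> 1 \<Longrightarrow> Pi_op m F \<in> laurent m"
  unfolding Pi_op_def by (intro laurent_closed) (auto intro: subst_in_laurent)

lemma Pi_op_add: "Pi_op m (F + G) = Pi_op m F + Pi_op m G"
  by (simp add: Pi_op_def subst_simps algebra_simps)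

lemma Pi_op_diff: "Pi_op m (F - G) = Pi_op m F - Pi_op m G"
  by (simp add: Pi_op_def subst_simps algebra_simps)

lemma Pi_op_0 [simp]: "Pi_op m 0 = 0"
  by (simp add: Pi_op_def subst_simps)

lemma Pi_op_scal: "Pi_op m (scal c F) = scal c (Pi_op m F)"
  by (simp add: Pi_op_def subst_scal scal_mult_right)

lemma Pi_op_mult: "Pi_op m (G * F) = subst m (\<lambda>j. j + 1) G * Pi_op m F"
  by (simp add: Pi_op_def subst_simps algebra_simps)

lemma Pi_op_Xpow: "m \<ge> 1 \<Longrightarrow> Pi_op m (Xpow m j k * F) = Xpow m (j + 1) k * Pi_op m F"
  by (simp add: Pi_op_mult subst_Xpow)

lemma Pi_op_surj:
  assumes "m \<ge> 1" "F \<in> laurent m"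
  obtains G where "G \<in> laurent m" "F = Pi_op m G"
proof
  let ?G = "subst m (\<lambda>j. j - 1) (Xpow m 1 (-1) * F)"
  show "?G \<in> laurent m" using assms by (simp add: subst_in_laurent)
  have "Xpow m 1 (-1) * F \<in> laurent m" using assms by (simp add: laurent_closed)
  then show "F = Pi_op m ?G"
    using Xpow_inverse[of m 1 1] unfolding Pi_op_def
    by (simp add: subst_subst[OF assms(1)] subst_id mult.commute mult.left_commute)
qed

definition swap_index :: "int \<Rightarrow> int \<Rightarrow> int" where
  "swap_index r j = (if j = r then r + 1 else if j = r + 1 then r else j)"

lemma s_op_nonzero: "i mod int m \<noteq> 0 \<Longrightarrow> s_op m i = subst m (swap_index (i mod int m))"
  by (rule ext) (simp add: s_op_def Let_def swap_index_def[abs_def])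

lemma s_op_zero:
  "i mod int m = 0 \<Longrightarrow> s_op m i F = Xpow m 1 1 * Xpow m 0 (-1) *
        subst m (\<lambda>j. if j = 1 then 0 else if j = int m then int m + 1 else j) F"
  by (simp add: s_op_def)

text \<open>The last condition is the comparison at the wrap-around index m, whose successor m+1 is
  the index 1 raised by a period.\<close>

lemma subst_Suc_commute:
  assumes m: "1 \<le> m" and \<sigma>: "\<And>j. 1 \<le> j \<Longrightarrow> j + 1 \<le> int m \<Longrightarrow> \<sigma>' (j + 1) = \<sigma> j + 1"
    "\<sigma>' 1 + int m = \<sigma> (int m) + 1"
  shows "subst m \<sigma>' (subst m (\<lambda>j. j + 1) F) = subst m (\<lambda>j. j + 1) (subst m \<sigma> F)"
  unfolding subst_subst[OF m]
proof (rule subst_cong)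
  fix j assume j: "1 \<le> j" "j \<le> int m"
  show "ext_index m \<sigma>' (j + 1) = ext_index m (\<lambda>j. j + 1) (\<sigma> j)"
  proof (cases "j = int m")
    case True
    then show ?thesis using m \<sigma>(2) by (simp add: ext_index_next)
  next
    case False
    then show ?thesis using j \<sigma>(1) by (simp add: ext_index_small)
  qed
qed

text \<open>Unless i is 0 or -1 modulo m, the swap leaves the prefactor X_1 of Pi alone. At these
  two residues it moves the prefactor, and the factor X_1/X_0 in s_0 compensates.\<close>

lemma s_op_Pi:
  assumes m: "m \<ge> 2"
  shows "s_op m (i + 1) (Pi_op m F) = Pi_op m (s_op m i F)"
proof -
  define r where "r = i mod int m"
  have r: "0 \<le> r" "r < int m" using m by (simp_all add: r_def)
  have next_mod: "(i + 1) mod int m = (if r = int m - 1 then 0 else r + 1)"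
  proof -
    have "(i + 1) mod int m = (r + 1) mod int m" by (simp add: r_def mod_add_left_eq)
    then show ?thesis using r by auto
  qed
  let ?z = "\<lambda>j. if j = 1 then 0 else if j = int m then int m + 1 else j"
  consider "r = 0" | "r = int m - 1" "r \<noteq> 0" | "r \<noteq> 0" "r \<noteq> int m - 1" by blast
  then show ?thesis
  proof cases
    case 1
    have "(i + 1) mod int m = 1" using next_mod 1 m by simp
    moreover have "subst m (swap_index 1) (subst m (\<lambda>j. j + 1) F) = subst m (\<lambda>j. j + 1) (subst m ?z F)"
      using m by (intro subst_Suc_commute) (auto simp: swap_index_def)
    moreover have "Xpow m 1 (-1) * Xpow m 1 1 = 1" using Xpow_inverse[of m 1 1] by simp
    ultimately show ?thesis using m 1
      by (simp add: s_op_nonzero s_op_zero r_def Pi_op_def subst_simps subst_Xpow ext_index_small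
          swap_index_def mult_ac flip: mult.assoc)
  next
    case 2
    have "(i + 1) mod int m = 0" using next_mod 2 by simp
    moreover have "subst m ?z (subst m (\<lambda>j. j + 1) F) = subst m (\<lambda>j. j + 1) (subst m (swap_index r) F)"
      using m 2 by (intro subst_Suc_commute) (auto simp: swap_index_def)
    moreover have "Xpow m 0 (-1) * Xpow m 0 1 = 1" using Xpow_inverse[of m 0 1] by simp
    ultimately show ?thesis using m 2
      by (simp add: s_op_nonzero s_op_zero flip: r_def)
         (simp add: Pi_op_def subst_simps subst_Xpow ext_index_small mult_ac flip: mult.assoc)
  next
    case 3
    have "(i + 1) mod int m = r + 1" "r + 1 \<noteq> 0" using next_mod 3 r by simp_all
    moreover have "subst m (swap_index (r + 1)) (subst m (\<lambda>j. j + 1) F) =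
        subst m (\<lambda>j. j + 1) (subst m (swap_index r) F)"
      using m 3 r by (intro subst_Suc_commute) (auto simp: swap_index_def)
    ultimately show ?thesis using m 3 r
      by (simp add: s_op_nonzero flip: r_def)
         (simp add: Pi_op_def subst_simps subst_Xpow ext_index_small swap_index_def)
  qed
qed

lemma is_div_diff_Pi:
  assumes "m \<ge> 2" "is_div_diff m i F D"
  shows "is_div_diff m (i + 1) (Pi_op m F) (Pi_op m D)"
proof -
  have "subst m (\<lambda>j. j + 1) (1 - Xratio m i) = 1 - Xratio m (i + 1)"
    using assms(1) by (simp add: subst_simps Xratio_def subst_Xpow)
  moreover have "(1 - Xratio m i) * D = F - s_op m i F" using assms by (simp add: is_div_diff_def)
  ultimately have "(1 - Xratio m (i + 1)) * Pi_op m D = Pi_op m (F - s_op m i F)"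
    by (metis Pi_op_mult)
  then show ?thesis
    using assms by (simp add: is_div_diff_def Pi_op_in_laurent Pi_op_diff s_op_Pi)
qed

section \<open>Existence of divided differences\<close>

lemma s_op_1: "m \<ge> 2 \<Longrightarrow> s_op m 1 = subst m (swap_index 1)"
  using s_op_nonzero[of 1 m] by simp

lemma is_div_diff_add:
  assumes "is_div_diff m i F D" "is_div_diff m i G E"
  shows "is_div_diff m i (F + G) (D + E)"
proof -
  have "s_op m i (F + G) = s_op m i F + s_op m i G"
    by (simp add: s_op_def Let_def subst_simps algebra_simps)
  moreover have "(1 - Xratio m i) * (D + E) = (F - s_op m i F) + (G - s_op m i G)"
    using assms by (simp add: is_div_diff_def distrib_left)
  ultimately show ?thesis using assms by (simp add: is_div_diff_def add_in_laurent)
qed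

lemma s_op_scal: "s_op m i (scal c F) = scal c (s_op m i F)"
  by (simp add: s_op_def Let_def subst_scal scal_mult_right)

lemma is_div_diff_scal:
  assumes "is_div_diff m i F D"
  shows "is_div_diff m i (scal c F) (scal c D)"
  using assms by (simp add: is_div_diff_def scal_in_laurent s_op_scal scal_mult_right flip: scal_diff)

lemma is_div_diff_0: "is_div_diff m i 0 0"
  by (simp add: is_div_diff_def s_op_def Let_def subst_simps)

lemma is_div_diff_1_1: "m \<ge> 2 \<Longrightarrow> is_div_diff m 1 1 0"
  by (simp add: is_div_diff_def s_op_1 subst_simps)

text \<open>The twisted Leibniz rule. With it, existence of the quotient has to be checked only on
  the variables and their inverses.\<close>

lemma is_div_diff_mult:
  assumes "m \<ge> 2" "is_div_diff m 1 F D" "is_div_diff m 1 G E" "G \<in> laurent m"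
  shows "is_div_diff m 1 (F * G) (D * G + s_op m 1 F * E)"
proof -
  let ?r = "1 - Xratio m 1"
  have "?r * (D * G + s_op m 1 F * E) = (?r * D) * G + s_op m 1 F * (?r * E)"
    by (simp add: algebra_simps)
  also have "\<dots> = F * G - s_op m 1 (F * G)"
    using assms by (simp add: is_div_diff_def s_op_1 subst_simps) (simp add: algebra_simps)
  finally show ?thesis using assms
    by (simp add: is_div_diff_def s_op_1 laurent_closed subst_in_laurent)
qed

lemma s_op_1_Xpow:
  assumes "m \<ge> 2"
  shows "s_op m 1 (Xpow m j k) = Xpow m (ext_index m (swap_index 1) j) k"
  using assms by (simp add: s_op_1 subst_Xpow)

lemma ext_swap_1:
  assumes "m \<ge> 2"
  shows "ext_index m (swap_index 1) 1 = 2" "ext_index m (swap_index 1) 2 = 1"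
    "(j - 1) mod int m \<notin> {0, 1} \<Longrightarrow> ext_index m (swap_index 1) j = j"
  using assms mult_div_mod_eq[of "int m" "j - 1"]
  by (simp_all add: ext_index_small swap_index_def) (simp add: ext_index_def swap_index_def)

lemma Xpow_m1_1: "Xpow m j (-1) * (Xpow m j 1 * F) = F" "Xpow m j 1 * (Xpow m j (-1) * F) = F"
  using Xpow_inverse[of m j 1] by (metis mult.assoc mult.commute mult.left_neutral)+

lemma is_div_diff_X12:
  assumes "m \<ge> 2"
  shows is_div_diff_X1: "is_div_diff m 1 (Xpow m 1 1) (- Xpow m 2 1)"
    and is_div_diff_X2: "is_div_diff m 1 (Xpow m 2 1) (Xpow m 2 1)"
    and is_div_diff_X1_inverse: "is_div_diff m 1 (Xpow m 1 (-1)) (Xpow m 1 (-1))"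
    and is_div_diff_X2_inverse: "is_div_diff m 1 (Xpow m 2 (-1)) (- Xpow m 1 (-1))"
  using assms Xpow_inverse[of m 2 1]
  by (simp_all add: is_div_diff_def uminus_in_laurent s_op_1_Xpow ext_swap_1 Xratio_def algebra_simps
      Xpow_m1_1)

lemma is_div_diff_Xj:
  "m \<ge> 2 \<Longrightarrow> (j - 1) mod int m \<notin> {0, 1} \<Longrightarrow> is_div_diff m 1 (Xpow m j k) 0"
  by (simp add: is_div_diff_def s_op_1_Xpow ext_swap_1)

lemma ex_div_diff_mult:
  assumes "m \<ge> 2" "\<exists>D. is_div_diff m 1 F D" "\<exists>E. is_div_diff m 1 G E" "G \<in> laurent m"
  shows "\<exists>D. is_div_diff m 1 (F * G) D"
  using assms is_div_diff_mult by blast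

lemma ex_div_diff_Xpow:
  assumes m: "m \<ge> 2" and j: "j \<in> {1..m}"
  shows "\<exists>D. is_div_diff m 1 (Xpow m (int j) k) D"
proof (cases "j = 1 \<or> j = 2")
  case False
  with j have "(int j - 1) mod int m = int j - 1" by auto
  moreover have "int j - 1 \<notin> {0, 1}" using False by auto
  ultimately show ?thesis using is_div_diff_Xj[OF m, of "int j"] by auto
next
  case True
  then have base: "\<exists>D. is_div_diff m 1 (Xpow m (int j) 1) D" "\<exists>D. is_div_diff m 1 (Xpow m (int j) (-1)) D"
    using is_div_diff_X1[OF m] is_div_diff_X2[OF m] is_div_diff_X1_inverse[OF m]
      is_div_diff_X2_inverse[OF m] by auto
  show ?thesis
  proof (induction k rule: int_induct[where k = 0])
    case base
    then show ?case using is_div_diff_1_1[OF m] by auto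
  next
    case (step1 i)
    then show ?case using ex_div_diff_mult[OF m _ base(1)] m by (simp add: Xpow_add)
  next
    case (step2 i)
    then show ?case using ex_div_diff_mult[OF m _ base(2)] m Xpow_add[of m "int j" i "-1"] by simp
  qed
qed

lemma ex_div_diff_1:
  assumes m: "m \<ge> 2" and F: "F \<in> laurent m"
  shows "\<exists>D. is_div_diff m 1 F D"
proof -
  have prod: "\<exists>D. is_div_diff m 1 (\<Prod>i\<in>B. Xpow m (int i) (\<alpha> i)) D" if "finite B" "B \<subseteq> {1..m}" for B \<alpha>
    using that
  proof (induction B rule: finite_induct)
    case empty
    then show ?case using is_div_diff_1_1[OF m] by auto
  next
    case (insert i B)
    then show ?case using m
      by (auto intro!: ex_div_diff_mult ex_div_diff_Xpow prod_in_laurent)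
  qed
  have sum: "\<exists>D. is_div_diff m 1 (sum f K) D" if "finite K" "\<And>\<alpha>. \<alpha> \<in> K \<Longrightarrow> \<exists>D. is_div_diff m 1 (f \<alpha>) D" for f :: "(nat \<Rightarrow>\<^sub>0 int) \<Rightarrow> _" and K
    using that
  proof (induction K rule: finite_induct)
    case empty
    then show ?case using is_div_diff_0 by auto
  next
    case (insert a K)
    then show ?case using is_div_diff_add by (metis insert_iff sum.insert)
  qed
  \<comment> \<open>The identity substitution displays \<open>F\<close> as a linear combination of
    products of powers of the variables.\<close>
  have "\<exists>D. is_div_diff m 1 (subst m (\<lambda>j. j) F) D"
    unfolding subst_def
  proof (rule sum)
    fix \<alpha> :: "nat \<Rightarrow>\<^sub>0 int"
    obtain D where "is_div_diff m 1 (\<Prod>i=1..m. Xpow m (int i) (lookup \<alpha> i)) D"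
      using prod[of "{1..m}"] by auto
    from is_div_diff_scal[OF this]
    show "\<exists>D. is_div_diff m 1 (scal (lookup F \<alpha>)
        (\<Prod>i=1..m. Xpow m (int i) (lookup \<alpha> i))) D" by blast
  qed simp
  then show ?thesis by (simp add: subst_id[OF F])
qed

text \<open>Every Laurent polynomial lies in the image of Pi, and conjugation by Pi raises the index
  of T_i by one, so a statement about T_i with i \<ge> 1 reduces to T_1. The index is not bounded by
  m; the node 0 is thereby covered as index m.\<close>

lemma Pi_conj_induct [consumes 3, case_names base step]:
  assumes "m \<ge> 1" "1 \<le> i" "F \<in> laurent m"
    and "\<And>F. F \<in> laurent m \<Longrightarrow> P 1 F"
    and "\<And>i F. 1 \<le> i \<Longrightarrow> F \<in> laurent m \<Longrightarrow> P i F \<Longrightarrow> P (i + 1) (Pi_op m F)"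
  shows "P (i::int) F"
  using assms(2,3)
proof (induction i arbitrary: F rule: int_ge_induct)
  case (step i)
  obtain G where "G \<in> laurent m" "F = Pi_op m G" using Pi_op_surj[OF assms(1) step.prems] .
  with step assms(5) show ?case by blast
qed (use assms(4) in blast)

lemma ex_div_diff:
  assumes "m \<ge> 2" "1 \<le> i" "F \<in> laurent m"
  shows "\<exists>D. is_div_diff m i F D"
proof -
  have "1 \<le> m" using assms by simp
  from this assms(2,3) show ?thesis
    by (induction rule: Pi_conj_induct) (use ex_div_diff_1 is_div_diff_Pi assms(1) in blast)+
qed

lemma div_diff:
  assumes "m \<ge> 2" "1 \<le> i" "F \<in> laurent m"
  shows "is_div_diff m i F (div_diff m i F)"
  using ex_div_diff[OF assms] div_diff_eqI[OF assms(1)] by blast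

section \<open>Linearity and relations of the operators T_i\<close>

lemma T_op_eqI:
  assumes "m \<ge> 2" "is_div_diff m i F D"
  shows "T_op m i F = scal tt (s_op m i F) + scal (tt - 1) D"
  unfolding T_op_def div_diff_eqI[OF assms] ..

lemma s_op_in_laurent: "m \<ge> 1 \<Longrightarrow> s_op m i F \<in> laurent m"
  by (auto simp: s_op_def Let_def intro!: laurent_closed subst_in_laurent)

lemma T_op_in_laurent:
  assumes "m \<ge> 2" "1 \<le> i" "F \<in> laurent m"
  shows "T_op m i F \<in> laurent m"
  using div_diff[OF assms] assms(1) unfolding T_op_def is_div_diff_def
  by (intro laurent_closed s_op_in_laurent) auto

lemma T_op_add:
  assumes "m \<ge> 2" "1 \<le> i" "F \<in> laurent m" "G \<in> laurent m"
  shows "T_op m i (F + G) = T_op m i F + T_op m i G"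
proof -
  have "s_op m i (F + G) = s_op m i F + s_op m i G"
    by (simp add: s_op_def Let_def subst_simps algebra_simps)
  then show ?thesis
    using T_op_eqI[OF assms(1) is_div_diff_add[OF div_diff div_diff]] assms
    by (simp add: T_op_def[of m i F] T_op_def[of m i G] scal_add)
qed

lemma T_op_scal:
  assumes "m \<ge> 2" "1 \<le> i" "F \<in> laurent m"
  shows "T_op m i (scal c F) = scal c (T_op m i F)"
  using T_op_eqI[OF assms(1) is_div_diff_scal[OF div_diff[OF assms]]]
  by (simp add: T_op_def[of m i F] scal_add s_op_scal mult.commute)

lemma T_op_diff:
  assumes "m \<ge> 2" "1 \<le> i" "F \<in> laurent m" "G \<in> laurent m"
  shows "T_op m i (F - G) = T_op m i F - T_op m i G"
proof -
  have "F - G = F + scal (-1) G" by (simp add: scal_def single_uminus)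
  then have "T_op m i (F - G) = T_op m i F + scal (-1) (T_op m i G)"
    using assms by (simp only: T_op_add T_op_scal laurent_closed)
  then show ?thesis by (simp add: scal_def single_uminus)
qed

lemma T_op_Pi:
  assumes "m \<ge> 2" "1 \<le> i" "F \<in> laurent m"
  shows "T_op m (i + 1) (Pi_op m F) = Pi_op m (T_op m i F)"
  using T_op_eqI[OF assms(1) is_div_diff_Pi[OF assms(1) div_diff[OF assms]]] assms
  by (simp add: T_op_def[of m i F] s_op_Pi Pi_op_add Pi_op_scal)

lemma coef_tt_minus_1: "coef (tt - 1) = coef tt - 1"
  by (simp add: single_diff)

text \<open>Taking a single variable for \<open>F\<close> gives the Bernstein relations between T_1
  and multiplication by variables.\<close>

lemma T_op_1_mult:
  assumes "m \<ge> 2" "is_div_diff m 1 F D" "G \<in> laurent m"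
  shows "T_op m 1 (F * G) = s_op m 1 F * T_op m 1 G + scal (tt - 1) (D * G)"
proof -
  note d = div_diff[OF assms(1) order_refl assms(3)]
  have "s_op m 1 (F * G) = s_op m 1 F * s_op m 1 G" using assms by (simp add: s_op_1 subst_simps)
  then show ?thesis
    unfolding T_op_eqI[OF assms(1) is_div_diff_mult[OF assms(1,2) d assms(3)]] T_op_def[of m 1 G]
    by (simp add: scal_def coef_tt_minus_1 algebra_simps)
qed

text \<open>Let D be the divided difference of \<open>F\<close> and \<theta> = X_1/X_2. Applying s_1
  to (1 - \<theta>) D = F - s_1 F gives s_1 D = \<theta> D. Hence -D is the divided difference of
  T_1 F, and the definition of T_1 yields the relation.\<close>

lemma T_op_quadratic:
  assumes "m \<ge> 2" "1 \<le> i" "F \<in> laurent m"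
  shows "T_op m i (T_op m i F) = scal (tt - 1) (T_op m i F) + scal tt F"
proof -
  have "1 \<le> m" using assms by simp
  from this assms(2,3) show ?thesis
  proof (induction rule: Pi_conj_induct)
    case (base F)
    let ?s = "s_op m 1" and ?\<theta> = "Xratio m 1" and ?t = "coef tt"
    define D where "D = div_diff m 1 F"
    have d: "is_div_diff m 1 F D" unfolding D_def using assms(1) base by (intro div_diff) auto
    have hom: "ring_hom ?s" using assms(1) by (simp add: s_op_1 subst_ring_hom)
    have ss: "?s (?s F) = F" if "F \<in> laurent m" for F
    proof -
      have "?s (?s F) = subst m (\<lambda>j. j) F"
        using assms(1) by (simp add: s_op_1 subst_subst)
          (rule subst_cong, use assms(1) in \<open>auto simp: ext_index_small swap_index_def\<close>)
      then show ?thesis by (simp add: subst_id[OF that])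
    qed
    have dF: "(1 - ?\<theta>) * D = F - ?s F" and DL: "D \<in> laurent m" using d by (auto simp: is_div_diff_def)
    have s\<theta>: "?\<theta> * ?s ?\<theta> = 1"
      using assms(1) Xpow_inverse[of m 1 1] Xpow_inverse[of m 2 1] by (simp add: Xratio_def ring_hom_mult[OF hom] s_op_1_Xpow ext_swap_1 Xpow_m1_1 mult_ac)
    have ne: "1 - ?\<theta> \<noteq> 0" using Xratio_neq_1[OF assms(1)] by simp
    have "(1 - ?s ?\<theta>) * ?s D = ?s ((1 - ?\<theta>) * D)"
      by (simp add: ring_hom_mult[OF hom] ring_hom_diff[OF hom] ring_hom_1[OF hom])
    also have "\<dots> = ?s F - F" by (simp add: dF ring_hom_diff[OF hom] ss base)
    also have "\<dots> = - ((1 - ?\<theta>) * D)" by (simp add: dF)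
    finally have "?\<theta> * ((1 - ?s ?\<theta>) * ?s D) = - (?\<theta> * (1 - ?\<theta>) * D)" by simp
    moreover have "?\<theta> * ((1 - ?s ?\<theta>) * ?s D) = (?\<theta> - ?\<theta> * ?s ?\<theta>) * ?s D" by (simp add: algebra_simps)
    ultimately have "(1 - ?\<theta>) * ?s D = (1 - ?\<theta>) * (?\<theta> * D)"
      unfolding s\<theta> by (simp add: algebra_simps)
    then have sD: "?s D = ?\<theta> * D" using ne by simp
    have TF: "T_op m 1 F = ?t * ?s F + (?t - 1) * D"
      using T_op_eqI[OF assms(1) d] by (simp add: scal_def coef_tt_minus_1)
    have sTF: "?s (T_op m 1 F) = ?t * F + (?t - 1) * (?\<theta> * D)"
    proof -
      have "?s (T_op m 1 F) = ?s (scal tt (?s F)) + ?s (scal (tt - 1) D)"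
        using T_op_eqI[OF assms(1) d] ring_hom_add[OF hom] by metis
      also have "\<dots> = scal tt F + scal (tt - 1) (?\<theta> * D)" by (simp only: s_op_scal ss base sD)
      finally show ?thesis by (simp add: scal_def coef_tt_minus_1)
    qed
    have "(1 - ?\<theta>) * (- D) = T_op m 1 F - ?s (T_op m 1 F)"
    proof -
      have "T_op m 1 F - ?s (T_op m 1 F) = (?t - 1) * ((1 - ?\<theta>) * D) - ?t * (F - ?s F)"
        unfolding sTF by (simp add: TF algebra_simps)
      also have "\<dots> = (1 - ?\<theta>) * (- D)" unfolding dF[symmetric] by (simp add: algebra_simps)
      finally show ?thesis ..
    qed
    then have "is_div_diff m 1 (T_op m 1 F) (- D)"
      using DL by (simp add: is_div_diff_def uminus_in_laurent)
    from T_op_eqI[OF assms(1) this]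
    have "T_op m 1 (T_op m 1 F) = ?t * (?t * F + (?t - 1) * (?\<theta> * D)) - (?t - 1) * D"
      by (simp add: scal_def coef_tt_minus_1 sTF)
    also have "\<dots> = (?t - 1) * T_op m 1 F + ?t * F"
    proof -
      have "?t * (?t * F + (?t - 1) * (?\<theta> * D)) - (?t - 1) * D - ((?t - 1) * T_op m 1 F + ?t * F) =
          ?t * (?t - 1) * ((F - ?s F) - (1 - ?\<theta>) * D)"
        unfolding TF by (simp add: algebra_simps)
      then show ?thesis by (simp add: dF)
    qed
    finally show ?case by (simp add: scal_def coef_tt_minus_1)
  next
    case (step i F)
    then show ?case using assms(1)
      by (simp add: T_op_Pi T_op_in_laurent Pi_op_add Pi_op_scal)
  qed
qed

text \<open>A Bernstein relation: the right-hand side is t X_{i+1} T_i^{-1} F. Together with the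
  next two rules it moves T_i past any variable, which makes inductions over polynomials
  possible.\<close>

lemma T_op_X:
  assumes "m \<ge> 2" "1 \<le> i" "F \<in> laurent m"
  shows "T_op m i (Xpow m i 1 * F) = Xpow m (i + 1) 1 * (T_op m i F - scal (tt - 1) F)"
proof -
  have "1 \<le> m" using assms by simp
  from this assms(2,3) show ?thesis
  proof (induction rule: Pi_conj_induct)
    case (base F)
    show ?case using T_op_1_mult[OF assms(1) is_div_diff_X1[OF assms(1)] base] assms(1)
      by (simp add: s_op_1_Xpow ext_swap_1 scal_def algebra_simps)
  next
    case (step i F)
    have "T_op m (i + 1) (Xpow m (i + 1) 1 * Pi_op m F) = T_op m (i + 1) (Pi_op m (Xpow m i 1 * F))"
      using assms(1) by (simp add: Pi_op_Xpow)
    also have "\<dots> = Pi_op m (T_op m i (Xpow m i 1 * F))"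
      using assms(1) step.hyps by (intro T_op_Pi) (auto intro: laurent_closed)
    also have "\<dots> = Xpow m (i + 1 + 1) 1 * (Pi_op m (T_op m i F) - scal (tt - 1) (Pi_op m F))"
      unfolding step.IH using assms(1) by (simp only: Pi_op_Xpow Pi_op_diff Pi_op_scal)
    finally show ?case using assms(1) step.hyps by (simp only: T_op_Pi)
  qed
qed

lemma T_op_X_next:
  assumes "m \<ge> 2" "1 \<le> i" "F \<in> laurent m"
  shows "T_op m i (Xpow m (i + 1) 1 * F) = Xpow m i 1 * T_op m i F + scal (tt - 1) (Xpow m (i + 1) 1 * F)"
proof -
  have "1 \<le> m" using assms by simp
  from this assms(2,3) show ?thesis
  proof (induction rule: Pi_conj_induct)
    case (base F)
    show ?case using T_op_1_mult[OF assms(1) is_div_diff_X2[OF assms(1)] base] assms(1)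
      by (simp add: s_op_1_Xpow ext_swap_1)
  next
    case (step i F)
    have "T_op m (i + 1) (Xpow m (i + 1 + 1) 1 * Pi_op m F) =
        T_op m (i + 1) (Pi_op m (Xpow m (i + 1) 1 * F))"
      using assms(1) by (simp only: Pi_op_Xpow)
    also have "\<dots> = Pi_op m (T_op m i (Xpow m (i + 1) 1 * F))"
      using assms(1) step.hyps by (intro T_op_Pi) (auto intro: laurent_closed)
    also have "\<dots> = Xpow m (i + 1) 1 * Pi_op m (T_op m i F) + scal (tt - 1) (Xpow m (i + 1 + 1) 1 * Pi_op m F)"
      unfolding step.IH using assms(1) by (simp only: Pi_op_Xpow Pi_op_add Pi_op_scal)
    finally show ?case using assms(1) step.hyps by (simp only: T_op_Pi)
  qed
qed

lemma T_op_X_other: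
  assumes "m \<ge> 2" "1 \<le> i" "F \<in> laurent m" "(j - i) mod int m \<notin> {0, 1}"
  shows "T_op m i (Xpow m j 1 * F) = Xpow m j 1 * T_op m i F"
proof -
  have "1 \<le> m" using assms by simp
  from this assms(2,3,4) show ?thesis
  proof (induction arbitrary: j rule: Pi_conj_induct)
    case (base F)
    show ?case using T_op_1_mult[OF assms(1) is_div_diff_Xj[OF assms(1) base(2)] base(1)] assms(1) base(2)
      by (simp add: s_op_1_Xpow ext_swap_1)
  next
    case (step i F)
    have IH: "T_op m i (Xpow m (j - 1) 1 * F) = Xpow m (j - 1) 1 * T_op m i F"
      using step.prems by (intro step.IH) (simp add: algebra_simps)
    have P: "Pi_op m (Xpow m (j - 1) 1 * G) = Xpow m j 1 * Pi_op m G" for G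
      using assms(1) Pi_op_Xpow[of m "j - 1" 1 G] by simp
    have "T_op m (i + 1) (Xpow m j 1 * Pi_op m F) = Pi_op m (T_op m i (Xpow m (j - 1) 1 * F))"
      unfolding P[symmetric] using assms(1) step.hyps by (intro T_op_Pi) (auto intro: laurent_closed)
    also have "\<dots> = Xpow m j 1 * Pi_op m (T_op m i F)" unfolding IH P ..
    finally show ?case using assms(1) step.hyps by (simp only: T_op_Pi)
  qed
qed

text \<open>The bound i < m keeps away from the node 0, where s_0 sends 1 to X_1/X_0.\<close>

lemma T_op_one:
  assumes "1 \<le> i" "i < int m"
  shows "T_op m i 1 = scal tt 1"
proof -
  have "is_div_diff m i 1 0" "s_op m i 1 = 1"
    using assms by (simp_all add: is_div_diff_def s_op_nonzero subst_simps)
  then show ?thesis using T_op_eqI[of m i 1 0] assms by simp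
qed

text \<open>Raising the index by m multiplies X_i and X_{i+1} by the same factor 1/q, which cancels
  in their ratio.\<close>

lemma T_op_periodic: "T_op m (i + int m) = T_op m i"
proof (cases "m = 0")
  case False
  have s: "s_op m (i + int m) = s_op m i" by (rule ext) (simp add: s_op_def)
  have "Xpow m (i + int m) 1 * Xpow m (i + int m + 1) (-1) = Xpow m i 1 * Xpow m (i + 1) (-1)"
    using Xpow_shift[of m i 1 1] Xpow_shift[of m "i + 1" 1 "-1"] False
    by (simp add: scal_mult_left scal_mult_right algebra_simps power_int_minus)
  then show ?thesis by (intro ext) (simp add: T_op_def div_diff_def s)
qed simp

text \<open>The quadratic relation read as T_i (T_i - (t - 1)) = t.\<close>

lemma T_op_right_inverse:
  assumes "m \<ge> 2" "1 \<le> i" "F \<in> laurent m"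
  shows "T_op m i (scal (1 / tt) (T_op m i F - scal (tt - 1) F)) = F"
proof -
  have "T_op m i (T_op m i F - scal (tt - 1) F) = T_op m i (T_op m i F) - scal (tt - 1) (T_op m i F)"
    using assms by (simp only: T_op_diff T_op_in_laurent scal_in_laurent T_op_scal)
  also have "\<dots> = scal tt F"
    using assms by (simp add: T_op_quadratic scal_diff_left)
  finally show ?thesis using assms
    by (simp add: T_op_scal T_op_in_laurent laurent_closed)
qed

lemma Tinv_op_eq:
  assumes "m \<ge> 2" "1 \<le> i" "F \<in> laurent m"
  shows "Tinv_op m i F = scal (1 / tt) (T_op m i F - scal (tt - 1) F)"
proof -
  have "inj_on (T_op m i) (laurent m)"
    by (rule inj_on_inverseI[where g = "\<lambda>F. scal (1 / tt) (T_op m i F - scal (tt - 1) F)"])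
      (simp add: T_op_quadratic[OF assms(1,2)])
  with T_op_right_inverse[OF assms] show ?thesis unfolding Tinv_op_def using assms
    by (intro inv_into_f_eq) (auto intro!: laurent_closed T_op_in_laurent)
qed

lemma T_op_Tinv_op:
  assumes "m \<ge> 2" "1 \<le> i" "F \<in> laurent m"
  shows "T_op m i (Tinv_op m i F) = F"
  using T_op_right_inverse[OF assms] by (simp add: Tinv_op_eq[OF assms])

lemma Tinv_op_T_op:
  assumes "m \<ge> 2" "1 \<le> i" "F \<in> laurent m"
  shows "Tinv_op m i (T_op m i F) = F"
  using Tinv_op_eq[OF assms(1,2) T_op_in_laurent[OF assms]] T_op_quadratic[OF assms] by simp

lemma Tinv_op_in_laurent:
  assumes "m \<ge> 2" "1 \<le> i" "F \<in> laurent m"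
  shows "Tinv_op m i F \<in> laurent m"
  using assms by (auto simp: Tinv_op_eq intro!: laurent_closed T_op_in_laurent)

lemma Tinv_op_Pi:
  assumes "m \<ge> 2" "1 \<le> i" "F \<in> laurent m"
  shows "Tinv_op m (i + 1) (Pi_op m F) = Pi_op m (Tinv_op m i F)"
  using assms by (simp add: Tinv_op_eq Pi_op_in_laurent T_op_Pi Pi_op_diff Pi_op_scal)

section \<open>Polynomials modulo \<open>1/q\<close>\<close>

lemma embed_ring_hom: "ring_hom embed"
  by (rule ring_homI) (simp_all add: embed_def flip: to_fract_add to_fract_mult one_pCons)

lemmas embed_simps [simp] = ring_hom_1[OF embed_ring_hom] ring_hom_0[OF embed_ring_hom]
  ring_hom_add[OF embed_ring_hom] ring_hom_mult[OF embed_ring_hom]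
  ring_hom_uminus[OF embed_ring_hom] ring_hom_diff[OF embed_ring_hom]
  ring_hom_power[OF embed_ring_hom]

lemma embed_eq_0_iff [simp]: "embed a = 0 \<longleftrightarrow> a = 0"
  by (simp add: embed_def)

lemma embed_inverse: "embed (inverse a) = inverse (embed a)"
proof (cases "a = 0")
  case False
  then have "embed (inverse a) * embed a = 1" by (simp flip: embed_simps(4))
  then show ?thesis by (metis inverse_unique mult.commute)
qed simp

lemma embed_divide: "embed (a / b) = embed a / embed b"
  by (simp add: divide_inverse embed_inverse)

definition ev_inv_q :: "Qt poly \<Rightarrow> Qqt" where
  "ev_inv_q p = poly (map_poly embed p) (inverse qq)"

lemma ev_inv_q_pCons: "ev_inv_q (pCons a p) = embed a + inverse qq * ev_inv_q p"
  by (simp add: ev_inv_q_def map_poly_pCons)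

lemma ev_inv_q_0 [simp]: "ev_inv_q 0 = 0"
  by (simp add: ev_inv_q_def)

lemma ev_inv_q_add: "ev_inv_q (p + p') = ev_inv_q p + ev_inv_q p'"
proof (induction p arbitrary: p')
  case (pCons a p)
  then show ?case by (cases p') (simp_all add: ev_inv_q_pCons algebra_simps)
qed simp

lemma ev_inv_q_smult: "ev_inv_q (smult c p) = embed c * ev_inv_q p"
  by (induction p) (simp_all add: ev_inv_q_pCons algebra_simps)

lemma lim_q_inf_iff: "lim_q_inf x c \<longleftrightarrow> (\<exists>p. x = ev_inv_q p \<and> c = poly p 0)"
  by (simp add: lim_q_inf_def ev_inv_q_def)

lemma lim_q_inf_embed: "lim_q_inf (embed c) c"
  unfolding lim_q_inf_iff by (rule exI[of _ "[:c:]"]) (simp add: ev_inv_q_pCons)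

lemma lim_q_inf_add: "lim_q_inf x c \<Longrightarrow> lim_q_inf y d \<Longrightarrow> lim_q_inf (x + y) (c + d)"
  unfolding lim_q_inf_iff by (metis ev_inv_q_add poly_add)

lemma lim_q_inf_scale: "lim_q_inf x c \<Longrightarrow> lim_q_inf (embed d * x) (d * c)"
  unfolding lim_q_inf_iff by (metis ev_inv_q_smult poly_smult)

lemma lim_q_inf_inverse_q: "lim_q_inf x c \<Longrightarrow> lim_q_inf (inverse qq * x) 0"
proof -
  assume "lim_q_inf x c"
  then obtain p where "x = ev_inv_q p" unfolding lim_q_inf_iff by auto
  then have "inverse qq * x = ev_inv_q (pCons 0 p)" by (simp add: ev_inv_q_pCons)
  then show ?thesis unfolding lim_q_inf_iff by (intro exI[of _ "pCons 0 p"]) simp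
qed

text \<open>The coefficient set is a parameter so that one argument shows both that polynomials go
  to polynomials (\<open>UNIV\<close>) and that vanishing limits are kept
  (\<open>null_coeffs\<close>).\<close>

definition npoly :: "nat \<Rightarrow> Qqt set \<Rightarrow> Qqt lpoly set" where
  "npoly m S = {F \<in> laurent m. (\<forall>\<alpha>\<in>keys F. \<forall>i. 0 \<le> lookup \<alpha> i) \<and>
     (\<forall>\<alpha>. lookup F \<alpha> \<in> S)}"

text \<open>These are the Q(t)[1/q]-submodules of Q(q,t).\<close>

definition stable :: "Qqt set \<Rightarrow> bool" where
  "stable S \<longleftrightarrow> 0 \<in> S \<and> (\<forall>a\<in>S. \<forall>b\<in>S. a + b \<in> S) \<and> (\<forall>a\<in>S. \<forall>c. embed c * a \<in> S) \<and>
     (\<forall>a\<in>S. inverse qq * a \<in> S)"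

abbreviation null_coeffs :: "Qqt set" where
  "null_coeffs \<equiv> {x. lim_q_inf x 0}"

lemma stable_UNIV [simp]: "stable UNIV"
  by (simp add: stable_def)

lemma stable_null [simp]: "stable null_coeffs"
  using lim_q_inf_embed[of 0] lim_q_inf_add[of _ 0 _ 0] lim_q_inf_scale[of _ 0] lim_q_inf_inverse_q[of _ 0]
  by (auto simp: stable_def)

lemma npoly_laurent: "F \<in> npoly m S \<Longrightarrow> F \<in> laurent m"
  by (simp add: npoly_def)

lemma npoly_0: "stable S \<Longrightarrow> 0 \<in> npoly m S"
  by (simp add: npoly_def stable_def)

lemma npoly_add: "stable S \<Longrightarrow> F \<in> npoly m S \<Longrightarrow> G \<in> npoly m S \<Longrightarrow> F + G \<in> npoly m S"
  using keys_add[of F G] unfolding npoly_def stable_def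
  by (auto simp: lookup_add add_in_laurent)

lemma npoly_scal:
  assumes "F \<in> npoly m S" "\<And>a. a \<in> S \<Longrightarrow> c * a \<in> S'"
  shows "scal c F \<in> npoly m S'"
  using assms unfolding npoly_def
  by (auto simp: lookup_scal scal_in_laurent in_keys_iff)

lemma npoly_scal_embed: "stable S \<Longrightarrow> F \<in> npoly m S \<Longrightarrow> scal (embed c) F \<in> npoly m S"
  by (rule npoly_scal) (auto simp: stable_def)

lemma npoly_scal_tt:
  assumes "stable S" "F \<in> npoly m S"
  shows "scal (tt - 1) F \<in> npoly m S" "scal tt F \<in> npoly m S" "scal (1 / tt) F \<in> npoly m S"
  using npoly_scal_embed[OF assms, of "t_Qt - 1"] npoly_scal_embed[OF assms, of t_Qt]
    npoly_scal_embed[OF assms, of "1 / t_Qt"]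
  by (simp_all add: tt_def embed_divide)

lemma npoly_diff: "stable S \<Longrightarrow> F \<in> npoly m S \<Longrightarrow> G \<in> npoly m S \<Longrightarrow> F - G \<in> npoly m S"
  using npoly_add[of S F m "scal (embed (-1)) G"] npoly_scal_embed[of S G m "-1"]
  by (simp add: scal_def single_uminus)

lemma npoly_sum: "stable S \<Longrightarrow> (\<And>x. x \<in> A \<Longrightarrow> f x \<in> npoly m S) \<Longrightarrow> sum f A \<in> npoly m S"
  by (induction A rule: infinite_finite_induct) (auto intro: npoly_add npoly_0)

lemma npoly_1: "1 \<in> npoly m UNIV"
  by (auto simp: npoly_def)

lemma npoly_scal_1: "stable S \<Longrightarrow> c \<in> S \<Longrightarrow> scal c 1 \<in> npoly m S"
  by (auto simp: npoly_def lookup_scal lookup_one when_def stable_def scal_in_laurent in_keys_iff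
      split: if_splits)

lemma lookup_single_mult:
  fixes F :: "('k::ab_group_add) \<Rightarrow>\<^sub>0 'a::comm_ring_1"
  shows "lookup (single \<beta> c * F) \<alpha> = c * lookup F (\<alpha> - \<beta>)"
proof (induction F rule: poly_mapping_add_induct)
  case (3 a)
  have "\<beta> + a = \<alpha> \<longleftrightarrow> a = \<alpha> - \<beta>" by (auto simp: algebra_simps)
  then show ?case by (simp add: mult_single lookup_single when_def)
qed (auto simp: algebra_simps lookup_add)

lemma npoly_X_mult:
  assumes "j \<in> {1..m}" "F \<in> npoly m S"
  shows "Xpow m (int j) 1 * F \<in> npoly m S"
proof -
  have m: "m \<ge> 1" using assms by auto
  have X: "Xpow m (int j) 1 = single (single j 1) 1"
    using assms(1) by (simp add: Xpow_small)
  have "0 \<le> lookup \<alpha> i" if \<alpha>: "\<alpha> \<in> keys (Xpow m (int j) 1 * F)" for \<alpha> i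
  proof -
    obtain b where "b \<in> keys F" "\<alpha> = single j 1 + b"
      using keys_mult[of "Xpow m (int j) 1" F] \<alpha> unfolding X by auto
    then show ?thesis using assms(2) by (auto simp: npoly_def lookup_add lookup_single when_def)
  qed
  moreover have "lookup (Xpow m (int j) 1 * F) \<alpha> \<in> S" for \<alpha>
    unfolding X using assms(2) by (simp add: lookup_single_mult npoly_def)
  ultimately show ?thesis using assms(2) m by (auto simp: npoly_def intro: mult_in_laurent)
qed

text \<open>Polynomials are built from constants by multiplication with variables, for which T_i and
  Pi have commutation rules. All intermediate polynomials keep their coefficients in
  \<open>S\<close>.\<close>

lemma npoly_induct [consumes 2, case_names scal mult add]:
  assumes F: "F \<in> npoly m S" and S: "stable S"
    and scal: "\<And>c. c \<in> S \<Longrightarrow> P (scal c 1)"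
    and mult: "\<And>j F. j \<in> {1..m} \<Longrightarrow> F \<in> npoly m S \<Longrightarrow> P F \<Longrightarrow> P (Xpow m (int j) 1 * F)"
    and add: "\<And>F G. F \<in> npoly m S \<Longrightarrow> G \<in> npoly m S \<Longrightarrow> P F \<Longrightarrow> P G \<Longrightarrow> P (F + G)"
  shows "P F"
proof -
  define Q where "Q G \<longleftrightarrow> G \<in> npoly m S \<and> P G" for G
  have Qmult: "Q (Xpow m (int j) (int k) * G)" if "Q G" "j \<in> {1..m}" for G j k
  proof (induction k)
    case (Suc k)
    then show ?case using that mult npoly_X_mult
      by (auto simp: Q_def Xpow_add mult.assoc)
  qed (use that in simp)
  have Qprod: "Q (scal c (\<Prod>i\<in>B. Xpow m (int i) (n i)))"
    if "finite B" "B \<subseteq> {1..m}" "c \<in> S" "\<And>i. 0 \<le> n i" for B c n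
    using that
  proof (induction B rule: finite_induct)
    case empty
    then show ?case using scal npoly_scal_1[OF S] by (simp add: Q_def)
  next
    case (insert i B)
    then have "Q (Xpow m (int i) (int (nat (n i))) * scal c (\<Prod>i\<in>B. Xpow m (int i) (n i)))"
      by (intro Qmult) auto
    then show ?case using insert by (simp add: scal_mult_right)
  qed
  have "Q F"
  proof (rule poly_mapping_add_induct)
    show "Q 0" using scal[of 0] npoly_0[OF S] S by (simp add: Q_def stable_def)
    show "Q (F + G)" if "Q F" "Q G" for F G using that add npoly_add[OF S] by (auto simp: Q_def)
    fix \<alpha> assume \<alpha>: "\<alpha> \<in> keys F"
    then have "keys \<alpha> \<subseteq> {1..m}" using F by (auto simp: npoly_def laurent_def)
    moreover have "Q (scal (lookup F \<alpha>)
        (\<Prod>i=1..m. Xpow m (int i) (lookup \<alpha> i)))"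
      using F \<alpha> by (intro Qprod) (auto simp: npoly_def)
    ultimately show "Q (single \<alpha> (lookup F \<alpha>))"
      by (simp add: single_eq_prod_Xpow)
  qed
  then show ?thesis by (simp add: Q_def)
qed

text \<open>Preservation for all stable sets, in particular for \<open>null_coeffs\<close>, together
  with linearity is what makes congruence modulo 1/q compatible with the operator.\<close>

definition good_op :: "nat \<Rightarrow> (Qqt lpoly \<Rightarrow> Qqt lpoly) \<Rightarrow> bool" where
  "good_op m f \<longleftrightarrow> (\<forall>S. stable S \<longrightarrow> f ` npoly m S \<subseteq> npoly m S) \<and>
     (\<forall>F\<in>npoly m UNIV. \<forall>G\<in>npoly m UNIV. f (F + G) = f F + f G) \<and>
     (\<forall>c. \<forall>F\<in>npoly m UNIV. f (scal c F) = scal c (f F))"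

lemma good_opD:
  assumes "good_op m f"
  shows good_op_npoly: "stable S \<Longrightarrow> F \<in> npoly m S \<Longrightarrow> f F \<in> npoly m S"
    and good_op_add: "F \<in> npoly m UNIV \<Longrightarrow> G \<in> npoly m UNIV \<Longrightarrow> f (F + G) = f F + f G"
    and good_op_scal: "F \<in> npoly m UNIV \<Longrightarrow> f (scal c F) = scal c (f F)"
  using assms by (auto simp: good_op_def)

lemma good_op_0: "good_op m f \<Longrightarrow> f 0 = 0"
  using good_op_scal[of m f 0 0] npoly_0[of UNIV m] by simp

lemma good_op_diff:
  assumes "good_op m f" "F \<in> npoly m UNIV" "G \<in> npoly m UNIV"
  shows "f (F - G) = f F - f G"
proof -
  have "F - G = F + scal (-1) G" by (simp add: scal_def single_uminus)
  then have "f (F - G) = f F + scal (-1) (f G)"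
    using assms npoly_scal[of G m UNIV "-1" UNIV] by (simp only: good_op_add good_op_scal UNIV_I)
  then show ?thesis by (simp add: scal_def single_uminus)
qed

lemma good_op_sum:
  assumes "good_op m f" "\<And>x. x \<in> A \<Longrightarrow> F x \<in> npoly m UNIV"
  shows "f (sum F A) = (\<Sum>x\<in>A. f (F x))"
  using assms(2)
  by (induction A rule: infinite_finite_induct)
    (auto simp: good_op_0[OF assms(1)] good_op_add[OF assms(1)] npoly_sum)

lemma good_op_id: "good_op m id" "good_op m (\<lambda>F. F)"
  by (auto simp: good_op_def)

lemma good_op_comp: "good_op m f \<Longrightarrow> good_op m g \<Longrightarrow> good_op m (\<lambda>F. f (g F))"
  by (auto simp: good_op_def image_subset_iff)

lemma good_op_scal_embed: "good_op m f \<Longrightarrow> good_op m (\<lambda>F. scal (embed c) (f F))"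
  by (auto simp: good_op_def image_subset_iff npoly_scal_embed scal_add mult.commute)

lemma good_op_sum_ops:
  assumes "\<And>x. x \<in> A \<Longrightarrow> good_op m (f x)"
  shows "good_op m (\<lambda>F. \<Sum>x\<in>A. f x F)"
  using assms unfolding good_op_def image_subset_iff
  by (auto intro!: npoly_sum simp: scal_sum simp flip: sum.distrib)

section \<open>Operators compatible with limits\<close>

lemma compose_simps [simp]: "compose [] = id" "compose (f # fs) = f \<circ> compose fs"
  by (simp_all add: compose_def)

lemma compose_append: "compose (fs @ gs) = compose fs \<circ> compose gs"
  by (induction fs) auto

lemma good_op_compose: "(\<And>f. f \<in> set fs \<Longrightarrow> good_op m f) \<Longrightarrow> good_op m (compose fs)"
  by (induction fs) (auto simp: good_op_id comp_def intro: good_op_comp)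

lemma good_op_funpow: "good_op m f \<Longrightarrow> good_op m (f ^^ n)"
  by (induction n) (auto simp: good_op_id comp_def intro: good_op_comp)

lemma mod_diff_not_01:
  assumes "1 \<le> i" "i < int m" "1 \<le> j" "j \<le> int m" "j \<noteq> i" "j \<noteq> i + 1"
  shows "(j - i) mod int m \<notin> {0, 1}"
proof (cases "j > i")
  case True
  then have "(j - i) mod int m = j - i" using assms by simp
  with assms show ?thesis by auto
next
  case False
  have "(j - i) mod int m = (j - i + int m) mod int m" by simp
  also have "\<dots> = j - i + int m" using False assms by (intro mod_pos_pos_trivial) auto
  finally show ?thesis using False assms by auto
qed

context
  fixes m :: nat and i :: int
  assumes i: "1 \<le> i" "i < int m"
begin

lemma T_X: "F \<in> laurent m \<Longrightarrow> T_op m i (Xpow m i 1 * F) =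
    Xpow m (i + 1) 1 * T_op m i F - scal (tt - 1) (Xpow m (i + 1) 1 * F)"
  using i T_op_X[of m i F] by (simp add: scal_def algebra_simps)

lemma T_X_next: "F \<in> laurent m \<Longrightarrow> T_op m i (Xpow m (i + 1) 1 * F) =
    Xpow m i 1 * T_op m i F + scal (tt - 1) (Xpow m (i + 1) 1 * F)"
  using i T_op_X_next[of m i F] by simp

lemma T_X_other:
  "F \<in> laurent m \<Longrightarrow> 1 \<le> j \<Longrightarrow> j \<le> int m \<Longrightarrow> j \<noteq> i \<Longrightarrow> j \<noteq> i + 1 \<Longrightarrow>
    T_op m i (Xpow m j 1 * F) = Xpow m j 1 * T_op m i F"
  using i T_op_X_other[of m i F j] mod_diff_not_01[OF i, of j] by simp

text \<open>The Bernstein relations involve only variables with indices in {1..m} and scalars from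
  Q(t).\<close>

lemma T_npoly:
  assumes S: "stable S" and F: "F \<in> npoly m S"
  shows "T_op m i F \<in> npoly m S"
  using F S
proof (induction rule: npoly_induct)
  case (scal c)
  then have "T_op m i (scal c 1) = scal tt (scal c 1)"
    using i by (simp add: T_op_scal T_op_one mult.commute)
  then show ?case using npoly_scal_tt(2)[OF S npoly_scal_1[OF S scal]] by simp
next
  case (mult j F)
  have F: "F \<in> laurent m" using mult npoly_laurent by blast
  define i' where "i' = nat i"
  have i': "i = int i'" "i' \<in> {1..m}" "i' + 1 \<in> {1..m}" using i by (auto simp: i'_def)
  have X: "Xpow m i 1 * G \<in> npoly m S" "Xpow m (i + 1) 1 * G \<in> npoly m S" if "G \<in> npoly m S" for G
    using npoly_X_mult[OF i'(2) that] npoly_X_mult[OF i'(3) that] i'(1) by (simp_all add: add.commute)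
  consider "int j = i" | "int j = i + 1" | "int j \<noteq> i" "int j \<noteq> i + 1" by blast
  then show ?case
  proof cases
    case 1
    show ?thesis unfolding 1 using mult F S by (auto simp: T_X intro!: npoly_diff npoly_scal_tt X)
  next
    case 2
    show ?thesis unfolding 2 using mult F S by (auto simp: T_X_next intro!: npoly_add npoly_scal_tt X)
  next
    case 3
    then show ?thesis using mult F by (auto simp: T_X_other intro!: npoly_X_mult)
  qed
next
  case (add F G)
  then show ?case using i S by (auto simp: T_op_add npoly_laurent intro: npoly_add)
qed

lemma good_op_T: "good_op m (T_op m i)"
  using i T_npoly by (auto simp: good_op_def T_op_add T_op_scal npoly_laurent)

lemma good_op_Tinv: "good_op m (Tinv_op m i)"
  unfolding good_op_def
proof (intro conjI allI impI ballI)
  fix S assume "stable S"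
  then show "Tinv_op m i ` npoly m S \<subseteq> npoly m S"
    using i by (auto simp: Tinv_op_eq npoly_laurent intro!: npoly_scal_tt npoly_diff T_npoly)
next
  fix F G assume "F \<in> npoly m UNIV" "G \<in> npoly m UNIV"
  then show "Tinv_op m i (F + G) = Tinv_op m i F + Tinv_op m i G"
    using i by (simp add: Tinv_op_eq npoly_laurent laurent_closed T_op_add)
      (simp add: scal_def algebra_simps)
next
  fix c F assume "F \<in> npoly m UNIV"
  then show "Tinv_op m i (scal c F) = scal c (Tinv_op m i F)"
    using i by (simp add: Tinv_op_eq npoly_laurent laurent_closed T_op_scal)
      (simp add: scal_diff mult_ac)
qed

end

lemma good_op_Pi:
  assumes m: "m \<ge> 1"
  shows "good_op m (Pi_op m)"
proof -
  have "Pi_op m F \<in> npoly m S" if S: "stable S" and F: "F \<in> npoly m S" for S F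
    using F S
  proof (induction rule: npoly_induct)
    case (scal c)
    have "Pi_op m (scal c 1) = Xpow m (int 1) 1 * scal c 1"
      by (simp add: Pi_op_def subst_scal subst_simps)
    then show ?case using npoly_X_mult[of 1 m] npoly_scal_1[OF S scal] m by simp
  next
    case (mult j F)
    have e: "Pi_op m (Xpow m (int j) 1 * F) = Xpow m (int j + 1) 1 * Pi_op m F"
      using m by (simp add: Pi_op_Xpow)
    show ?case
    proof (cases "j = m")
      case True
      \<comment> \<open>The one place where q enters: X_{m+1} = X_1/q. Only negative powers of q can
        therefore be produced.\<close>
      have "Xpow m (int j + 1) 1 = scal (inverse qq) (Xpow m (int 1) 1)"
        using Xpow_shift[OF m, of 1 1 1] True by (simp add: power_int_minus add.commute)
      then have "Pi_op m (Xpow m (int j) 1 * F) = scal (inverse qq) (Xpow m (int 1) 1 * Pi_op m F)"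
        using e by (simp add: scal_mult_left)
      then show ?thesis using npoly_scal[of _ m S "inverse qq" S] npoly_X_mult[of 1 m] mult m S
        by (simp add: stable_def)
    next
      case False
      then show ?thesis using e npoly_X_mult[of "j + 1" m] mult by (simp add: add.commute)
    qed
  next
    case (add F G)
    then show ?case using S by (simp add: Pi_op_add npoly_add)
  qed
  then show ?thesis by (auto simp: good_op_def Pi_op_add Pi_op_scal)
qed

text \<open>Congruence modulo 1/q. Only the difference is constrained; the limit is read off once
  one side has coefficients in Q(t).\<close>

definition lim_eq :: "nat \<Rightarrow> Qqt lpoly \<Rightarrow> Qqt lpoly \<Rightarrow> bool" where
  "lim_eq m F G \<longleftrightarrow> F \<in> npoly m UNIV \<and> G \<in> npoly m UNIV \<and> F - G \<in> npoly m null_coeffs"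

lemma lim_eq_refl: "F \<in> npoly m UNIV \<Longrightarrow> lim_eq m F F"
  by (simp add: lim_eq_def npoly_0)

lemma lim_eq_trans [trans]: "lim_eq m F G \<Longrightarrow> lim_eq m G H \<Longrightarrow> lim_eq m F H"
  unfolding lim_eq_def using npoly_add[OF stable_null, of "F - G" m "G - H"] by simp

lemma lim_eq_good: "good_op m f \<Longrightarrow> lim_eq m F G \<Longrightarrow> lim_eq m (f F) (f G)"
  unfolding lim_eq_def
  by (auto simp: good_op_npoly simp flip: good_op_diff)

lemma lim_eq_scal: "lim_eq m F G \<Longrightarrow> lim_eq m (scal (embed c) F) (scal (embed c) G)"
  using lim_eq_good[OF good_op_scal_embed[OF good_op_id(2)]] .

lemma coef_mult: "coef (a * b) = coef a * coef b"
  by (simp add: mult_single)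

section \<open>Relations between the operators\<close>

text \<open>On constants both operators act by t. The Bernstein relations move the two words past a
  variable; for X_i, X_{i+1} and X_{i+2} shorter words remain, which the quadratic relation
  matches.\<close>

lemma T_braid:
  assumes i: "1 \<le> i" "i + 1 < int m" and F: "F \<in> npoly m UNIV"
  shows "T_op m i (T_op m (i + 1) (T_op m i F)) = T_op m (i + 1) (T_op m i (T_op m (i + 1) F))"
proof -
  have m: "m \<ge> 2" "m \<ge> 1" using i by auto
  have i': "i < int m" "1 \<le> i + 1" "i + 2 \<le> int m" using i by auto
  note closed = T_op_in_laurent[OF m(1) i(1)] T_op_in_laurent[OF m(1) i'(2)] laurent_closed
    Xpow_in_laurent[OF m(2)]
  note lin = T_op_add[OF m(1) i(1)] T_op_add[OF m(1) i'(2)] T_op_scal[OF m(1) i(1)]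
    T_op_scal[OF m(1) i'(2)] T_op_diff[OF m(1) i(1)] T_op_diff[OF m(1) i'(2)]
  have n: "i + 1 + 1 = i + 2" by simp
  note rules = T_X[OF i(1) i'(1)] T_X_next[OF i(1) i'(1)] T_X_other[OF i(1) i'(1)]
    T_X[OF i'(2) i(2), unfolded n] T_X_next[OF i'(2) i(2), unfolded n] T_X_other[OF i'(2) i(2)]
    T_op_quadratic[OF m(1) i(1)] T_op_quadratic[OF m(1) i'(2)]
  show ?thesis using F stable_UNIV
  proof (induction rule: npoly_induct)
    case (scal c)
    then show ?case using i i' m by (simp add: T_op_scal T_op_one)
  next
    case (mult j F)
    note [simp] = npoly_laurent[OF mult(2)]
    consider "int j = i" | "int j = i + 1" | "int j = i + 2" | "int j \<notin> {i, i + 1, i + 2}" by blast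
    then show ?case
    proof cases
      case 4
      then show ?thesis using mult i by (simp add: rules lin closed n)
    qed (use i mult.IH in \<open>simp_all only:\<close>,
      simp_all add: rules lin closed scal_add scal_diff scal_mult_right,
      simp_all add: scal_def coef_mult single_add single_diff algebra_simps)
  next
    case (add F G)
    then show ?case by (simp add: lin closed npoly_laurent)
  qed
qed

lemma T_commute:
  assumes i: "1 \<le> i" "i < int m" and j: "1 \<le> j" "j < int m" and ij: "i + 1 < j"
    and F: "F \<in> npoly m UNIV"
  shows "T_op m i (T_op m j F) = T_op m j (T_op m i F)"
proof -
  have m: "m \<ge> 2" "m \<ge> 1" using i by auto
  note closed = T_op_in_laurent[OF m(1) i(1)] T_op_in_laurent[OF m(1) j(1)] laurent_closed
    Xpow_in_laurent[OF m(2)]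
  note lin = T_op_add[OF m(1) i(1)] T_op_add[OF m(1) j(1)] T_op_scal[OF m(1) i(1)]
    T_op_scal[OF m(1) j(1)] T_op_diff[OF m(1) i(1)] T_op_diff[OF m(1) j(1)]
  note rules = T_X[OF i] T_X_next[OF i] T_X_other[OF i] T_X[OF j] T_X_next[OF j] T_X_other[OF j]
  show ?thesis using F stable_UNIV
  proof (induction rule: npoly_induct)
    case (scal c)
    then show ?case using i j m by (simp add: T_op_scal T_op_one)
  next
    case (mult k F)
    note [simp] = npoly_laurent[OF mult(2)]
    consider "int k = i" | "int k = i + 1" | "int k = j" | "int k = j + 1" | "int k \<notin> {i, i + 1, j, j + 1}" by blast
    then show ?case
      by cases (use i j ij mult in \<open>simp_all add: rules lin closed\<close>)
  next
    case (add F G)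
    then show ?case by (simp add: lin closed npoly_laurent)
  qed
qed

text \<open>Two applications of Pi raise the index m-1 to m+1, which is 1 modulo m.\<close>

lemma T_Pi_Pi:
  assumes "m \<ge> 2" "F \<in> laurent m"
  shows "T_op m 1 (Pi_op m (Pi_op m F)) = Pi_op m (Pi_op m (T_op m (int m - 1) F))"
proof -
  have "T_op m 1 = T_op m (int m - 1 + 1 + 1)" using T_op_periodic[of m 1] by (simp add: add.commute)
  then show ?thesis using assms T_op_Pi[of m "int m - 1 + 1" "Pi_op m F"] T_op_Pi[of m "int m - 1" F]
    by (simp add: Pi_op_in_laurent)
qed

section \<open>Commutation of the \<open>Y\<^sub>i\<close>\<close>

text \<open>The word f_b ... f_a, in which f_a acts first.\<close>

definition descend :: "(int \<Rightarrow> 'v \<Rightarrow> 'v) \<Rightarrow> int \<Rightarrow> int \<Rightarrow> 'v \<Rightarrow> 'v" where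
  "descend f a b = compose (map f (rev [a..b]))"

lemma descend_empty: "b < a \<Longrightarrow> descend f a b x = x"
  by (simp add: descend_def)

lemma descend_last: "a \<le> b \<Longrightarrow> descend f a b x = f b (descend f a (b - 1) x)"
  by (simp add: descend_def upto_rec2)

lemma descend_first: "a \<le> b \<Longrightarrow> descend f a b x = descend f (a + 1) b (f a x)"
  by (simp add: descend_def upto_rec1 compose_append)

lemma descend_next: "a \<le> b + 1 \<Longrightarrow> descend f a (b + 1) x = f (b + 1) (descend f a b x)"
  by (simp add: descend_last)

lemma descend_in:
  assumes "\<And>i y. a \<le> i \<Longrightarrow> i \<le> b \<Longrightarrow> y \<in> V \<Longrightarrow> f i y \<in> V" "x \<in> V"
  shows "descend f a b x \<in> V"
proof (cases "a \<le> b + 1")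
  case True
  have "descend f a k x \<in> V" if "a - 1 \<le> k" "k \<le> b" for k
    using that
  proof (induction k rule: int_ge_induct)
    case (step k)
    then show ?case using assms by (auto simp: descend_next)
  qed (use assms in \<open>auto simp: descend_empty\<close>)
  from this[of b] True show ?thesis by simp
qed (use assms in \<open>simp add: descend_empty\<close>)

lemma descend_commute:
  assumes "\<And>i y. a \<le> i \<Longrightarrow> i \<le> b \<Longrightarrow> y \<in> V \<Longrightarrow> f i y \<in> V"
    and "\<And>i y. a \<le> i \<Longrightarrow> i \<le> b \<Longrightarrow> y \<in> V \<Longrightarrow> g (f i y) = f' i (g y)" "x \<in> V"
  shows "g (descend f a b x) = descend f' a b (g x)"
proof (cases "a \<le> b + 1")
  case True
  have "g (descend f a k x) = descend f' a k (g x)" if "a - 1 \<le> k" "k \<le> b" for k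
    using that
  proof (induction k rule: int_ge_induct)
    case (step k)
    have "descend f a k x \<in> V" using assms step.prems by (intro descend_in) auto
    with step assms show ?case by (auto simp: descend_next)
  qed (use assms in \<open>auto simp: descend_empty\<close>)
  from this[of b] True show ?thesis by simp
qed (use assms in \<open>simp add: descend_empty\<close>)

lemma descend_shift: "descend (\<lambda>i. f (i + 1)) a b = descend f (a + 1) (b + 1)"
proof -
  have "map (\<lambda>i. i + 1) [a..b] = [a + 1..b + 1]"
    by (rule nth_equalityI) auto
  then have "map f (rev [a + 1..b + 1]) = map (\<lambda>i. f (i + 1)) (rev [a..b])"
    by (simp add: rev_map flip: \<open>map (\<lambda>i. i + 1) [a..b] = _\<close>)
  then show ?thesis by (simp add: descend_def)
qed

text \<open>Commutation of the Y_i is a fact about the extended affine braid group, stated here for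
  an action on a set. The node 0 is eliminated: its relations are carried by \<open>T_p_p\<close>,
  since p^2 takes T_{m-1} to T_1.\<close>

locale affine_braid =
  fixes V :: "'v set" and m :: int and T Ti :: "int \<Rightarrow> 'v \<Rightarrow> 'v" and p :: "'v \<Rightarrow> 'v"
  assumes T_in: "1 \<le> i \<Longrightarrow> i < m \<Longrightarrow> x \<in> V \<Longrightarrow> T i x \<in> V"
    and Ti_in: "1 \<le> i \<Longrightarrow> i < m \<Longrightarrow> x \<in> V \<Longrightarrow> Ti i x \<in> V"
    and p_in: "x \<in> V \<Longrightarrow> p x \<in> V"
    and T_Ti: "1 \<le> i \<Longrightarrow> i < m \<Longrightarrow> x \<in> V \<Longrightarrow> T i (Ti i x) = x"
    and Ti_T: "1 \<le> i \<Longrightarrow> i < m \<Longrightarrow> x \<in> V \<Longrightarrow> Ti i (T i x) = x"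
    and braid: "1 \<le> i \<Longrightarrow> i + 1 < m \<Longrightarrow> x \<in> V \<Longrightarrow> T i (T (i + 1) (T i x)) = T (i + 1) (T i (T (i + 1) x))"
    and comm: "1 \<le> i \<Longrightarrow> i + 1 < j \<Longrightarrow> j < m \<Longrightarrow> x \<in> V \<Longrightarrow> T i (T j x) = T j (T i x)"
    and p_T: "1 \<le> i \<Longrightarrow> i + 1 < m \<Longrightarrow> x \<in> V \<Longrightarrow> p (T i x) = T (i + 1) (p x)"
    and T_p_p: "2 \<le> m \<Longrightarrow> x \<in> V \<Longrightarrow> T 1 (p (p x)) = p (p (T (m - 1) x))"
begin

definition far :: "int \<Rightarrow> int \<Rightarrow> bool" where
  "far i j \<longleftrightarrow> 1 \<le> i \<and> i < m \<and> 1 \<le> j \<and> j < m \<and> (i + 1 < j \<or> j + 1 < i)"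

lemma T_T_far: "far i j \<Longrightarrow> x \<in> V \<Longrightarrow> T i (T j x) = T j (T i x)"
  using comm[of i j x] comm[of j i x] by (auto simp: far_def)

lemma T_Ti_far:
  assumes "far i j" "x \<in> V"
  shows "T i (Ti j x) = Ti j (T i x)"
proof -
  have "T j (T i (Ti j x)) = T i (T j (Ti j x))"
    using assms by (intro T_T_far) (auto simp: far_def Ti_in)
  also have "\<dots> = T i x" using assms by (simp add: T_Ti far_def)
  finally show ?thesis using assms Ti_T[of j "T i (Ti j x)"] by (auto simp: far_def T_in Ti_in)
qed

lemma p_Ti:
  assumes "1 \<le> i" "i + 1 < m" "x \<in> V"
  shows "p (Ti i x) = Ti (i + 1) (p x)"
proof -
  have "T (i + 1) (p (Ti i x)) = p x"
    using assms p_T[of i "Ti i x"] by (simp add: Ti_in T_Ti)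
  then show ?thesis using assms Ti_T[of "i + 1" "p (Ti i x)"] by (simp add: p_in Ti_in)
qed

lemma T_Ti_Ti:
  assumes "1 \<le> i" "i + 1 < m" "x \<in> V"
  shows "T i (Ti (i + 1) (Ti i x)) = Ti (i + 1) (Ti i (T (i + 1) x))"
    and "T (i + 1) (Ti i (Ti (i + 1) x)) = Ti i (Ti (i + 1) (T i x))"
proof -
  let ?j = "i + 1"
  have b: "T i (T ?j (T i y)) = T ?j (T i (T ?j y))" if "y \<in> V" for y
    using assms that by (intro braid) auto
  have [simp]: "T i y \<in> V" "T ?j y \<in> V" "Ti i y \<in> V" "Ti ?j y \<in> V" if "y \<in> V" for y
    using assms that by (auto simp: T_in Ti_in)
  have [simp]: "T i (Ti i y) = y" "T ?j (Ti ?j y) = y" "Ti i (T i y) = y" "Ti ?j (T ?j y) = y"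
    if "y \<in> V" for y using assms that by (auto simp: T_Ti Ti_T)
  have "T i (T ?j (T i (Ti ?j (Ti i x)))) = T ?j (T i (T ?j (Ti ?j (Ti i x))))"
    using assms by (intro b) auto
  also have "\<dots> = T ?j x" using assms by simp
  finally have "Ti ?j (Ti i (T i (T ?j (T i (Ti ?j (Ti i x)))))) = Ti ?j (Ti i (T ?j x))" by simp
  then show "T i (Ti ?j (Ti i x)) = Ti ?j (Ti i (T ?j x))" using assms by simp
  have "T ?j (T i (T ?j (Ti i (Ti ?j x)))) = T i (T ?j (T i (Ti i (Ti ?j x))))"
    using assms by (intro b[symmetric]) auto
  also have "\<dots> = T i x" using assms by simp
  finally have "Ti i (Ti ?j (T ?j (T i (T ?j (Ti i (Ti ?j x)))))) = Ti i (Ti ?j (T i x))" by simp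
  then show "T ?j (Ti i (Ti ?j x)) = Ti i (Ti ?j (T i x))" using assms by simp
qed

lemma descend_T_in: "1 \<le> a \<Longrightarrow> b < m \<Longrightarrow> x \<in> V \<Longrightarrow> descend T a b x \<in> V"
  by (rule descend_in) (auto intro: T_in)

lemma descend_Ti_in: "1 \<le> a \<Longrightarrow> b < m \<Longrightarrow> x \<in> V \<Longrightarrow> descend Ti a b x \<in> V"
  by (rule descend_in) (auto intro: Ti_in)

lemma T_descend_T:
  assumes "1 \<le> a" "b < m" "1 \<le> j" "j < m" "j + 1 < a \<or> b + 1 < j" "x \<in> V"
  shows "T j (descend T a b x) = descend T a b (T j x)"
  using assms by (intro descend_commute) (auto simp: T_in far_def intro: T_T_far)

lemma T_descend_Ti:
  assumes "1 \<le> a" "b < m" "1 \<le> j" "j < m" "j + 1 < a \<or> b + 1 < j" "x \<in> V"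
  shows "T j (descend Ti a b x) = descend Ti a b (T j x)"
  using assms by (intro descend_commute) (auto simp: Ti_in far_def intro: T_Ti_far)

lemma p_descend_Ti:
  assumes "1 \<le> a" "b + 1 < m" "x \<in> V"
  shows "p (descend Ti a b x) = descend Ti (a + 1) (b + 1) (p x)"
  unfolding descend_shift[symmetric]
  using assms by (intro descend_commute) (auto simp: Ti_in p_Ti)

text \<open>T_{j-1} passes the letters above j, the braid relation at the letters j and j-1 turns it
  into T_j, and T_j passes the remaining letters. For words in the T_i the same mechanism raises an
  index by one.\<close>

lemma T_pred_descend_Ti:
  assumes "1 \<le> a" "a < j" "j \<le> b" "b < m" "x \<in> V"
  shows "T (j - 1) (descend Ti a b x) = descend Ti a b (T j x)"
  using assms(3,4)
proof (induction b rule: int_ge_induct)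
  case base
  let ?y = "descend Ti a (j - 2) x"
  have y: "?y \<in> V" using assms base by (intro descend_Ti_in) auto
  have d: "descend Ti a j z = Ti j (Ti (j - 1) (descend Ti a (j - 2) z))" for z
    using assms by (simp add: descend_last)
  have "T (j - 1) (Ti j (Ti (j - 1) ?y)) = Ti j (Ti (j - 1) (T j ?y))"
    using T_Ti_Ti(1)[of "j - 1" ?y] y assms base by simp
  also have "T j ?y = descend Ti a (j - 2) (T j x)"
    using assms base by (intro T_descend_Ti) auto
  finally show ?case unfolding d .
next
  case (step b)
  have "T (j - 1) (Ti (b + 1) (descend Ti a b x)) = Ti (b + 1) (T (j - 1) (descend Ti a b x))"
    using assms step by (intro T_Ti_far descend_Ti_in) (auto simp: far_def)
  with step assms show ?case by (simp add: descend_next)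
qed

lemma T_descend_T_Suc:
  assumes "1 \<le> a" "a \<le> j" "j + 1 \<le> b" "b < m" "x \<in> V"
  shows "T j (descend T a b x) = descend T a b (T (j + 1) x)"
  using assms(3,4)
proof (induction b rule: int_ge_induct)
  case base
  let ?y = "descend T a (j - 1) x"
  have y: "?y \<in> V" using assms base by (intro descend_T_in) auto
  have d: "descend T a (j + 1) z = T (j + 1) (T j (descend T a (j - 1) z))" for z
    using assms by (simp add: descend_last)
  have "T j (T (j + 1) (T j ?y)) = T (j + 1) (T j (T (j + 1) ?y))"
    using y assms base by (intro braid) auto
  also have "T (j + 1) ?y = descend T a (j - 1) (T (j + 1) x)"
    using assms base by (intro T_descend_T) auto
  finally show ?case unfolding d .
next
  case (step b)
  have "T j (T (b + 1) (descend T a b x)) = T (b + 1) (T j (descend T a b x))"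
    using assms step by (intro T_T_far descend_T_in) (auto simp: far_def)
  with step assms show ?case by (simp add: descend_next)
qed

text \<open>The operator Y_i without its factor t^{m-i}, as there are no scalars here. In this
  normalization Y_{i+1} = T_i Y_i T_i.\<close>

definition Y :: "int \<Rightarrow> 'v \<Rightarrow> 'v" where
  "Y i x = descend T 1 (i - 1) (p (descend Ti i (m - 1) x))"

lemma Y_in: "1 \<le> i \<Longrightarrow> i \<le> m \<Longrightarrow> x \<in> V \<Longrightarrow> Y i x \<in> V"
  unfolding Y_def by (intro descend_T_in p_in descend_Ti_in) auto

lemma Y_Suc:
  assumes "1 \<le> i" "i < m" "x \<in> V"
  shows "Y (i + 1) x = T i (Y i (T i x))"
  using assms unfolding Y_def
  by (simp add: descend_first[of i] descend_last[of 1 i] Ti_T)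

text \<open>Passing p lowers the index of T_j by one and passing the word of inverses raises it
  again.\<close>

lemma T_Y_above:
  assumes "1 \<le> i" "i < j" "j < m" "x \<in> V"
  shows "T j (Y i x) = Y i (T j x)"
proof -
  have "T j (Y i x) = descend T 1 (i - 1) (T j (p (descend Ti i (m - 1) x)))"
    unfolding Y_def using assms by (intro T_descend_T p_in descend_Ti_in) auto
  also have "T j (p (descend Ti i (m - 1) x)) = p (T (j - 1) (descend Ti i (m - 1) x))"
    using assms p_T[of "j - 1"] by (simp add: descend_Ti_in)
  also have "T (j - 1) (descend Ti i (m - 1) x) = descend Ti i (m - 1) (T j x)"
    using assms by (intro T_pred_descend_Ti) auto
  finally show ?thesis by (simp add: Y_def)
qed

text \<open>Passing the word of the T_k raises the index by one and passing p lowers it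
  again.\<close>

lemma T_Y_below:
  assumes "1 \<le> j" "j + 1 < i" "i \<le> m" "x \<in> V"
  shows "T j (Y i x) = Y i (T j x)"
proof -
  have "T j (Y i x) = descend T 1 (i - 1) (T (j + 1) (p (descend Ti i (m - 1) x)))"
    unfolding Y_def using assms by (intro T_descend_T_Suc p_in descend_Ti_in) auto
  also have "T (j + 1) (p (descend Ti i (m - 1) x)) = p (T j (descend Ti i (m - 1) x))"
    using assms by (intro p_T[symmetric] descend_Ti_in) auto
  also have "T j (descend Ti i (m - 1) x) = descend Ti i (m - 1) (T j x)"
    using assms by (intro T_descend_Ti) auto
  finally show ?thesis by (simp add: Y_def)
qed

text \<open>The product of the two words conjugates T_1 to T_k. For k = m-1 it is the braid that
  remains in Y_1 Y_2 after both p are moved to the left.\<close>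

lemma T_descend_descend:
  assumes "1 \<le> k" "k < m" "x \<in> V"
  shows "T k (descend Ti 1 (k - 1) (descend Ti 2 k x)) = descend Ti 1 (k - 1) (descend Ti 2 k (T 1 x))"
  using assms(1,2)
proof (induction k rule: int_ge_induct)
  case base
  then show ?case by (simp add: descend_empty)
next
  case (step k)
  let ?Q = "\<lambda>z. descend Ti 1 (k - 1) (descend Ti 2 k z)"
  have Qin: "?Q z \<in> V" if "z \<in> V" for z
    using that step by (intro descend_Ti_in) auto
  have d: "descend Ti 1 k (descend Ti 2 (k + 1) z) = Ti k (Ti (k + 1) (?Q z))" if "z \<in> V" for z
  proof -
    have "Ti (k + 1) (descend Ti 1 (k - 1) y) = descend Ti 1 (k - 1) (Ti (k + 1) y)" if "y \<in> V" for y
    proof -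
      have "T (k + 1) (descend Ti 1 (k - 1) (Ti (k + 1) y)) = descend Ti 1 (k - 1) (T (k + 1) (Ti (k + 1) y))"
        using step that by (intro T_descend_Ti Ti_in) auto
      also have "\<dots> = descend Ti 1 (k - 1) y" using step that by (simp add: T_Ti)
      finally show ?thesis
        using step that Ti_T[of "k + 1" "descend Ti 1 (k - 1) (Ti (k + 1) y)"]
        by (auto simp: descend_Ti_in Ti_in)
    qed
    moreover have "descend Ti 2 k z \<in> V" using that step by (intro descend_Ti_in) auto
    ultimately show ?thesis using step by (simp add: descend_next descend_last[of 1 k])
  qed
  have "T (k + 1) (Ti k (Ti (k + 1) (?Q x))) = Ti k (Ti (k + 1) (T k (?Q x)))"
    using step Qin[OF assms(3)] by (intro T_Ti_Ti(2)) auto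
  also have "T k (?Q x) = ?Q (T 1 x)" using step by auto
  finally show ?case using step assms(3) d[of x] d[of "T 1 x"] by (simp add: T_in)
qed

text \<open>With both p on the left, the two sides differ by a T_{m-1} behind p^2 against a T_1 in
  front of it, and \<open>T_p_p\<close> exchanges these.\<close>

lemma Y_1_2:
  assumes m: "2 \<le> m" and x: "x \<in> V"
  shows "Y 1 (Y 2 x) = Y 2 (Y 1 x)"
proof -
  have D2: "descend Ti 2 (m - 1) z \<in> V" if "z \<in> V" for z
    using that by (intro descend_Ti_in) auto
  have Y1: "Y 1 z = p (descend Ti 2 (m - 1) (Ti 1 z))" for z
    using m by (simp add: Y_def descend_empty descend_first[of 1])
  have Y2: "Y 2 z = T 1 (p (descend Ti 2 (m - 1) z))" for z
    by (simp add: Y_def descend_last[of 1 1] descend_empty)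
  have pp: "p (descend Ti 2 (m - 1) (p z)) = p (p (descend Ti 1 (m - 2) z))" if "z \<in> V" for z
    using p_descend_Ti[of 1 "m - 2" z] that by simp
  have "Y 1 (Y 2 x) = p (p (descend Ti 1 (m - 2) (descend Ti 2 (m - 1) x)))"
    unfolding Y1 Y2 using m x D2 by (simp add: Ti_T p_in pp)
  also have "descend Ti 1 (m - 2) (descend Ti 2 (m - 1) x) =
      T (m - 1) (descend Ti 1 (m - 2) (descend Ti 2 (m - 1) (Ti 1 x)))"
    using T_descend_descend[of "m - 1" "Ti 1 x"] m x by (simp add: Ti_in T_Ti)
  also have "p (p \<dots>) = T 1 (p (p (descend Ti 1 (m - 2) (descend Ti 2 (m - 1) (Ti 1 x)))))"
    using m x D2 by (intro T_p_p[symmetric] descend_Ti_in Ti_in) auto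
  also have "\<dots> = Y 2 (Y 1 x)" unfolding Y1 Y2 using m x by (subst pp) (auto simp: D2 Ti_in)
  finally show ?thesis .
qed

text \<open>The recursion Y_{i+1} = T_i Y_i T_i lowers both indices down to the pair 1, 2, because
  the T that is split off commutes with the other Y.\<close>

lemma Y_less_commute:
  assumes "1 \<le> i" "i < j" "j \<le> m" "x \<in> V"
  shows "Y i (Y j x) = Y j (Y i x)"
  using assms
proof (induction i arbitrary: j x rule: int_ge_induct)
  case base
  have "2 \<le> j" using base by simp
  then show ?case using base.prems(2-3)
  proof (induction j arbitrary: x rule: int_ge_induct)
    case base
    then show ?case by (intro Y_1_2) auto
  next
    case (step j)
    have "Y 1 (Y (j + 1) x) = Y 1 (T j (Y j (T j x)))" using step by (subst Y_Suc) auto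
    also have "\<dots> = T j (Y 1 (Y j (T j x)))"
      using step by (intro T_Y_above[symmetric] Y_in T_in) auto
    also have "Y 1 (Y j (T j x)) = Y j (Y 1 (T j x))" using step by (intro step.IH T_in) auto
    also have "Y 1 (T j x) = T j (Y 1 x)" using step by (intro T_Y_above[symmetric]) auto
    also have "T j (Y j (T j (Y 1 x))) = Y (j + 1) (Y 1 x)"
      using step by (subst Y_Suc) (auto intro: Y_in)
    finally show ?case .
  qed
next
  case (step i)
  have "Y (i + 1) (Y j x) = T i (Y i (T i (Y j x)))" using step by (subst Y_Suc) (auto intro: Y_in)
  also have "T i (Y j x) = Y j (T i x)" using step by (intro T_Y_below) auto
  also have "Y i (Y j (T i x)) = Y j (Y i (T i x))" using step by (intro step.IH) (auto intro: T_in)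
  also have "T i (Y j (Y i (T i x))) = Y j (T i (Y i (T i x)))"
    using step by (intro T_Y_below Y_in T_in) auto
  also have "T i (Y i (T i x)) = Y (i + 1) x" using step by (subst Y_Suc) auto
  finally show ?case .
qed

lemma Y_commute:
  assumes "1 \<le> i" "i \<le> m" "1 \<le> j" "j \<le> m" "x \<in> V"
  shows "Y i (Y j x) = Y j (Y i x)"
  using Y_less_commute[of i j x] Y_less_commute[of j i x] assms by (cases i j rule: linorder_cases) auto

end

lemma affine_braid_T_op:
  assumes "m \<ge> 1"
  shows "affine_braid (npoly m UNIV) (int m) (T_op m) (Tinv_op m) (Pi_op m)"
proof
  fix i j :: int and F assume F: "F \<in> npoly m UNIV"
  note FL = npoly_laurent[OF F]
  show "Pi_op m F \<in> npoly m UNIV" using good_op_npoly[OF good_op_Pi[OF assms] _ F] by simp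
  show "1 \<le> i \<Longrightarrow> i < int m \<Longrightarrow> T_op m i F \<in> npoly m UNIV"
    using good_op_npoly[OF good_op_T _ F] by simp
  show "1 \<le> i \<Longrightarrow> i < int m \<Longrightarrow> Tinv_op m i F \<in> npoly m UNIV"
    using good_op_npoly[OF good_op_Tinv _ F] by simp
  show "1 \<le> i \<Longrightarrow> i < int m \<Longrightarrow> T_op m i (Tinv_op m i F) = F"
    using FL by (intro T_op_Tinv_op) auto
  show "1 \<le> i \<Longrightarrow> i < int m \<Longrightarrow> Tinv_op m i (T_op m i F) = F"
    using FL by (intro Tinv_op_T_op) auto
  show "1 \<le> i \<Longrightarrow> i + 1 < int m \<Longrightarrow> T_op m i (T_op m (i + 1) (T_op m i F)) =
      T_op m (i + 1) (T_op m i (T_op m (i + 1) F))"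
    using F by (intro T_braid) auto
  show "1 \<le> i \<Longrightarrow> i + 1 < j \<Longrightarrow> j < int m \<Longrightarrow> T_op m i (T_op m j F) = T_op m j (T_op m i F)"
    using F by (intro T_commute) auto
  show "1 \<le> i \<Longrightarrow> i + 1 < int m \<Longrightarrow> Pi_op m (T_op m i F) = T_op m (i + 1) (Pi_op m F)"
    using FL by (intro T_op_Pi[symmetric]) auto
  show "2 \<le> int m \<Longrightarrow> T_op m 1 (Pi_op m (Pi_op m F)) = Pi_op m (Pi_op m (T_op m (int m - 1) F))"
    using FL by (intro T_Pi_Pi) auto
qed

lemma Y_op_descend:
  "Y_op m i F = scal (tt ^ (m - i))
     (descend (T_op m) 1 (int i - 1) (Pi_op m (descend (Tinv_op m) (int i) (int m - 1) F)))"
  by (simp add: Y_op_def descend_def)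

lemma good_op_descend:
  assumes "\<And>i. a \<le> i \<Longrightarrow> i \<le> b \<Longrightarrow> good_op m (f i)"
  shows "good_op m (descend f a b)"
  unfolding descend_def using assms by (intro good_op_compose) auto

lemma good_op_Y_unscaled:
  assumes "i \<in> {1..m}"
  shows "good_op m (\<lambda>F. descend (T_op m) 1 (int i - 1) (Pi_op m (descend (Tinv_op m) (int i) (int m - 1) F)))"
  using assms by (intro good_op_comp[OF good_op_descend] good_op_comp[OF good_op_Pi] good_op_descend)
    (auto intro: good_op_T good_op_Tinv)

lemma good_op_Y:
  assumes "i \<in> {1..m}"
  shows "good_op m (Y_op m i)"
proof -
  have "Y_op m i = (\<lambda>F. scal (embed (t_Qt ^ (m - i))) (descend (T_op m) 1 (int i - 1)
      (Pi_op m (descend (Tinv_op m) (int i) (int m - 1) F))))"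
    by (rule ext) (simp add: Y_op_descend tt_def)
  then show ?thesis using good_op_scal_embed[OF good_op_Y_unscaled[OF assms]] by metis
qed

lemma Y_op_commute:
  assumes i: "i \<in> {1..m}" and j: "j \<in> {1..m}" and F: "F \<in> npoly m UNIV"
  shows "Y_op m i (Y_op m j F) = Y_op m j (Y_op m i F)"
proof -
  interpret affine_braid "npoly m UNIV" "int m" "T_op m" "Tinv_op m" "Pi_op m"
    using i by (intro affine_braid_T_op) auto
  have Y: "Y_op m k = (\<lambda>F. scal (tt ^ (m - k)) (Y (int k) F))" for k
    by (rule ext) (simp add: Y_op_descend Y_def)
  have g: "good_op m (Y (int k))" if "k \<in> {1..m}" for k
  proof -
    have "Y (int k) = (\<lambda>F. descend (T_op m) 1 (int k - 1) (Pi_op m (descend (Tinv_op m) (int k) (int m - 1) F)))"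
      by (rule ext) (simp add: Y_def)
    then show ?thesis using good_op_Y_unscaled[OF that] by simp
  qed
  have "Y (int i) (Y (int j) F) = Y (int j) (Y (int i) F)"
    using i j F by (intro Y_commute) auto
  then show ?thesis unfolding Y
    using i j F g[OF i] g[OF j]
    by (simp add: good_op_scal[OF g[OF i]] good_op_scal[OF g[OF j]] good_op_npoly mult.commute)
qed

section \<open>Multilinear polynomials\<close>

declare One_nat_def [simp del]

definition Xset :: "nat \<Rightarrow> nat set \<Rightarrow> Qqt lpoly" where
  "Xset m I = (\<Prod>i\<in>I. Xpow m (int i) 1)"

text \<open>Coefficients are taken from Q(t), so such a polynomial is its own limit and serves as a
  normal form modulo 1/q.\<close>

definition mlin :: "nat \<Rightarrow> (nat set \<Rightarrow> Qt) \<Rightarrow> Qqt lpoly" where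
  "mlin m f = (\<Sum>I\<in>Pow {1..m}. scal (embed (f I)) (Xset m I))"

lemma finite_sub [intro]: "I \<subseteq> {1..m} \<Longrightarrow> finite (I :: nat set)"
  by (rule finite_subset) auto

lemma Xset_empty [simp]: "Xset m {} = 1"
  by (simp add: Xset_def)

lemma Xset_insert: "i \<notin> I \<Longrightarrow> I \<subseteq> {1..m} \<Longrightarrow> Xset m (insert i I) = Xpow m (int i) 1 * Xset m I"
  by (simp add: Xset_def finite_sub)

lemma npoly_Xset_mult:
  assumes "I \<subseteq> {1..m}" "F \<in> npoly m S"
  shows "Xset m I * F \<in> npoly m S"
  using finite_sub[OF assms(1)] assms(1)
  by (induction I rule: finite_induct) (auto simp: assms(2) Xset_insert mult.assoc intro!: npoly_X_mult)

lemma npoly_Xset: "I \<subseteq> {1..m} \<Longrightarrow> Xset m I \<in> npoly m UNIV"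
  using npoly_Xset_mult[of I m 1 UNIV] npoly_1 by simp

lemma Xset_in_laurent: "I \<subseteq> {1..m} \<Longrightarrow> Xset m I \<in> laurent m"
  using npoly_laurent npoly_Xset by blast

lemma npoly_mlin: "mlin m f \<in> npoly m UNIV"
  unfolding mlin_def by (intro npoly_sum npoly_scal_embed npoly_Xset) auto

lemma mlin_cong: "(\<And>I. I \<subseteq> {1..m} \<Longrightarrow> f I = g I) \<Longrightarrow> mlin m f = mlin m g"
  unfolding mlin_def by (intro sum.cong) auto

lemma scal_mlin: "scal (embed c) (mlin m f) = mlin m (\<lambda>I. c * f I)"
  by (simp add: mlin_def scal_sum)

lemma mlin_add: "mlin m f + mlin m g = mlin m (\<lambda>I. f I + g I)"
  by (simp add: mlin_def scal_add_left sum.distrib)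

lemma mlin_diff: "mlin m f - mlin m g = mlin m (\<lambda>I. f I - g I)"
  by (simp add: mlin_def scal_diff_left sum_subtractf)

lemma mlin_0: "mlin m (\<lambda>I. 0) = 0"
  by (simp add: mlin_def)

lemma mlin_sum: "(\<Sum>x\<in>A. mlin m (f x)) = mlin m (\<lambda>I. \<Sum>x\<in>A. f x I)"
  by (induction A rule: infinite_finite_induct) (simp_all add: mlin_0 mlin_add)

lemma mlin_single: "J \<subseteq> {1..m} \<Longrightarrow> mlin m (\<lambda>I. if I = J then c else 0) = scal (embed c) (Xset m J)"
proof -
  assume J: "J \<subseteq> {1..m}"
  have "mlin m (\<lambda>I. if I = J then c else 0) =
      (\<Sum>I\<in>Pow {1..m}. if I = J then scal (embed c) (Xset m J) else 0)"
    unfolding mlin_def by (intro sum.cong) auto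
  then show ?thesis using J by (simp add: sum.delta)
qed

lemma good_op_mlin:
  assumes "good_op m g"
  shows "g (mlin m f) = (\<Sum>I\<in>Pow {1..m}. scal (embed (f I)) (g (Xset m I)))"
  unfolding mlin_def
  by (subst good_op_sum[OF assms])
    (auto intro!: npoly_scal_embed npoly_Xset sum.cong good_op_scal[OF assms npoly_Xset])

section \<open>The operators T_i on squarefree monomials\<close>

definition swap_set :: "nat \<Rightarrow> nat set \<Rightarrow> nat set" where
  "swap_set i I = (if i \<in> I \<and> i + 1 \<notin> I then insert (i + 1) (I - {i})
     else if i \<notin> I \<and> i + 1 \<in> I then insert i (I - {i + 1}) else I)"

lemma in_swap_set:
  "k \<in> swap_set i I \<longleftrightarrow> (if k = i then i + 1 \<in> I else if k = i + 1 then i \<in> I else k \<in> I)"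
  by (auto simp: swap_set_def)

lemma swap_set_swap_set [simp]: "swap_set i (swap_set i I) = I"
  by (rule set_eqI) (simp add: in_swap_set)

lemma swap_set_sub: "1 \<le> i \<Longrightarrow> i < m \<Longrightarrow> I \<subseteq> {1..m} \<Longrightarrow> swap_set i I \<subseteq> {1..m}"
  by (auto simp: in_swap_set split: if_splits)

lemma card_swap_set: "card (swap_set i I) = card I"
proof -
  let ?\<tau> = "\<lambda>k. if k = i then i + 1 else if k = i + 1 then i else k"
  have eq: "swap_set i I = ?\<tau> ` I"
    by (rule set_eqI) (auto simp: in_swap_set image_iff split: if_splits)
  have "inj_on ?\<tau> I" by (auto simp: inj_on_def split: if_splits)
  then show ?thesis unfolding eq by (rule card_image)
qed

lemma card_swap_set_Int:
  assumes "1 \<le> i" "i < p"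
  shows "card (swap_set i I \<inter> {1..p}) = card (I \<inter> {1..p})"
proof -
  have "swap_set i I \<inter> {1..p} = swap_set i (I \<inter> {1..p})"
    using assms by (auto simp: in_swap_set split: if_splits)
  then show ?thesis by (simp add: card_swap_set)
qed

lemma T_Xset_mult:
  assumes i: "1 \<le> i" "i < m" and I: "I \<subseteq> {1..m}" "i \<notin> I" "i + 1 \<notin> I" and F: "F \<in> laurent m"
  shows "T_op m (int i) (Xset m I * F) = Xset m I * T_op m (int i) F"
  using finite_sub[OF I(1)] I
proof (induction I rule: finite_induct)
  case (insert j I)
  have "T_op m (int i) (Xpow m (int j) 1 * (Xset m I * F)) = Xpow m (int j) 1 * T_op m (int i) (Xset m I * F)"
    using i insert F by (intro T_X_other) (auto intro: mult_in_laurent Xset_in_laurent)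
  then show ?case using insert by (simp add: Xset_insert mult.assoc)
qed simp

text \<open>Variables other than X_i and X_{i+1} are pulled out, which leaves the four monomials 1,
  X_i, X_{i+1} and X_i X_{i+1}.\<close>

lemma T_Xset:
  assumes i: "1 \<le> i" "i < m" and I: "I \<subseteq> {1..m}"
  shows "T_op m (int i) (Xset m I) =
    (if i \<in> I \<longleftrightarrow> i + 1 \<in> I then scal tt (Xset m I)
     else if i \<in> I then Xset m (swap_set i I)
     else scal tt (Xset m (swap_set i I)) + scal (tt - 1) (Xset m I))"
proof -
  let ?J = "I - {i, i + 1}" and ?T = "T_op m (int i)" and ?X = "\<lambda>j. Xpow m (int j) 1"
  have J: "?J \<subseteq> {1..m}" using I by auto
  have ii: "1 \<le> int i" "int i < int m" using i by auto
  have n: "int i + 1 = int (i + 1)" by simp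
  have L: "Xset m ?J \<in> laurent m" "?X (i + 1) * Xset m ?J \<in> laurent m"
    using Xset_in_laurent[OF J] i by (auto intro: mult_in_laurent)
  have T0: "?T (Xset m ?J) = scal tt (Xset m ?J)"
    using T_Xset_mult[OF i J, of 1] i by (simp add: T_op_one scal_mult_right)
  have T1: "?T (?X i * Xset m ?J) = ?X (i + 1) * Xset m ?J"
    using T_X[OF ii L(1), unfolded n] T0 by (simp add: scal_mult_right flip: scal_diff_left)
  have T2: "?T (?X (i + 1) * Xset m ?J) = scal tt (?X i * Xset m ?J) + scal (tt - 1) (?X (i + 1) * Xset m ?J)"
    using T_X_next[OF ii L(1), unfolded n] T0 by (simp add: scal_mult_right)
  have T12: "?T (?X i * (?X (i + 1) * Xset m ?J)) = scal tt (?X i * (?X (i + 1) * Xset m ?J))"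
    using T_X[OF ii L(2), unfolded n] unfolding T2 by (simp add: scal_mult_right algebra_simps)
  have one: "Xset m (insert k ?J) = ?X k * Xset m ?J" if "k \<in> {i, i + 1}" for k
    using J that by (intro Xset_insert) auto
  have two: "Xset m (insert i (insert (i + 1) ?J)) = ?X i * (?X (i + 1) * Xset m ?J)"
    using J i one[of "i + 1"] by (subst Xset_insert) auto
  consider "i \<in> I" "i + 1 \<in> I" | "i \<notin> I" "i + 1 \<notin> I" | "i \<in> I" "i + 1 \<notin> I" | "i \<notin> I" "i + 1 \<in> I" by blast
  then show ?thesis
  proof cases
    case 1
    then have "I = insert i (insert (i + 1) ?J)" by auto
    with 1 T12 two show ?thesis by metis
  next
    case 2
    then have "I = ?J" by auto
    with 2 T0 show ?thesis by metis
  next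
    case 3
    then have "I = insert i ?J" "swap_set i I = insert (i + 1) ?J" by (auto simp: in_swap_set split: if_splits)
    with 3 T1 one[of i] one[of "i + 1"] show ?thesis by (metis insertCI)
  next
    case 4
    then have "I = insert (i + 1) ?J" "swap_set i I = insert i ?J" by (auto simp: in_swap_set split: if_splits)
    with 4 T2 one[of i] one[of "i + 1"] show ?thesis by (metis insertCI)
  qed
qed

lemma T_Xset_move:
  assumes i: "1 \<le> i" "i < m" and I: "I \<subseteq> {1..m}" "i \<in> I"
  shows "T_op m (int i) (Xset m I) = scal (embed (if i + 1 \<in> I then t_Qt else 1)) (Xset m (swap_set i I))"
  using T_Xset[OF i I(1)] I(2) by (auto simp: tt_def swap_set_def)

text \<open>Dual to \<open>T_Xset_move\<close>: T_i sends a monomial containing X_i to a single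
  term, its inverse does so with monomials not containing X_i.\<close>

lemma Tinv_Xset_move:
  assumes i: "1 \<le> i" "i < m" and I: "I \<subseteq> {1..m}" "i \<notin> I"
  shows "Tinv_op m (int i) (Xset m I) = scal (embed (if i + 1 \<notin> I then 1 / t_Qt else 1)) (Xset m (swap_set i I))"
proof -
  let ?G = "scal (embed (if i + 1 \<notin> I then 1 / t_Qt else 1)) (Xset m (swap_set i I))"
  have sub: "swap_set i I \<subseteq> {1..m}" using swap_set_sub i I by blast
  have "swap_set i I = I" if "i + 1 \<notin> I" using that I by (simp add: swap_set_def)
  then have "T_op m (int i) ?G = Xset m I"
    using i I T_Xset[OF i sub] sub
    by (auto simp: T_op_scal Xset_in_laurent in_swap_set embed_divide simp flip: tt_def)
  then show ?thesis using Tinv_op_T_op[of m "int i" ?G] i sub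
    by (simp add: scal_in_laurent Xset_in_laurent)
qed

lemma t_Qt_nonzero [simp]: "t_Qt \<noteq> 0"
  by (simp add: t_Qt_def)

lemma T_mlin_sym:
  assumes i: "1 \<le> i" "i < m" and h: "\<And>I. I \<subseteq> {1..m} \<Longrightarrow> h (swap_set i I) = h I"
  shows "T_op m (int i) (mlin m h) = scal tt (mlin m h)"
proof -
  have ii: "1 \<le> int i" "int i < int m" using i by auto
  \<comment> \<open>T_i X_I = a(I) X_J + b(I) X_I, where J is I with i and i+1 exchanged. In every
    case a(J) + b(I) = t, which gives the eigenvalue.\<close>
  define a b where "a I = (if i \<in> I \<longleftrightarrow> i + 1 \<in> I then 0 else if i \<in> I then 1 else t_Qt)"
    and "b I = (if i \<in> I \<longleftrightarrow> i + 1 \<in> I then t_Qt else if i \<in> I then 0 else t_Qt - 1)" for I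
  have "T_op m (int i) (mlin m h) = (\<Sum>I\<in>Pow {1..m}. scal (embed (h I * a I)) (Xset m (swap_set i I)) +
      scal (embed (h I * b I)) (Xset m I))"
    unfolding good_op_mlin[OF good_op_T[OF ii]]
    by (intro sum.cong refl) (auto simp: T_Xset[OF i] a_def b_def tt_def scal_add)
  also have "\<dots> = (\<Sum>I\<in>Pow {1..m}. scal (embed (h I * a I)) (Xset m (swap_set i I))) + mlin m (\<lambda>I. h I * b I)"
    by (simp add: sum.distrib mlin_def)
  also have "(\<Sum>I\<in>Pow {1..m}. scal (embed (h I * a I)) (Xset m (swap_set i I))) =
      mlin m (\<lambda>I. h I * a (swap_set i I))"
    unfolding mlin_def using h
    by (intro sum.reindex_bij_witness[of _ "swap_set i" "swap_set i"])
      (use swap_set_sub[OF i] in auto)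
  also have "\<dots> + mlin m (\<lambda>I. h I * b I) = mlin m (\<lambda>I. t_Qt * h I)"
    unfolding mlin_add by (rule mlin_cong) (auto simp: a_def b_def in_swap_set algebra_simps)
  finally show ?thesis by (simp add: tt_def scal_mlin)
qed

lemma Tinv_mlin_sym:
  assumes i: "1 \<le> i" "i < m" and h: "\<And>I. I \<subseteq> {1..m} \<Longrightarrow> h (swap_set i I) = h I"
  shows "Tinv_op m (int i) (mlin m h) = scal (embed (1 / t_Qt)) (mlin m h)"
  using T_mlin_sym[of i m h] assms npoly_laurent[OF npoly_mlin]
  by (simp add: Tinv_op_eq embed_divide flip: scal_diff_left tt_def)

lemma descend_Tinv_mlin_sym:
  assumes "1 \<le> a" "int j < int m" "a \<le> j + 1"
    and h: "\<And>i I. a \<le> i \<Longrightarrow> i \<le> j \<Longrightarrow> I \<subseteq> {1..m} \<Longrightarrow> h (swap_set i I) = h I"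
  shows "descend (Tinv_op m) (int a) (int j) (mlin m h) = scal (embed ((1 / t_Qt) ^ (j + 1 - a))) (mlin m h)"
  using assms(2-)
proof (induction j)
  case 0
  then show ?case using assms(1) by (auto simp: descend_def le_Suc_eq)
next
  case (Suc j)
  show ?case
  proof (cases "a = j + 2")
    case True
    then show ?thesis by (simp add: descend_empty)
  next
    case False
    then have a: "a \<le> j + 1" using Suc by simp
    let ?f = "Tinv_op m (int (Suc j))"
    have g: "good_op m ?f" using Suc by (intro good_op_Tinv) auto
    have "descend (Tinv_op m) (int a) (int (Suc j)) (mlin m h) = ?f (descend (Tinv_op m) (int a) (int j) (mlin m h))"
      using a by (subst descend_last) auto
    also have "\<dots> = ?f (scal (embed ((1 / t_Qt) ^ (j + 1 - a))) (mlin m h))"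
      using Suc a by (subst Suc.IH) auto
    also have "\<dots> = scal (embed ((1 / t_Qt) ^ (j + 1 - a))) (?f (mlin m h))"
      by (intro good_op_scal[OF g] npoly_mlin)
    also have "?f (mlin m h) = scal (embed (1 / t_Qt)) (mlin m h)"
      using Suc.prems a by (intro Tinv_mlin_sym) auto
    finally show ?thesis using a by (simp add: Suc_diff_le mult.commute embed_divide)
  qed
qed

section \<open>Sums of descending words\<close>

definition count :: "bool \<Rightarrow> nat \<Rightarrow> nat set \<Rightarrow> nat" where
  "count \<kappa> j I = card {i \<in> {1..j}. (i \<in> I) = \<kappa>}"

lemma count_0 [simp]: "count \<kappa> 0 I = 0"
  by (simp add: count_def)

lemma count_Suc: "count \<kappa> (Suc j) I = (if (Suc j \<in> I) = \<kappa> then Suc (count \<kappa> j I) else count \<kappa> j I)"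
proof -
  have "{i \<in> {1..Suc j}. (i \<in> I) = \<kappa>} = (if (Suc j \<in> I) = \<kappa> then insert (Suc j) {i \<in> {1..j}. (i \<in> I) = \<kappa>}
      else {i \<in> {1..j}. (i \<in> I) = \<kappa>})"
    by (auto simp: le_Suc_eq)
  then show ?thesis by (simp add: count_def)
qed

lemma count_swap_set: "j < i \<Longrightarrow> count \<kappa> j (swap_set i I) = count \<kappa> j I"
  unfolding count_def by (rule arg_cong[where f = card]) (auto simp: in_swap_set)

text \<open>Each nonzero term raises the count by one, so the exponents that occur are 0, 1, 2 and
  so on.\<close>

lemma sum_count: "(\<Sum>j<p. if (Suc j \<in> I) = \<kappa> then c ^ count \<kappa> j I else 0) = (\<Sum>k<count \<kappa> p I. c ^ k)"
  for c :: "'a::comm_ring_1"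
  by (induction p) (auto simp: count_Suc)

lemma count_True: "count True p I = card (I \<inter> {1..p})"
  unfolding count_def by (rule arg_cong[where f = card]) auto

lemma count_False: "count False p I = p - card (I \<inter> {1..p})"
proof -
  have "{i \<in> {1..p}. (i \<in> I) = False} = {1..p} - I \<inter> {1..p}" by auto
  then show ?thesis by (simp add: count_def card_Diff_subset)
qed

text \<open>\<open>R\<^sub>i\<close> is \<open>T\<^sub>i\<close> for \<open>\<kappa> = True\<close> and the inverse of \<open>T\<^sub>i\<close> for \<open>\<kappa> = False\<close>: in both cases
  \<open>R\<^sub>i\<close> permutes, up to scalars, the monomials on which the membership of \<open>i\<close> is \<open>\<kappa>\<close>.\<close>

lemma descend_mlin:
  assumes good: "\<And>i. 1 \<le> i \<Longrightarrow> i \<le> j \<Longrightarrow> good_op m (R (int i))"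
    and R: "\<And>i I. 1 \<le> i \<Longrightarrow> i \<le> j \<Longrightarrow> I \<subseteq> {1..m} \<Longrightarrow> (i \<in> I) = \<kappa> \<Longrightarrow>
      R (int i) (Xset m I) = scal (embed (if (i + 1 \<in> I) = \<kappa> then c else 1)) (Xset m (swap_set i I))"
    and h: "\<And>i I. 1 \<le> i \<Longrightarrow> i \<le> j \<Longrightarrow> I \<subseteq> {1..m} \<Longrightarrow> h (swap_set i I) = h I"
    and j: "j < m"
  shows "descend R 1 (int j) (mlin m (\<lambda>I. if (1 \<in> I) = \<kappa> then h I else 0)) =
    mlin m (\<lambda>I. if (Suc j \<in> I) = \<kappa> then c ^ count \<kappa> j I * h I else 0)"
  using assms
proof (induction j)
  case 0
  show ?case by (simp add: descend_empty One_nat_def cong: if_cong)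
next
  case (Suc j)
  let ?i = "Suc j"
  have i: "1 \<le> ?i" "?i < m" using Suc by auto
  have "descend R 1 (int (Suc j)) (mlin m (\<lambda>I. if (1 \<in> I) = \<kappa> then h I else 0)) =
     R (int ?i) (mlin m (\<lambda>I. if (?i \<in> I) = \<kappa> then c ^ count \<kappa> j I * h I else 0))"
    using Suc by (subst descend_last) auto
  also have "\<dots> = (\<Sum>I\<in>Pow {1..m}. scal (embed (if (?i \<in> I) = \<kappa> then c ^ count \<kappa> j I * h I else 0))
      (R (int ?i) (Xset m I)))"
    using Suc.prems(1)[of ?i] by (intro good_op_mlin) auto
  also have "\<dots> = (\<Sum>I\<in>Pow {1..m}. scal (embed (if (?i \<in> I) = \<kappa> then
      c ^ count \<kappa> j I * h I * (if (?i + 1 \<in> I) = \<kappa> then c else 1) else 0)) (Xset m (swap_set ?i I)))"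
    using Suc.prems(2)[of ?i] by (intro sum.cong refl) auto
  also have "\<dots> = mlin m (\<lambda>I. if (Suc ?i \<in> I) = \<kappa> then c ^ count \<kappa> ?i I * h I else 0)"
    unfolding mlin_def using Suc.prems(3)[of ?i]
    by (intro sum.reindex_bij_witness[of _ "swap_set ?i" "swap_set ?i"])
      (use swap_set_sub[OF i] in \<open>auto simp: in_swap_set count_Suc count_swap_set mult_ac\<close>)
  finally show ?case by simp
qed

lemma t_Qt_power_eq_iff [simp]: "t_Qt ^ a = t_Qt ^ b \<longleftrightarrow> a = b"
proof
  have p: "t_Qt ^ n = to_fract (monom 1 n)" for n
    by (induction n) (simp_all add: t_Qt_def monom_Suc one_pCons flip: to_fract_mult to_fract_1)
  assume "t_Qt ^ a = t_Qt ^ b"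
  then have "degree (monom (1::rat) a) = degree (monom (1::rat) b)" by (simp add: p)
  then show "a = b" by (simp add: degree_monom_eq)
qed simp

lemma one_minus_t [simp]: "1 - t_Qt \<noteq> 0" "t_Qt \<noteq> 1"
  using t_Qt_power_eq_iff[of 1 0] by auto

lemma t_int_sum: "t_int n = (\<Sum>k<n. t_Qt ^ k)"
  by (simp add: t_int_def sum_gp_strict)

lemma t_int_0 [simp]: "t_int 0 = 0"
  by (simp add: t_int_def)

lemma t_int_nonzero: "n \<ge> 1 \<Longrightarrow> t_int n \<noteq> 0"
  using t_Qt_power_eq_iff[of n 0] by (auto simp: t_int_def)

lemma t_fact_Suc: "t_fact (Suc n) = t_int (Suc n) * t_fact n"
  by (simp add: t_fact_def)

lemma t_fact_0 [simp]: "t_fact 0 = 1"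
  by (simp add: t_fact_def)

lemma t_fact_nonzero [simp]: "t_fact n \<noteq> 0"
  by (auto simp: t_fact_def t_int_nonzero)

text \<open>The difference consists of the last r terms t^{-(p-r)}, ..., t^{-(p-1)}.\<close>

lemma sum_inverse_t:
  assumes "r \<le> p"
  shows "(\<Sum>k<p. (1 / t_Qt) ^ k) - (\<Sum>k<p - r. (1 / t_Qt) ^ k) = t_Qt powi (1 - int p) * t_int r"
  using assms
proof (induction r)
  case (Suc r)
  have e: "p - r = Suc (p - Suc r)" using Suc by simp
  have "t_Qt powi (1 - int p) * t_Qt ^ r = t_Qt powi (1 - int p + int r)"
    by (simp add: power_int_add)
  also have "1 - int p + int r = - int (p - Suc r)" using Suc by simp
  also have "t_Qt powi \<dots> = (1 / t_Qt) ^ (p - Suc r)" by (simp add: power_int_minus field_simps)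
  finally show ?case using Suc by (simp add: t_int_sum algebra_simps e)
qed simp

text \<open>T_j ... T_1 carries coefficients on sets containing 1 to sets I containing j+1, weighted
  by t to the number of elements of I in {1..j}. Summation over j gives a geometric sum.\<close>

lemma sum_descend_T_mlin:
  assumes h: "\<And>i I. 1 \<le> i \<Longrightarrow> i < p \<Longrightarrow> I \<subseteq> {1..m} \<Longrightarrow> h (swap_set i I) = h I" and p: "p \<le> m"
  shows "(\<Sum>j<p. descend (T_op m) 1 (int j) (mlin m (\<lambda>I. if 1 \<in> I then h I else 0))) =
    mlin m (\<lambda>I. t_int (card (I \<inter> {1..p})) * h I)"
proof -
  have "descend (T_op m) 1 (int j) (mlin m (\<lambda>I. if (1 \<in> I) = True then h I else 0)) =
      mlin m (\<lambda>I. if (Suc j \<in> I) = True then t_Qt ^ count True j I * h I else 0)" if "j < p" for j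
    using that p T_Xset_move[of _ m] h by (intro descend_mlin good_op_T) auto
  then have "(\<Sum>j<p. descend (T_op m) 1 (int j) (mlin m (\<lambda>I. if 1 \<in> I then h I else 0))) =
      mlin m (\<lambda>I. \<Sum>j<p. if (Suc j \<in> I) = True then t_Qt ^ count True j I * h I else 0)"
    by (simp add: mlin_sum)
  also have "\<dots> = mlin m (\<lambda>I. (\<Sum>j<p. if (Suc j \<in> I) = True then t_Qt ^ count True j I else 0) * h I)"
    by (rule mlin_cong) (auto simp: sum_distrib_right intro!: sum.cong)
  finally show ?thesis unfolding sum_count by (simp add: count_True t_int_sum)
qed

lemma sum_descend_Tinv_mlin:
  assumes h: "\<And>i I. 1 \<le> i \<Longrightarrow> i < p \<Longrightarrow> I \<subseteq> {1..m} \<Longrightarrow> h (swap_set i I) = h I" and p: "p \<le> m"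
  shows "(\<Sum>j<p. descend (Tinv_op m) 1 (int j) (mlin m (\<lambda>I. if 1 \<in> I then h I else 0))) =
    mlin m (\<lambda>I. t_Qt powi (1 - int p) * t_int (card (I \<inter> {1..p})) * h I)"
proof -
  let ?u = "1 / t_Qt"
  let ?w = "\<lambda>j I. if (Suc j \<in> I) = False then ?u ^ count False j I * h I else 0"
  \<comment> \<open>Inverses move single terms only on sets without 1, so sets containing 1 are
    treated as a complement. The full symmetric function is an eigenvector with eigenvalue
    t^{-j}.\<close>
  have split: "mlin m (\<lambda>I. if 1 \<in> I then h I else 0) = mlin m h - mlin m (\<lambda>I. if (1 \<in> I) = False then h I else 0)"
    unfolding mlin_diff by (rule mlin_cong) auto
  have "descend (Tinv_op m) 1 (int j) (mlin m (\<lambda>I. if 1 \<in> I then h I else 0)) =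
      mlin m (\<lambda>I. ?u ^ j * h I - ?w j I)"
    if j: "j < p" for j
  proof -
    have g: "good_op m (descend (Tinv_op m) 1 (int j))"
      using j p by (intro good_op_descend good_op_Tinv) auto
    have "descend (Tinv_op m) 1 (int j) (mlin m (\<lambda>I. if (1 \<in> I) = False then h I else 0)) =
        mlin m (\<lambda>I. ?w j I)"
      using j p Tinv_Xset_move[of _ m] h by (intro descend_mlin good_op_Tinv) auto
    moreover have "descend (Tinv_op m) 1 (int j) (mlin m h) = mlin m (\<lambda>I. ?u ^ j * h I)"
      using descend_Tinv_mlin_sym[of 1 j m h] j p h by (simp add: scal_mlin flip: embed_simps(7))
    ultimately show ?thesis
      unfolding split by (subst good_op_diff[OF g npoly_mlin npoly_mlin]) (simp add: mlin_diff)
  qed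
  then have "(\<Sum>j<p. descend (Tinv_op m) 1 (int j) (mlin m (\<lambda>I. if 1 \<in> I then h I else 0))) =
      mlin m (\<lambda>I. \<Sum>j<p. ?u ^ j * h I - ?w j I)"
    by (simp add: mlin_sum)
  also have "\<dots> = mlin m (\<lambda>I. t_Qt powi (1 - int p) * t_int (card (I \<inter> {1..p})) * h I)"
  proof (rule mlin_cong)
    fix I assume "I \<subseteq> {1..m}"
    have "(\<Sum>j<p. ?u ^ j * h I - ?w j I) =
        ((\<Sum>j<p. ?u ^ j) - (\<Sum>j<p. if (Suc j \<in> I) = False then ?u ^ count False j I else 0)) * h I"
      unfolding left_diff_distrib sum_distrib_right sum_subtractf[symmetric]
      by (intro sum.cong) auto
    also have "(\<Sum>j<p. ?u ^ j) - (\<Sum>j<p. if (Suc j \<in> I) = False then ?u ^ count False j I else 0) =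
        t_Qt powi (1 - int p) * t_int (card (I \<inter> {1..p}))"
      unfolding sum_count
      unfolding count_False
      by (rule sum_inverse_t) (metis card_mono card_atLeastAtMost diff_Suc_1 finite_atLeastAtMost inf_le2)
    finally show "(\<Sum>j<p. ?u ^ j * h I - ?w j I) =
        t_Qt powi (1 - int p) * t_int (card (I \<inter> {1..p})) * h I" .
  qed
  finally show ?thesis .
qed

section \<open>The operator Pi modulo 1/q\<close>

lemma Pi_Xset:
  assumes m: "m \<ge> 1" and I: "I \<subseteq> {1..m}" "m \<notin> I"
  shows "Pi_op m (Xset m I) = Xset m (insert 1 (Suc ` I))"
proof -
  have "Pi_op m (Xset m I) = (\<Prod>i\<in>I. Xpow m (int (Suc i)) 1) * Pi_op m 1"
    using finite_sub[OF I(1)] I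
    by (induction I rule: finite_induct) (auto simp: Xset_insert Pi_op_Xpow m mult.assoc add.commute)
  also have "(\<Prod>i\<in>I. Xpow m (int (Suc i)) 1) = Xset m (Suc ` I)"
    by (simp add: Xset_def prod.reindex)
  also have "Pi_op m 1 = Xpow m (int 1) 1" by (simp add: Pi_op_def subst_simps)
  also have "Xset m (Suc ` I) * Xpow m (int 1) 1 = Xset m (insert 1 (Suc ` I))"
  proof -
    have "Suc ` I \<subseteq> {1..m}"
    proof
      fix x assume "x \<in> Suc ` I"
      then obtain i where "x = Suc i" "i \<in> I" by auto
      moreover from this have "i \<noteq> m" "i \<le> m" using I by auto
      ultimately show "x \<in> {1..m}" by auto
    qed
    moreover have "1 \<notin> Suc ` I" using I by auto
    ultimately show ?thesis by (simp add: Xset_insert mult.commute)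
  qed
  finally show ?thesis .
qed

lemma Pi_Xset_null:
  assumes m: "m \<ge> 1" and I: "I \<subseteq> {1..m}" "m \<in> I"
  shows "Pi_op m (Xset m I) \<in> npoly m null_coeffs"
proof -
  let ?J = "I - {m}" and ?K = "insert 1 (Suc ` (I - {m}))"
  have J: "?J \<subseteq> {1..m}" "m \<notin> ?J" using I by auto
  have K: "?K \<subseteq> {1..m}"
  proof
    fix x assume "x \<in> ?K"
    then consider "x = 1" | i where "i \<in> I" "i \<noteq> m" "x = Suc i" by auto
    then show "x \<in> {1..m}" using I m by cases fastforce+
  qed
  have "I = insert m ?J" using I by auto
  then have "Xset m I = Xpow m (int m) 1 * Xset m ?J" using J by (metis Xset_insert)
  then have "Pi_op m (Xset m I) = Xpow m (int m + 1) 1 * Xset m ?K"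
    using m J by (simp add: Pi_op_Xpow Pi_Xset)
  also have "Xpow m (int m + 1) 1 = Xpow m (int 1) 1 * scal (inverse qq) 1"
    using Xpow_shift[OF m, of 1 1 1] by (simp add: power_int_minus add.commute scal_mult_right)
  also have "Xpow m (int 1) 1 * scal (inverse qq) 1 * Xset m ?K = Xpow m (int 1) 1 * (Xset m ?K * scal (inverse qq) 1)"
    by (simp add: mult_ac)
  also have "\<dots> \<in> npoly m null_coeffs"
    using K m lim_q_inf_inverse_q[OF lim_q_inf_embed[of 1]]
    by (intro npoly_X_mult npoly_Xset_mult npoly_scal_1) auto
  finally show ?thesis .
qed

text \<open>If 1 lies in K, this is the set I for which X_I is sent to X_K by Pi. Removing the
  minimum instead of the element 1 extends this to all K in a way that respects swaps, as the sums
  of descending words require.\<close>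

definition drop_min :: "nat set \<Rightarrow> nat set" where
  "drop_min K = (\<lambda>k. k - 1) ` (K - {Min K})"

lemma drop_min_insert_1:
  assumes "I \<subseteq> {1..m}"
  shows "drop_min (insert 1 (Suc ` I)) = I"
proof -
  have fin: "finite (insert 1 (Suc ` I))" using finite_sub[OF assms] by simp
  have "Min (insert 1 (Suc ` I)) = 1" using fin by (intro Min_eqI) auto
  moreover have "insert 1 (Suc ` I) - {1} = Suc ` I" using assms by auto
  ultimately show ?thesis by (simp add: drop_min_def image_image)
qed

text \<open>Sets containing m contribute multiples of 1/q. The others correspond bijectively to the
  sets K containing 1, with inverse \<open>drop_min\<close>.\<close>

lemma lim_eq_Pi_mlin:
  assumes m: "m \<ge> 1"
  shows "lim_eq m (Pi_op m (mlin m f)) (mlin m (\<lambda>K. if 1 \<in> K then f (drop_min K) else 0))"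
proof -
  let ?A = "{I \<in> Pow {1..m}. m \<notin> I}" and ?B = "{I \<in> Pow {1..m}. m \<in> I}"
  have g: "good_op m (Pi_op m)" by (rule good_op_Pi[OF m])
  have PiX: "Pi_op m (Xset m I) \<in> npoly m UNIV" if "I \<subseteq> {1..m}" for I
    using good_op_npoly[OF g] npoly_Xset[OF that] by simp
  have "Pi_op m (mlin m f) = (\<Sum>I\<in>?A. scal (embed (f I)) (Pi_op m (Xset m I))) +
      (\<Sum>I\<in>?B. scal (embed (f I)) (Pi_op m (Xset m I)))"
    unfolding good_op_mlin[OF g] by (subst sum.union_disjoint[symmetric]) (auto intro: sum.cong)
  moreover have "(\<Sum>I\<in>?A. scal (embed (f I)) (Pi_op m (Xset m I))) =
      mlin m (\<lambda>K. if 1 \<in> K then f (drop_min K) else 0)"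
  proof -
    have "(\<Sum>I\<in>?A. scal (embed (f I)) (Pi_op m (Xset m I))) =
        (\<Sum>K\<in>{K \<in> Pow {1..m}. 1 \<in> K}. scal (embed (f (drop_min K))) (Xset m K))"
    proof (rule sum.reindex_bij_witness[of _ drop_min "\<lambda>I. insert 1 (Suc ` I)"])
      fix I assume "I \<in> ?A"
      then have I: "I \<subseteq> {1..m}" "m \<notin> I" by auto
      show "drop_min (insert 1 (Suc ` I)) = I" using drop_min_insert_1 I by blast
      then show "scal (embed (f (drop_min (insert 1 (Suc ` I))))) (Xset m (insert 1 (Suc ` I))) =
          scal (embed (f I)) (Pi_op m (Xset m I))"
        using Pi_Xset[OF m I] by simp
      have "Suc i \<le> m" if "i \<in> I" for i
        using that I by (metis atLeastAtMost_iff le_neq_implies_less subsetD Suc_leI)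
      then show "insert 1 (Suc ` I) \<in> {K \<in> Pow {1..m}. 1 \<in> K}" using m by auto
    next
      fix K assume "K \<in> {K \<in> Pow {1..m}. 1 \<in> K}"
      then have K: "K \<subseteq> {1..m}" "1 \<in> K" by auto
      then have "Min K = 1" using finite_sub[OF K(1)] by (intro Min_eqI) auto
      then have d: "drop_min K = (\<lambda>k. k - 1) ` (K - {1})" by (simp add: drop_min_def)
      have "Suc (k - 1) = k" if "k \<in> K - {1}" for k using that K by auto
      then show "insert 1 (Suc ` drop_min K) = K" using K by (auto simp: d image_image)
      show "drop_min K \<in> ?A" unfolding d using K by force
    qed
    also have "\<dots> = mlin m (\<lambda>K. if 1 \<in> K then f (drop_min K) else 0)"
      unfolding mlin_def by (rule sum.mono_neutral_cong_left) auto
    finally show ?thesis .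
  qed
  moreover have "(\<Sum>I\<in>?B. scal (embed (f I)) (Pi_op m (Xset m I))) \<in> npoly m null_coeffs"
    using m by (intro npoly_sum npoly_scal_embed Pi_Xset_null) auto
  ultimately show ?thesis
    unfolding lim_eq_def using good_op_npoly[OF g stable_UNIV npoly_mlin[of m f]] npoly_mlin by simp
qed

text \<open>If the swap moves the minimum, the same set remains after its removal; any other
  effective swap survives with index i-1. So invariance of f under swaps below i-1 extends by one
  index after composition with \<open>drop_min\<close>, and the swap of 1 and 2 comes for
  free.\<close>

lemma drop_min_swap_set:
  assumes i: "1 \<le> i" and K: "K \<subseteq> {1..m}"
  shows "drop_min (swap_set i K) = drop_min K \<or>
    (2 \<le> i \<and> drop_min (swap_set i K) = swap_set (i - 1) (drop_min K))"
proof -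
  have main: "drop_min (swap_set i K) = drop_min K \<or>
      (2 \<le> i \<and> drop_min (swap_set i K) = swap_set (i - 1) (drop_min K))"
    if K: "finite K" "0 \<notin> K" and iK: "i \<in> K" "i + 1 \<notin> K" for K
  proof -
    have ne: "K \<noteq> {}" using iK by auto
    have s: "swap_set i K = insert (i + 1) (K - {i})" using iK by (simp add: swap_set_def)
    have le: "Min K \<le> i" "Min K \<in> K" using K iK ne by auto
    then have pos: "Min K \<ge> 1" using K by (metis One_nat_def Suc_leI neq0_conv)
    show ?thesis
    proof (cases "Min K = i")
      case True
      then have gt: "i \<le> k" if "k \<in> K" for k using that K Min_le by metis
      have "Min (swap_set i K) = i + 1"
        unfolding s
      proof (rule Min_eqI)
        fix y assume "y \<in> insert (i + 1) (K - {i})"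
        then show "i + 1 \<le> y" using gt[of y] by auto
      qed (use K in auto)
      then have "swap_set i K - {Min (swap_set i K)} = K - {Min K}"
        using True iK unfolding s by auto
      then show ?thesis by (simp add: drop_min_def)
    next
      case False
      with le have lt: "Min K < i" by simp
      have min: "Min (swap_set i K) = Min K"
        using K le lt unfolding s by (intro Min_eqI) (auto simp: less_imp_le)
      have "drop_min (swap_set i K) = swap_set (i - 1) (drop_min K)"
      proof (rule set_eqI)
        fix x
        have mem: "y \<in> drop_min L \<longleftrightarrow> y + 1 \<in> L \<and> y + 1 \<noteq> Min K" if L: "0 \<notin> L" "Min L = Min K" for y L
        proof
          assume "y \<in> drop_min L"
          then obtain k where k: "k \<in> L" "k \<noteq> Min K" "y = k - 1" using L by (auto simp: drop_min_def)
          then have "y + 1 = k" using L by (cases k) auto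
          with k(1,2) show "y + 1 \<in> L \<and> y + 1 \<noteq> Min K" by metis
        next
          assume "y + 1 \<in> L \<and> y + 1 \<noteq> Min K"
          then show "y \<in> drop_min L" using L unfolding drop_min_def
            by (intro image_eqI[of _ _ "y + 1"]) auto
        qed
        have z: "0 \<notin> swap_set i K" using K i by (auto simp: in_swap_set)
        obtain i' where i': "i = i' + 1" using lt by (cases i) auto
        consider "x = i'" | "x = i' + 1" | "x \<noteq> i'" "x \<noteq> i' + 1" by blast
        then show "x \<in> drop_min (swap_set i K) \<longleftrightarrow> x \<in> swap_set (i - 1) (drop_min K)"
          unfolding mem[OF z min] in_swap_set mem[OF K(2) refl] using lt pos iK i' by cases auto
      qed
      then show ?thesis using lt pos by simp
    qed
  qed
  have fin: "finite K" "0 \<notin> K" using K finite_sub by auto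
  have fin': "finite (swap_set i K)" "0 \<notin> swap_set i K"
    using fin i by (auto simp: swap_set_def)
  consider "i \<in> K" "i + 1 \<notin> K" | "i \<notin> K" "i + 1 \<in> K" | "i \<in> K \<longleftrightarrow> i + 1 \<in> K" by blast
  then show ?thesis
  proof cases
    case 1
    then show ?thesis using main[OF fin] by blast
  next
    case 2
    then have "i \<in> swap_set i K" "i + 1 \<notin> swap_set i K" by (auto simp: in_swap_set)
    from main[OF fin' this] show ?thesis by (metis swap_set_swap_set)
  next
    case 3
    then have "swap_set i K = K" by (auto simp: swap_set_def)
    then show ?thesis by simp
  qed
qed

section \<open>Limits of multilinear polynomials\<close>

lemma prod_single_variables:
  "(\<Prod>i\<in>I. single (single i b) 1) =
    (single (\<Sum>i\<in>I. single i b) 1 :: ('k \<Rightarrow>\<^sub>0 'b::comm_monoid_add) \<Rightarrow>\<^sub>0 'a::comm_ring_1)"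
  by (induction I rule: infinite_finite_induct) (auto simp: mult_single)

lemma Xset_eq_single:
  assumes "I \<subseteq> {1..m}"
  shows "Xset m I = single (\<Sum>i\<in>I. single i 1) 1"
proof -
  have "Xset m I = (\<Prod>i\<in>I. single (single i 1) 1)"
    unfolding Xset_def using assms by (intro prod.cong) (auto simp: Xpow_small)
  then show ?thesis by (simp only: prod_single_variables)
qed

lemma scal_e_sym:
  "scal c (e_sym n m) = (\<Sum>I\<in>Pow {1..m}. scal (if card I = n then c else 0)
     (single (\<Sum>i\<in>I. single i 1) 1))"
  unfolding e_sym_def scal_sum prod_single_variables
  by (rule sum.mono_neutral_cong_left) auto

lemma e_sym_eq_mlin: "e_sym n m = mlin m (\<lambda>I. if card I = n then 1 else 0)"
proof -
  have "e_sym n m = scal 1 (e_sym n m)" by simp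
  also have "\<dots> = mlin m (\<lambda>I. if card I = n then 1 else 0)"
    unfolding mlin_def scal_e_sym by (intro sum.cong) (auto simp: Xset_eq_single)
  finally show ?thesis .
qed

lemma lim_q_inf_lookup:
  assumes "lim_eq m F (mlin m f)" and f: "\<And>I. I \<subseteq> {1..m} \<Longrightarrow> f I = (if card I = n then c else 0)"
  shows "lim_q_inf (lookup F \<alpha>) (lookup (scal c (e_sym n m)) \<alpha>)"
proof -
  have "lookup (mlin m f) \<alpha> = embed (lookup (scal c (e_sym n m)) \<alpha>)"
    unfolding mlin_def scal_e_sym lookup_sum ring_hom_sum[OF embed_ring_hom]
    using f by (intro sum.cong refl) (auto simp: lookup_scal Xset_eq_single lookup_single when_def)
  moreover have "lim_q_inf (lookup (F - mlin m f) \<alpha>) 0"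
    using assms(1) by (simp add: lim_eq_def npoly_def)
  ultimately show ?thesis
    using lim_q_inf_add[of "lookup (F - mlin m f) \<alpha>" 0,
        OF _ lim_q_inf_embed[of "lookup (scal c (e_sym n m)) \<alpha>"]]
    by (simp add: lookup_minus)
qed

section \<open>The limit of the symmetric function of a unit interval graph\<close>

lemma descend_Tinv_Pi:
  assumes "m \<ge> 2" "1 \<le> a" "F \<in> laurent m"
  shows "Pi_op m (descend (Tinv_op m) a b F) = descend (Tinv_op m) (a + 1) (b + 1) (Pi_op m F)"
  unfolding descend_shift[symmetric]
  using assms by (intro descend_commute[where V = "laurent m"]) (auto simp: Tinv_op_in_laurent Tinv_op_Pi)

lemma S_op_Pi:
  assumes m: "m \<ge> 1" and i: "1 \<le> i" "e < i" and F: "F \<in> laurent m"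
  shows "S_op m (i + 1) (e + 1) (Pi_op m F) = Pi_op m (S_op m i e F)"
proof (cases "m = 1")
  case True
  \<comment> \<open>For m = 1 the operator vanishes unless e = i - 1, when only the empty word is
    left.\<close>
  then show ?thesis using i by (cases "e = i - 1") (auto simp: S_op_def)
next
  case False
  then have m2: "m \<ge> 2" using m by simp
  have hom: "Pi_op m (sum f A) = (\<Sum>x\<in>A. Pi_op m (f x))" for f :: "int \<Rightarrow> _" and A
    by (induction A rule: infinite_finite_induct) (auto simp: Pi_op_add)
  have "(\<Sum>j\<in>{i..int m + e}. descend (Tinv_op m) (i + 1) j (Pi_op m F)) =
      (\<Sum>j\<in>{i - 1..int m + e - 1}. descend (Tinv_op m) (i + 1) (j + 1) (Pi_op m F))"
    by (rule sum.reindex_bij_witness[of _ "\<lambda>j. j + 1" "\<lambda>j. j - 1"]) auto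
  then show ?thesis
    by (simp add: S_op_def hom descend_Tinv_Pi[OF m2 i(1) F] flip: descend_def)
qed

lemma S_op_in_laurent:
  assumes m: "m \<ge> 1" and i: "1 \<le> i" "e < i" and F: "F \<in> laurent m"
  shows "S_op m i e F \<in> laurent m"
proof (cases "m = 1")
  case True
  then show ?thesis using i F by (cases "e = i - 1") (auto simp: S_op_def)
next
  case False
  then have "descend (Tinv_op m) i j F \<in> laurent m" for j
    using i m F by (intro descend_in) (auto simp: Tinv_op_in_laurent)
  then show ?thesis by (auto simp: S_op_def intro!: sum_in_laurent simp flip: descend_def)
qed

lemma S_op_Pi_power:
  assumes m: "m \<ge> 1" and e: "e < int n + 1" and F: "F \<in> laurent m"
  shows "S_op m (int n + 1) e ((Pi_op m ^^ n) F) = (Pi_op m ^^ n) (S_op m 1 (e - int n) F)"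
  using e
proof (induction n arbitrary: e)
  case (Suc n)
  have L: "(Pi_op m ^^ n) F \<in> laurent m"
    using F m by (cases n) (auto simp: Pi_op_in_laurent)
  have "S_op m (int (Suc n) + 1) e ((Pi_op m ^^ Suc n) F) =
      S_op m (int n + 1 + 1) (e - 1 + 1) (Pi_op m ((Pi_op m ^^ n) F))"
    by (simp add: algebra_simps)
  also have "\<dots> = Pi_op m (S_op m (int n + 1) (e - 1) ((Pi_op m ^^ n) F))"
    using Suc.prems L m by (intro S_op_Pi) auto
  also have "S_op m (int n + 1) (e - 1) ((Pi_op m ^^ n) F) =
      (Pi_op m ^^ n) (S_op m 1 (e - 1 - int n) F)"
    using Suc.prems by (intro Suc.IH) auto
  finally show ?case by (simp add: algebra_simps)
qed simp

definition S_Pi_iter :: "nat \<Rightarrow> (nat \<Rightarrow> int) \<Rightarrow> nat list \<Rightarrow> Qqt lpoly \<Rightarrow> Qqt lpoly" where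
  "S_Pi_iter m e = foldr (\<lambda>i G. S_op m 1 (e i - int i + 1) (Pi_op m G))"

text \<open>The last factor is moved to the left through all but one of the available powers of Pi,
  which brings its first index down to 1; the remaining Pi joins it to form one operator
  B_a.\<close>

lemma compose_S_op:
  assumes m: "m \<ge> 1" and e: "\<And>i. 1 \<le> i \<Longrightarrow> i \<le> n \<Longrightarrow> e i < int i" and F: "F \<in> laurent m"
  shows "compose (map (\<lambda>i. S_op m (int i) (e i)) [1..<n + 1]) ((Pi_op m ^^ n) F) =
    S_Pi_iter m e [1..<n + 1] F"
  using e F
proof (induction n arbitrary: F)
  case (Suc n)
  let ?G = "S_op m 1 (e (Suc n) - int n) (Pi_op m F)"
  have G: "?G \<in> laurent m"
    using Suc.prems(1)[of "Suc n"] m by (intro S_op_in_laurent Pi_op_in_laurent) auto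
  have "S_op m (int (Suc n)) (e (Suc n)) ((Pi_op m ^^ Suc n) F) =
      S_op m (int n + 1) (e (Suc n)) ((Pi_op m ^^ n) (Pi_op m F))"
    by (simp add: funpow_swap1 add.commute)
  also have "\<dots> = (Pi_op m ^^ n) ?G"
    using Suc.prems(1)[of "Suc n"] m by (intro S_op_Pi_power Pi_op_in_laurent) auto
  finally have *: "S_op m (int (Suc n)) (e (Suc n)) ((Pi_op m ^^ Suc n) F) = (Pi_op m ^^ n) ?G" .
  have u: "[1..<Suc n + 1] = [1..<n + 1] @ [Suc n]" by simp
  have "compose (map (\<lambda>i. S_op m (int i) (e i)) [1..<Suc n + 1]) ((Pi_op m ^^ Suc n) F) =
      compose (map (\<lambda>i. S_op m (int i) (e i)) [1..<n + 1])
        (S_op m (int (Suc n)) (e (Suc n)) ((Pi_op m ^^ Suc n) F))"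
    unfolding u by (simp only: map_append compose_append list.map compose_simps comp_apply id_apply)
  also have "\<dots> = S_Pi_iter m e [1..<n + 1] ?G"
    unfolding * using Suc.prems G by (intro Suc.IH) auto
  also have "\<dots> = S_Pi_iter m e [1..<Suc n + 1] F"
    unfolding u by (simp add: S_Pi_iter_def algebra_simps)
  finally show ?case .
qed (simp add: S_Pi_iter_def)

text \<open>For a \<ge> m the defining case distinction gives 0 and the sum is empty.\<close>

lemma S_op_1:
  "S_op m 1 (- int a) F = (\<Sum>j<m - a. descend (Tinv_op m) 1 (int j) F)"
proof (cases "a < m")
  case True
  have "(\<Sum>j\<in>{0..int m - int a - 1}. descend (Tinv_op m) 1 j F) = (\<Sum>j<m - a. descend (Tinv_op m) 1 (int j) F)"
    by (rule sum.reindex_bij_witness[of _ int nat]) (use True in auto)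
  then show ?thesis using True by (simp add: S_op_def algebra_simps flip: descend_def)
qed (auto simp: S_op_def)

lemma lim_eq_S_op:
  assumes m: "m \<ge> 1" and G: "lim_eq m G (mlin m f)"
    and f: "\<And>i I. 1 \<le> i \<Longrightarrow> i + 1 + a < m \<Longrightarrow> I \<subseteq> {1..m} \<Longrightarrow> f (swap_set i I) = f I"
  shows "lim_eq m (S_op m 1 (- int a) (Pi_op m G))
    (mlin m (\<lambda>K. t_Qt powi (1 + int a - int m) * t_int (card (K \<inter> {1..m - a})) * f (drop_min K)))"
proof -
  let ?S = "\<lambda>F. \<Sum>j<m - a. descend (Tinv_op m) 1 (int j) F"
  let ?h = "\<lambda>K. f (drop_min K)"
  have sub: "drop_min K \<subseteq> {1..m}" if "K \<subseteq> {1..m}" for K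
  proof (cases "K = {}")
    case False
    then have "Min K \<in> K" "\<And>k. k \<in> K \<Longrightarrow> Min K \<le> k" using finite_sub[OF that] by auto
    then show ?thesis using that unfolding drop_min_def by force
  qed (simp add: drop_min_def)
  have h: "?h (swap_set i I) = ?h I" if "1 \<le> i" "i < m - a" "I \<subseteq> {1..m}" for i I
    using drop_min_swap_set[OF that(1,3)] f[of "i - 1" "drop_min I"] that sub[OF that(3)] by auto
  have good: "good_op m ?S" by (intro good_op_sum_ops good_op_descend good_op_Tinv) auto
  have "lim_eq m (Pi_op m G) (mlin m (\<lambda>K. if 1 \<in> K then ?h K else 0))"
    using lim_eq_trans[OF lim_eq_good[OF good_op_Pi[OF m] G] lim_eq_Pi_mlin[OF m]] .
  from lim_eq_good[OF good this]
  have "lim_eq m (?S (Pi_op m G))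
    (mlin m (\<lambda>I. t_Qt powi (1 - int (m - a)) * t_int (card (I \<inter> {1..m - a})) * ?h I))"
    using sum_descend_Tinv_mlin[of "m - a" m ?h] h by simp
  moreover have "mlin m (\<lambda>I. t_Qt powi (1 - int (m - a)) * t_int (card (I \<inter> {1..m - a})) * ?h I) =
      mlin m (\<lambda>K. t_Qt powi (1 + int a - int m) * t_int (card (K \<inter> {1..m - a})) * ?h K)"
  proof (cases "a \<le> m")
    case True
    then have "1 - int (m - a) = 1 + int a - int m" by simp
    then show ?thesis by (simp only:)
  qed simp
  ultimately show ?thesis unfolding S_op_1 by simp
qed

lemma drop_min_sub:
  assumes "K \<subseteq> {1..p}" "K \<noteq> {}"
  shows "drop_min K \<subseteq> {1..p - 1}" "card (drop_min K) = card K - 1"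
proof -
  have min: "Min K \<in> K" "\<And>k. k \<in> K \<Longrightarrow> Min K \<le> k" using finite_sub[OF assms(1)] assms(2) by auto
  then show "drop_min K \<subseteq> {1..p - 1}" using assms(1) unfolding drop_min_def by force
  have "inj_on (\<lambda>k. k - 1) (K - {Min K})"
  proof (rule inj_onI)
    fix x y assume "x \<in> K - {Min K}" "y \<in> K - {Min K}" "x - 1 = y - 1"
    moreover from this have "1 \<le> x" "1 \<le> y" using assms(1) by auto
    ultimately show "x = y" by simp
  qed
  then show "card (drop_min K) = card K - 1"
    unfolding drop_min_def using min finite_sub[OF assms(1)] by (simp add: card_image)
qed

lemma power_int_prod: "(\<Prod>j\<in>A. t_Qt powi b j) = t_Qt powi (\<Sum>j\<in>A. b j)"
  by (induction A rule: infinite_finite_induct) (auto simp: power_int_add)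

lemma sum_pred: "(\<Sum>j=1..n. int j - 1) = int (n * (n - 1) div 2)"
proof -
  have "2 * (\<Sum>j=1..n. int j - 1) = int n * (int n - 1)"
    by (induction n) (auto simp: algebra_simps)
  also have "\<dots> = int (n * (n - 1))" by (cases n) (auto simp: algebra_simps)
  finally show ?thesis by linarith
qed

text \<open>Two invariants are carried: symmetry of f in {1..m - a i}, which the next factor
  consumes, and explicit values on subsets of {1..m + 1 - i}. The latter range shrinks as i grows
  because \<open>drop_min\<close> lowers elements; at i = 1 it is all of {1..m}.\<close>

lemma lim_eq_foldr_S_op:
  assumes m: "m \<ge> 1" and e: "e \<in> EE n" and i: "1 \<le> i" "i \<le> n + 1"
  defines "a \<equiv> \<lambda>j. nat (int j - 1 - e j)"
  shows "\<exists>f. lim_eq m (S_Pi_iter m e [i..<n + 1] 1) (mlin m f) \<and>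
    (\<forall>k K. 1 \<le> k \<longrightarrow> k < m \<longrightarrow> (i \<le> n \<longrightarrow> k + a i < m) \<longrightarrow> K \<subseteq> {1..m} \<longrightarrow> f (swap_set k K) = f K) \<and>
    (\<forall>K \<subseteq> {1..m + 1 - i}. f K = (if card K = n + 1 - i
       then (\<Prod>j=i..n. t_Qt powi (1 + int (a j) - int m)) * t_fact (n + 1 - i) else 0))"
  (is "\<exists>f. ?P i f")
  using i(2,1)
proof (induction i rule: inc_induct)
  case base
  let ?f = "\<lambda>K. if K = {} then 1 else 0"
  have "lim_eq m 1 (mlin m ?f)"
    unfolding mlin_single[OF empty_subsetI] by (simp add: lim_eq_refl npoly_1)
  moreover have "swap_set k K = {} \<longleftrightarrow> K = {}" for k K
  proof -
    have "swap_set k {} = {}" by (simp add: swap_set_def)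
    then show ?thesis by (metis swap_set_swap_set)
  qed
  moreover have "card K = 0 \<longleftrightarrow> K = {}" if "K \<subseteq> {1..m + 1 - (n + 1)}" for K
    using finite_sub[OF that] by auto
  ultimately have "?P (n + 1) ?f" by (auto simp: S_Pi_iter_def)
  then show ?case by blast
next
  case (step i)
  then have in': "1 \<le> i" "i \<le> n" by auto
  from step obtain f where f: "?P (Suc i) f" by auto
  have ei: "0 \<le> e i" "e i < int i" using e in' by (auto simp: EE_def)
  have ai: "e i - int i + 1 = - int (a i)" "a i < i" using ei in' by (auto simp: a_def)
  \<comment> \<open>Monotonicity of e enters here: f is symmetric in {1..m - a (i+1)}, which
    contains the range {1..m - a i - 1} required by the factor for i.\<close>
  have anext: "a (Suc i) \<le> a i + 1" if "Suc i \<le> n"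
  proof -
    have "e i \<le> e (i + 1)" using e in' that by (auto simp: EE_def)
    then show ?thesis by (simp add: a_def Suc_eq_plus1)
  qed
  have finv: "f (swap_set k I) = f I" if "1 \<le> k" "k + 1 + a i < m" "I \<subseteq> {1..m}" for k I
    using f anext that by force
  define g where "g = (\<lambda>K. t_Qt powi (1 + int (a i) - int m) * t_int (card (K \<inter> {1..m - a i})) * f (drop_min K))"
  have "lim_eq m (S_op m 1 (- int (a i)) (Pi_op m (S_Pi_iter m e [Suc i..<n + 1] 1)))
     (mlin m g)"
    unfolding g_def
  proof (rule lim_eq_S_op[OF m])
    show "lim_eq m (S_Pi_iter m e [Suc i..<n + 1] 1) (mlin m f)"
      using f by blast
  qed (rule finv)
  moreover have "S_Pi_iter m e [i..<n + 1] 1 =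
      S_op m 1 (- int (a i)) (Pi_op m (S_Pi_iter m e [Suc i..<n + 1] 1))"
    using in' by (simp add: S_Pi_iter_def upt_conv_Cons ai)
  moreover have "g (swap_set k K) = g K" if k: "1 \<le> k" "k < m" "i \<le> n \<longrightarrow> k + a i < m" "K \<subseteq> {1..m}" for k K
  proof -
    have "card (swap_set k K \<inter> {1..m - a i}) = card (K \<inter> {1..m - a i})"
      using k in' by (intro card_swap_set_Int) auto
    moreover have "f (drop_min (swap_set k K)) = f (drop_min K)"
    proof -
      have "drop_min K \<subseteq> {1..m}"
        using drop_min_sub(1)[OF k(4)] by (cases "K = {}") (auto simp: drop_min_def)
      then have "f (swap_set (k - 1) (drop_min K)) = f (drop_min K)" if "2 \<le> k"
        using finv[of "k - 1" "drop_min K"] that k in' by auto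
      then show ?thesis using drop_min_swap_set[OF k(1,4)] by auto
    qed
    ultimately show ?thesis by (simp add: g_def)
  qed
  moreover have "g K = (if card K = n + 1 - i
       then (\<Prod>j=i..n. t_Qt powi (1 + int (a j) - int m)) * t_fact (n + 1 - i) else 0)"
    if K: "K \<subseteq> {1..m + 1 - i}" for K
  proof (cases "K = {}")
    case True
    then show ?thesis using in' by (simp add: g_def)
  next
    case False
    \<comment> \<open>Since a i < i, the range {1..m + 1 - i} lies inside {1..m - a i}, so the
      t-integer sees all of K.\<close>
    have "K \<inter> {1..m - a i} = K" using K ai(2) by fastforce
    moreover have "f (drop_min K) = (if card (drop_min K) = n + 1 - Suc i
       then (\<Prod>j=Suc i..n. t_Qt powi (1 + int (a j) - int m)) * t_fact (n + 1 - Suc i) else 0)"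
      using drop_min_sub(1)[OF K False] f by auto
    moreover have "card K \<ge> 1" using False finite_sub[OF K] by (simp add: Suc_leI card_gt_0_iff One_nat_def)
    moreover have "(\<Prod>j=i..n. t_Qt powi (1 + int (a j) - int m)) =
        t_Qt powi (1 + int (a i) - int m) * (\<Prod>j=Suc i..n. t_Qt powi (1 + int (a j) - int m))"
      using in' by (simp add: prod.atLeast_Suc_atMost)
    moreover have "n + 1 - i = Suc (n - i)" using in' by simp
    ultimately show ?thesis
      by (auto simp: g_def drop_min_sub(2)[OF K False] t_fact_Suc)
  qed
  ultimately have "?P i g" by auto
  then show ?case by blast
qed

lemma symfun_lim_X_qt:
  assumes e: "e \<in> EE n"
  shows "symfun_lim (X_qt n e)
    (\<lambda>m. scal (t_Qt powi (int (n * (n - 1) div 2) - e_size n e) * t_fact n) (e_sym n m))"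
  unfolding symfun_lim_def
proof (intro allI impI)
  fix m :: nat and \<alpha> assume m: "m \<ge> 1"
  define a where "a = (\<lambda>j. nat (int j - 1 - e j))"
  define P where "P = (\<Prod>j=1..n. t_Qt powi (1 + int (a j) - int m))"
  let ?F = "S_Pi_iter m e [1..<n + 1] 1"
  obtain f where f: "lim_eq m ?F (mlin m f)"
    "\<And>K. K \<subseteq> {1..m} \<Longrightarrow> f K = (if card K = n then P * t_fact n else 0)"
    using lim_eq_foldr_S_op[OF m e, of 1] by (auto simp: P_def a_def)
  have X: "X_qt n e m = scal (embed (t_Qt ^ (n * (m - 1)))) ?F"
    unfolding X_qt_def using e m by (subst compose_S_op) (auto simp: EE_def tt_def)
  have "lim_eq m (X_qt n e m) (mlin m (\<lambda>I. t_Qt ^ (n * (m - 1)) * f I))"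
    unfolding X scal_mlin[symmetric] by (rule lim_eq_scal[OF f(1)])
  \<comment> \<open>The normalizing power cancels the n factors t^{1-m}; the sum of the a j = j - 1
    - e j remains in the exponent.\<close>
  moreover have "t_Qt ^ (n * (m - 1)) * P = t_Qt powi (int (n * (n - 1) div 2) - e_size n e)"
  proof -
    have "(\<Sum>j=1..n. 1 + int (a j) - int m) = (\<Sum>j=1..n. (int j - 1) - e j + (1 - int m))"
      using e by (intro sum.cong) (auto simp: a_def EE_def)
    also have "\<dots> = (\<Sum>j=1..n. int j - 1) - e_size n e + int n * (1 - int m)"
      by (simp add: sum.distrib sum_subtractf sum_negf e_size_def algebra_simps)
    also have "(\<Sum>j=1..n. int j - 1) = int (n * (n - 1) div 2)" by (rule sum_pred)
    finally have "P = t_Qt powi (int (n * (n - 1) div 2) - e_size n e + int n * (1 - int m))"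
      unfolding P_def power_int_prod by simp
    moreover have "t_Qt ^ (n * (m - 1)) = t_Qt powi (int n * (int m - 1))"
      using m by (simp add: of_nat_diff flip: power_int_of_nat)
    ultimately have "t_Qt ^ (n * (m - 1)) * P =
        t_Qt powi (int n * (int m - 1) + (int (n * (n - 1) div 2) - e_size n e + int n * (1 - int m)))"
      by (simp only: power_int_add[OF disjI1] t_Qt_nonzero not_False_eq_True)
    then show ?thesis by (simp add: algebra_simps)
  qed
  ultimately show "lim_q_inf (lookup (X_qt n e m) \<alpha>)
      (lookup (scal (t_Qt powi (int (n * (n - 1) div 2) - e_size n e) * t_fact n) (e_sym n m)) \<alpha>)"
    using f(2)
    by (intro lim_q_inf_lookup[where f = "\<lambda>I. t_Qt ^ (n * (m - 1)) * f I"]) (auto simp flip: mult.assoc)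
qed

section \<open>The limit of \<open>\<star>\<close>-products\<close>

lemma compose_commute:
  assumes "\<And>f x. f \<in> set fs \<Longrightarrow> x \<in> V \<Longrightarrow> f x \<in> V"
    and "\<And>f x. f \<in> set fs \<Longrightarrow> x \<in> V \<Longrightarrow> g (f x) = f (g x)" and "x \<in> V"
  shows "compose fs x \<in> V \<and> g (compose fs x) = compose fs (g x)"
  using assms by (induction fs) auto

lemma funpow_in: "(\<And>x. x \<in> V \<Longrightarrow> f x \<in> V) \<Longrightarrow> x \<in> V \<Longrightarrow> (f ^^ n) x \<in> V"
  by (induction n) auto

lemma funpow_commute:
  assumes "\<And>x. x \<in> V \<Longrightarrow> f x \<in> V" "\<And>x. x \<in> V \<Longrightarrow> g (f x) = f (g x)" "x \<in> V"
  shows "g ((f ^^ n) x) = (f ^^ n) (g x)"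
  by (induction n) (auto simp: assms funpow_in[of V f])

text \<open>Monomials in commuting operators multiply by adding exponents; commutation is assumed
  only on an invariant set.\<close>

lemma compose_funpow_add:
  assumes "\<And>i x. i \<in> set is \<Longrightarrow> x \<in> V \<Longrightarrow> f i x \<in> V"
    and "\<And>i j x. i \<in> set is \<Longrightarrow> j \<in> set is \<Longrightarrow> x \<in> V \<Longrightarrow> f i (f j x) = f j (f i x)" and "x \<in> V"
  shows "compose (map (\<lambda>i. f i ^^ (a i + b i)) is) x =
    compose (map (\<lambda>i. f i ^^ a i) is) (compose (map (\<lambda>i. f i ^^ b i) is) x)"
  using assms
proof (induction "is")
  case (Cons i "is")
  have pow_in: "(f j ^^ n) y \<in> V" if "j \<in> set (i # is)" "y \<in> V" for j n y
    using that Cons.prems(1) by (intro funpow_in) auto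
  have C: "compose (map (\<lambda>i. f i ^^ c i) is) y \<in> V" if "y \<in> V" for c y
    using pow_in that compose_commute[of "map (\<lambda>i. f i ^^ c i) is" V id y] by auto
  have comm: "(f i ^^ n) (compose (map (\<lambda>i. f i ^^ c i) is) y) = compose (map (\<lambda>i. f i ^^ c i) is) ((f i ^^ n) y)"
    if "y \<in> V" for n c y
  proof -
    have "(f i ^^ n) ((f j ^^ k) z) = (f j ^^ k) ((f i ^^ n) z)" if "j \<in> set is" "z \<in> V" for j k z
    proof (rule funpow_commute)
      fix w assume w: "w \<in> V"
      show "f j w \<in> V" using w that Cons.prems(1) by auto
      show "(f i ^^ n) (f j w) = f j ((f i ^^ n) w)"
        using w that Cons.prems by (intro funpow_commute[symmetric]) auto
    qed (use that in auto)
    then show ?thesis using that pow_in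
      by (intro conjunct2[OF compose_commute[where V = V]]) auto
  qed
  have "compose (map (\<lambda>i. f i ^^ (a i + b i)) (i # is)) x =
      (f i ^^ a i) ((f i ^^ b i) (compose (map (\<lambda>i. f i ^^ a i) is) (compose (map (\<lambda>i. f i ^^ b i) is) x)))"
  proof -
    have IH: "compose (map (\<lambda>i. f i ^^ (a i + b i)) is) x =
        compose (map (\<lambda>i. f i ^^ a i) is) (compose (map (\<lambda>i. f i ^^ b i) is) x)"
      using Cons by simp
    show ?thesis by (simp add: IH funpow_add[where m = "a i" and n = "b i" and f = "f i"])
  qed
  then show ?case using Cons.prems(3) C by (simp add: comm)
qed simp

lemma Y_monom_add:
  assumes "F \<in> npoly m UNIV"
  shows "Y_monom m (\<alpha> + \<beta>) F = Y_monom m \<alpha> (Y_monom m \<beta> F)"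
  unfolding Y_monom_def lookup_add
  using assms good_op_npoly[OF good_op_Y] Y_op_commute
  by (intro compose_funpow_add[where V = "npoly m UNIV"]) auto

lemma good_op_Y_monom: "good_op m (Y_monom m \<alpha>)"
  unfolding Y_monom_def by (intro good_op_compose) (auto intro!: good_op_funpow good_op_Y)

text \<open>The operator P(Y) is applied to an arbitrary vector rather than to 1, so that products
  of polynomials become compositions.\<close>

definition q_op :: "nat \<Rightarrow> ((nat \<Rightarrow>\<^sub>0 nat) \<Rightarrow>\<^sub>0 Qqt) \<Rightarrow> Qqt lpoly \<Rightarrow> Qqt lpoly" where
  "q_op m P F = lext coef (\<lambda>\<alpha>. Y_monom m \<alpha> F) P"

lemma q_map_eq: "q_map m P = q_op m P 1"
  by (simp add: q_map_def q_op_def lext_def scal_def)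

lemma q_op_in: "F \<in> npoly m UNIV \<Longrightarrow> q_op m P F \<in> npoly m UNIV"
  by (auto simp: q_op_def lext_def simp flip: scal_def
      intro!: npoly_sum npoly_scal[where S = UNIV] good_op_npoly[OF good_op_Y_monom])

lemma q_op_mult:
  assumes F: "F \<in> npoly m UNIV"
  shows "q_op m (P * Q) F = q_op m P (q_op m Q F)"
proof -
  have "lext coef (\<lambda>\<beta>. Y_monom m (\<alpha> + \<beta>) F) Q = Y_monom m \<alpha> (q_op m Q F)" for \<alpha>
  proof -
    note in_npoly = good_op_npoly[OF good_op_Y_monom stable_UNIV F]
    have "lext coef (\<lambda>\<beta>. Y_monom m (\<alpha> + \<beta>) F) Q =
        (\<Sum>\<beta>\<in>keys Q. Y_monom m \<alpha> (scal (lookup Q \<beta>) (Y_monom m \<beta> F)))"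
      by (simp add: lext_def Y_monom_add[OF F] good_op_scal[OF good_op_Y_monom in_npoly] flip: scal_def)
    also have "\<dots> = Y_monom m \<alpha> (\<Sum>\<beta>\<in>keys Q. scal (lookup Q \<beta>) (Y_monom m \<beta> F))"
      by (rule good_op_sum[OF good_op_Y_monom, symmetric]) (auto intro!: npoly_scal[OF in_npoly])
    finally show ?thesis by (simp add: q_op_def lext_def scal_def)
  qed
  then show ?thesis unfolding q_op_def[of m "P * Q"] lext_mult[OF ring_hom_single0]
    by (simp add: q_op_def)
qed

lemma q_op_commute:
  "F \<in> npoly m UNIV \<Longrightarrow> q_op m P (q_op m Q F) = q_op m Q (q_op m P F)"
  by (simp add: mult.commute flip: q_op_mult)

lemma q_op_1: "q_op m 1 F = F"
proof -
  have "compose (map (\<lambda>i. Y_op m i ^^ 0) is) F = F" for "is"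
    by (induction "is") auto
  then have "Y_monom m 0 F = F" by (simp add: Y_monom_def)
  then show ?thesis using lext_single[OF ring_hom_single0, of "\<lambda>\<alpha>. Y_monom m \<alpha> F" 0 1]
    by (simp add: q_op_def)
qed

text \<open>The inverse image picked by \<open>inv_into\<close> agrees with the given polynomial on
  the vector 1. Commuting the operators brings each factor next to 1 in turn, where it can be
  replaced.\<close>

lemma star_q_op:
  assumes "P \<in> Y_polys m" "Q \<in> Y_polys m"
  shows "star m (q_op m P 1) (q_op m Q 1) = q_op m (P * Q) 1"
proof -
  let ?inv = "inv_into (Y_polys m) (q_map m)"
  have inv: "q_op m (?inv (q_op m R 1)) 1 = q_op m R 1" if "R \<in> Y_polys m" for R
    using that f_inv_into_f[of "q_op m R 1" "q_map m" "Y_polys m"] by (auto simp: q_map_eq)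
  have "star m (q_op m P 1) (q_op m Q 1) =
      q_op m (?inv (q_op m P 1)) (q_op m (?inv (q_op m Q 1)) 1)"
    by (simp add: star_def q_map_eq q_op_mult npoly_1)
  also have "\<dots> = q_op m (?inv (q_op m P 1)) (q_op m Q 1)" by (simp add: inv assms)
  also have "\<dots> = q_op m Q (q_op m (?inv (q_op m P 1)) 1)" by (rule q_op_commute[OF npoly_1])
  also have "\<dots> = q_op m Q (q_op m P 1)" by (simp add: inv assms)
  also have "\<dots> = q_op m P (q_op m Q 1)" by (rule q_op_commute[OF npoly_1])
  also have "\<dots> = q_op m (P * Q) 1" by (simp add: q_op_mult npoly_1)
  finally show ?thesis .
qed

lemma Y_polys_1: "1 \<in> Y_polys m"
  by (simp add: Y_polys_def)

lemma Y_polys_mult: "P \<in> Y_polys m \<Longrightarrow> Q \<in> Y_polys m \<Longrightarrow> P * Q \<in> Y_polys m"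
proof -
  assume P: "P \<in> Y_polys m" and Q: "Q \<in> Y_polys m"
  have "keys (a + b) \<subseteq> {1..m}" if "a \<in> keys P" "b \<in> keys Q" for a b
    using keys_add[of a b] P Q that unfolding Y_polys_def by blast
  with keys_mult[of P Q] show ?thesis unfolding Y_polys_def by blast
qed

text \<open>The word moves the vacant position i upwards: occupied positions that it passes drop by
  one without a scalar, and passing a vacant one costs 1/t.\<close>

lemma descend_Tinv_Xset:
  assumes i: "1 \<le> i" "i \<le> m" and I: "I \<subseteq> {i + 1..m}" and j: "i \<le> j + 1" "j < m"
  shows "descend (Tinv_op m) (int i) (int j) (Xset m I) =
    scal (embed ((1 / t_Qt) ^ card ({i + 1..j + 1} - I)))
      (Xset m ({k \<in> I. j + 1 < k} \<union> {k. k + 1 \<in> I \<and> k \<le> j}))"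
proof -
  let ?J = "\<lambda>j. {k \<in> I. j + 1 < k} \<union> {k. k + 1 \<in> I \<and> k \<le> j}"
  define i' where "i' = i - 1"
  have i': "i = i' + 1" using i by (simp add: i'_def)
  have J: "?J j \<subseteq> {1..m}" if "i' \<le> j" for j using I i by auto
  have "i' \<le> j" using j i' by simp
  from this j(2) show ?thesis
  proof (induction j rule: dec_induct)
    case base
    have "?J i' = I" using I i' by force
    then show ?case by (simp add: i' descend_empty)
  next
    case (step j)
    let ?i = "j + 1"
    have ge: "i \<le> ?i" using step i' by simp
    have g: "good_op m (Tinv_op m (int ?i))" using step by (intro good_op_Tinv) auto
    have notin: "?i \<notin> ?J j" by auto
    have swap: "swap_set ?i (?J j) = ?J (Suc j)"
      by (rule set_eqI) (auto simp: in_swap_set Suc_eq_plus1)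
    have mem: "?i + 1 \<in> ?J j \<longleftrightarrow> ?i + 1 \<in> I" by auto
    have "descend (Tinv_op m) (int i) (int (Suc j)) (Xset m I) =
        Tinv_op m (int ?i) (descend (Tinv_op m) (int i) (int j) (Xset m I))"
      using ge by (subst descend_last) (auto simp: algebra_simps)
    also have "\<dots> = scal (embed ((1 / t_Qt) ^ card ({i + 1..j + 1} - I))) (Tinv_op m (int ?i) (Xset m (?J j)))"
    proof -
      have IH: "descend (Tinv_op m) (int i) (int j) (Xset m I) =
          scal (embed ((1 / t_Qt) ^ card ({i + 1..j + 1} - I))) (Xset m (?J j))"
        using step by simp
      show ?thesis unfolding IH using step(1) by (intro good_op_scal[OF g] npoly_Xset J)
    qed
    also have "Tinv_op m (int ?i) (Xset m (?J j)) =
        scal (embed (if ?i + 1 \<notin> I then 1 / t_Qt else 1)) (Xset m (?J (Suc j)))"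
      using step J[of j] notin swap mem Tinv_Xset_move[of ?i m "?J j"] by simp
    finally have D: "descend (Tinv_op m) (int i) (int (Suc j)) (Xset m I) =
        scal (embed ((1 / t_Qt) ^ card ({i + 1..j + 1} - I)))
          (scal (embed (if ?i + 1 \<notin> I then 1 / t_Qt else 1)) (Xset m (?J (Suc j))))" .
    have ins: "{i + 1..Suc j + 1} = insert (?i + 1) {i + 1..j + 1}"
      using ge by (auto simp: Suc_eq_plus1)
    have "{i + 1..Suc j + 1} - I = (if ?i + 1 \<notin> I then insert (?i + 1) ({i + 1..j + 1} - I) else {i + 1..j + 1} - I)"
      unfolding ins by auto
    then have "card ({i + 1..Suc j + 1} - I) = (if ?i + 1 \<notin> I then Suc (card ({i + 1..j + 1} - I)) else card ({i + 1..j + 1} - I))"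
      by simp
    then show ?case unfolding D by (simp add: embed_divide mult.commute)
  qed
qed

lemma descend_T_Xset:
  assumes "I \<subseteq> {j + 2..m}" "j < m"
  shows "descend (T_op m) 1 (int j) (Xset m (insert 1 I)) = Xset m (insert (j + 1) I)"
  using assms
proof (induction j)
  case (Suc j)
  let ?i = "j + 1"
  have sub: "insert ?i I \<subseteq> {1..m}" and I: "?i + 1 \<notin> I" "?i \<notin> I" using Suc.prems by auto
  have swap: "swap_set ?i (insert ?i I) = insert (?i + 1) I" using I by (auto simp: swap_set_def)
  have "descend (T_op m) 1 (int (Suc j)) (Xset m (insert 1 I)) =
      T_op m (int ?i) (descend (T_op m) 1 (int j) (Xset m (insert 1 I)))"
    by (subst descend_last) (auto simp: algebra_simps)
  also have "descend (T_op m) 1 (int j) (Xset m (insert 1 I)) = Xset m (insert ?i I)"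
    using Suc.prems by (intro Suc.IH) auto
  also have "T_op m (int ?i) (Xset m (insert ?i I)) = Xset m (insert (?i + 1) I)"
    using T_Xset_move[of ?i m "insert ?i I"] sub I swap Suc.prems by simp
  finally show ?case by (simp add: Suc_eq_plus1)
qed (simp add: descend_empty)

text \<open>Each gap of I in {i + 1..m} contributes 1/t, which reduces the factor t^{m-i} to t^{card
  I}. The new variable X_1 created by Pi is carried to X_i across vacant positions, without a
  scalar.\<close>

lemma Y_op_Xset:
  assumes i: "1 \<le> i" "i \<le> m" and I: "I \<subseteq> {i + 1..m}"
  shows "Y_op m i (Xset m I) = scal (embed (t_Qt ^ card I)) (Xset m (insert i I))"
proof -
  let ?J = "{k. k + 1 \<in> I}" and ?c = "card ({i + 1..m} - I)"
  have J: "?J \<subseteq> {1..m}" "m \<notin> ?J" using I i by auto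
  have D: "descend (Tinv_op m) (int i) (int m - 1) (Xset m I) = scal (embed ((1 / t_Qt) ^ ?c)) (Xset m ?J)"
  proof -
    have e: "int (m - 1) = int m - 1" "m - 1 + 1 = m" using i by auto
    have "{k \<in> I. m < k} \<union> {k. k + 1 \<in> I \<and> k \<le> m - 1} = ?J" using I by force
    then show ?thesis using descend_Tinv_Xset[OF i I, of "m - 1", unfolded e] i by simp
  qed
  have Suc_J: "Suc ` ?J = I"
  proof (rule set_eqI)
    fix k show "k \<in> Suc ` ?J \<longleftrightarrow> k \<in> I" using I i by (cases k) (auto simp: image_iff Suc_eq_plus1)
  qed
  have m: "m \<ge> 1" using i by simp
  have Pi: "Pi_op m (Xset m ?J) = Xset m (insert 1 I)" using Pi_Xset[OF m J] by (simp add: Suc_J)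
  have T: "descend (T_op m) 1 (int i - 1) (Xset m (insert 1 I)) = Xset m (insert i I)"
  proof -
    have e: "int (i - 1) = int i - 1" "i - 1 + 1 = i" "i - 1 + 2 = i + 1" using i by auto
    show ?thesis using descend_T_Xset[of I "i - 1" m, unfolded e] I i by simp
  qed
  have g: "good_op m (descend (T_op m) 1 (int i - 1))"
    using i by (intro good_op_descend good_op_T) auto
  have sub: "insert 1 I \<subseteq> {1..m}" using I i by auto
  have "Y_op m i (Xset m I) = scal (tt ^ (m - i)) (scal (embed ((1 / t_Qt) ^ ?c)) (Xset m (insert i I)))"
    unfolding Y_op_descend D Pi_op_scal Pi good_op_scal[OF g npoly_Xset[OF sub]] T ..
  also have "\<dots> = scal (embed (t_Qt ^ (m - i) * (1 / t_Qt) ^ ?c)) (Xset m (insert i I))"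
    by (simp add: tt_def)
  also have "t_Qt ^ (m - i) * (1 / t_Qt) ^ ?c = t_Qt ^ card I"
  proof -
    have "?c + card I = m - i"
      using I card_Diff_subset[of I "{i + 1..m}"] card_mono[of "{i + 1..m}" I] finite_subset[OF I] by auto
    then have "t_Qt ^ (m - i) = t_Qt ^ ?c * t_Qt ^ card I" by (simp flip: power_add)
    then show ?thesis by (simp add: power_divide)
  qed
  finally show ?thesis .
qed

definition expo :: "nat set \<Rightarrow> nat \<Rightarrow>\<^sub>0 nat" where
  "expo A = (\<Sum>i\<in>A. single i 1)"

lemma lookup_expo: "finite A \<Longrightarrow> lookup (expo A) i = (if i \<in> A then 1 else 0)"
  by (auto simp: expo_def lookup_sum lookup_single when_def)

text \<open>The Y_i with the largest index acts first, so each one meets only larger variables. The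
  exponents 0, 1, ..., card A - 1 add up.\<close>

lemma Y_monom_expo:
  assumes A: "A \<subseteq> {1..m}"
  shows "Y_monom m (expo A) 1 = scal (embed (t_Qt ^ (card A * (card A - 1) div 2))) (Xset m A)"
proof -
  have "compose (map (\<lambda>i. Y_op m i ^^ lookup (expo A) i) [k..<m + 1]) 1 =
     scal (embed (t_Qt ^ (card (A \<inter> {k..m}) * (card (A \<inter> {k..m}) - 1) div 2))) (Xset m (A \<inter> {k..m}))"
    if "1 \<le> k" "k \<le> m + 1" for k
    using that(2,1)
  proof (induction k rule: inc_induct)
    case (step k)
    let ?B = "A \<inter> {Suc k..m}" and ?Y = "Y_op m k"
    have funpow_1: "?Y ^^ 1 = ?Y" by (simp add: One_nat_def)
    have g: "good_op m ?Y" using step by (intro good_op_Y) auto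
    have upt: "[k..<m + 1] = k # [Suc k..<m + 1]" using step by (simp add: upt_conv_Cons)
    have int: "{k..m} = insert k {Suc k..m}" using step by auto
    have B: "?B \<subseteq> {k + 1..m}" "?B \<subseteq> {1..m}" using A by auto
    show ?case
    proof (cases "k \<in> A")
      case False
      then have "A \<inter> {k..m} = ?B" by (auto simp: int)
      then show ?thesis using step False finite_sub[OF A] by (simp add: upt lookup_expo)
    next
      case True
      then have e: "A \<inter> {k..m} = insert k ?B" by (auto simp: int)
      have c: "card (insert k ?B) = Suc (card ?B)" using finite_sub[OF B(2)] by simp
      have "compose (map (\<lambda>i. Y_op m i ^^ lookup (expo A) i) [k..<m + 1]) 1 =
          ?Y (scal (embed (t_Qt ^ (card ?B * (card ?B - 1) div 2))) (Xset m ?B))"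
        using step True finite_sub[OF A] funpow_1 by (simp add: upt lookup_expo)
      also have "\<dots> = scal (embed (t_Qt ^ (card ?B * (card ?B - 1) div 2))) (scal (embed (t_Qt ^ card ?B)) (Xset m (insert k ?B)))"
        using Y_op_Xset[of k m ?B] B step by (simp add: good_op_scal[OF g npoly_Xset])
      also have "\<dots> = scal (embed (t_Qt ^ (card ?B * (card ?B - 1) div 2 + card ?B))) (Xset m (insert k ?B))"
        by (simp add: power_add)
      also have "card ?B * (card ?B - 1) div 2 + card ?B = Suc (card ?B) * (Suc (card ?B) - 1) div 2"
      proof -
        have "Suc n * (Suc n - 1) = n * (n - 1) + n * 2" for n by (cases n) auto
        then show ?thesis by (simp only: div_mult_self1)
      qed
      finally show ?thesis unfolding e c .
    qed
  qed simp
  from this[of 1] A show ?thesis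
    unfolding Y_monom_def by (simp add: Int_absorb2)
qed

text \<open>The scalar cancels the power of t in \<open>Y_monom_expo\<close>, so that applying this
  polynomial to 1 gives exactly e_r.\<close>

definition e_Y :: "nat \<Rightarrow> nat \<Rightarrow> (nat \<Rightarrow>\<^sub>0 nat) \<Rightarrow>\<^sub>0 Qqt" where
  "e_Y m r = (\<Sum>A | A \<subseteq> {1..m} \<and> card A = r.
     single (expo A) (embed ((1 / t_Qt) ^ (r * (r - 1) div 2))))"

lemma e_Y_in: "e_Y m r \<in> Y_polys m"
proof -
  have "keys (expo A) \<subseteq> {1..m}" if "A \<subseteq> {1..m}" for A
    using that finite_sub[OF that] by (auto simp: in_keys_iff lookup_expo split: if_splits)
  moreover have "\<exists>A \<subseteq> {1..m}. \<alpha> = expo A" if \<alpha>: "\<alpha> \<in> keys (e_Y m r)" for \<alpha>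
  proof -
    obtain A where "A \<subseteq> {1..m}"
      "\<alpha> \<in> keys (single (expo A) (embed ((1 / t_Qt) ^ (r * (r - 1) div 2))))"
      using subsetD[OF keys_sum \<alpha>[unfolded e_Y_def]] by blast
    then show ?thesis by (auto simp del: embed_simps split: if_splits)
  qed
  ultimately have "keys \<alpha> \<subseteq> {1..m}" if "\<alpha> \<in> keys (e_Y m r)" for \<alpha>
    using that by blast
  then show ?thesis by (simp add: Y_polys_def)
qed

lemma q_op_e_Y: "q_op m (e_Y m r) F = (\<Sum>A | A \<subseteq> {1..m} \<and> card A = r.
    scal (embed ((1 / t_Qt) ^ (r * (r - 1) div 2))) (Y_monom m (expo A) F))"
  by (simp add: q_op_def e_Y_def lext_sum[OF ring_hom_single0] lext_single[OF ring_hom_single0] scal_def)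

lemma good_op_e_Y: "good_op m (q_op m (e_Y m r))"
proof -
  have "good_op m (\<lambda>F. \<Sum>A | A \<subseteq> {1..m} \<and> card A = r.
    scal (embed ((1 / t_Qt) ^ (r * (r - 1) div 2))) (Y_monom m (expo A) F))"
    by (intro good_op_sum_ops good_op_scal_embed good_op_Y_monom)
  then show ?thesis by (simp add: q_op_e_Y[abs_def])
qed

lemma q_op_e_Y_1: "q_op m (e_Y m r) 1 = e_sym r m"
proof -
  have "q_op m (e_Y m r) 1 = (\<Sum>A | A \<subseteq> {1..m} \<and> card A = r. Xset m A)"
    unfolding q_op_e_Y
  proof (intro sum.cong refl)
    fix A assume A: "A \<in> {A. A \<subseteq> {1..m} \<and> card A = r}"
    have "(1 / t_Qt) ^ k * t_Qt ^ k = 1" for k by (simp add: power_divide)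
    then have "embed ((1 / t_Qt) ^ k) * embed (t_Qt ^ k) = 1" for k by (metis embed_simps(1,4))
    with A show "scal (embed ((1 / t_Qt) ^ (r * (r - 1) div 2))) (Y_monom m (expo A) 1) = Xset m A"
      by (auto simp: Y_monom_expo simp del: embed_simps)
  qed
  also have "\<dots> = e_sym r m"
    unfolding e_sym_def by (intro sum.cong refl) (auto simp: Xset_def Xpow_small intro!: prod.cong)
  finally show ?thesis .
qed

lemma Y_monom_singleton: "i \<in> {1..m} \<Longrightarrow> Y_monom m (expo {i}) F = Y_op m i F"
proof -
  assume i: "i \<in> {1..m}"
  have "distinct is \<Longrightarrow> compose (map (\<lambda>j. Y_op m j ^^ lookup (expo {i}) j) is) F =
      (if i \<in> set is then Y_op m i F else F)" for "is"
    by (induction "is") (auto simp: lookup_expo One_nat_def)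
  then show ?thesis using i by (simp add: Y_monom_def)
qed

lemma e_sym_0: "e_sym 0 m = 1"
proof -
  have "{A. A \<subseteq> {1..m} \<and> card A = 0} = {{}}"
    using finite_sub by (auto simp: card_eq_0_iff)
  then show ?thesis by (simp add: e_sym_def)
qed

lemma e_sym_npoly: "e_sym n m \<in> npoly m UNIV"
  unfolding e_sym_eq_mlin by (rule npoly_mlin)

text \<open>On the symmetric e_n the inverse word in Y_i acts by t^{-(m-i)} and cancels the scalar
  of Y_i. Thus e_1(Y) acts as the sum of the words T_{i-1} ... T_1 after Pi.\<close>

lemma lim_eq_e_Y_1:
  assumes m: "m \<ge> 1"
  shows "lim_eq m (q_op m (e_Y m 1) (e_sym n m)) (scal (embed (t_int (Suc n))) (e_sym (Suc n) m))"
proof -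
  let ?h = "\<lambda>I. if card I = Suc n then 1 else 0 :: Qt"
  let ?S = "\<lambda>F. \<Sum>j<m. descend (T_op m) 1 (int j) F"
  have "{A. A \<subseteq> {1..m} \<and> card A = 1} = (\<lambda>i. {i}) ` {1..m}"
    by (auto simp: card_1_singleton_iff One_nat_def)
  then have "q_op m (e_Y m 1) (e_sym n m) = (\<Sum>i\<in>{1..m}. Y_op m i (e_sym n m))"
    unfolding q_op_e_Y by (simp add: sum.reindex Y_monom_singleton)
  also have "\<dots> = (\<Sum>i\<in>{1..m}. descend (T_op m) 1 (int i - 1) (Pi_op m (e_sym n m)))"
  proof (intro sum.cong refl)
    fix i assume i: "i \<in> {1..m}"
    have g: "good_op m (descend (T_op m) 1 (int i - 1))"
      using i by (intro good_op_descend good_op_T) auto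
    have e: "int (m - 1) = int m - 1" "m - 1 + 1 - i = m - i" using i by auto
    have "descend (Tinv_op m) (int i) (int m - 1) (e_sym n m) = scal (embed ((1 / t_Qt) ^ (m - i))) (e_sym n m)"
      using descend_Tinv_mlin_sym[of i "m - 1" m "\<lambda>I. if card I = n then 1 else 0", unfolded e] i
      unfolding e_sym_eq_mlin by (simp add: card_swap_set)
    then show "Y_op m i (e_sym n m) = descend (T_op m) 1 (int i - 1) (Pi_op m (e_sym n m))"
      unfolding Y_op_descend
      by (simp add: Pi_op_scal good_op_scal[OF g good_op_npoly[OF good_op_Pi[OF m] stable_UNIV e_sym_npoly]]
          tt_def power_divide embed_divide)
  qed
  also have "\<dots> = ?S (Pi_op m (e_sym n m))"
    by (rule sum.reindex_bij_witness[of _ "\<lambda>j. j + 1" "\<lambda>i. i - 1"]) auto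
  finally have q: "q_op m (e_Y m 1) (e_sym n m) = ?S (Pi_op m (e_sym n m))" .
  have "lim_eq m (Pi_op m (e_sym n m)) (mlin m (\<lambda>K. if 1 \<in> K then if card (drop_min K) = n then 1 else 0 else 0))"
    unfolding e_sym_eq_mlin by (rule lim_eq_Pi_mlin[OF m])
  also have "mlin m (\<lambda>K. if 1 \<in> K then if card (drop_min K) = n then 1 else 0 else 0) =
      mlin m (\<lambda>K. if 1 \<in> K then ?h K else 0)"
  proof (rule mlin_cong)
    fix K :: "nat set" assume K: "K \<subseteq> {1..m}"
    have "card (drop_min K) = n \<longleftrightarrow> card K = Suc n" if "1 \<in> K"
    proof -
      have "card K > 0" "K \<noteq> {}" using that finite_sub[OF K] by (auto simp: card_gt_0_iff)
      then show ?thesis using drop_min_sub(2)[OF K] by auto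
    qed
    then show "(if 1 \<in> K then if card (drop_min K) = n then 1 else 0 else 0) = (if 1 \<in> K then ?h K else 0)"
      by simp
  qed
  finally have "lim_eq m (Pi_op m (e_sym n m)) (mlin m (\<lambda>K. if 1 \<in> K then ?h K else 0))" .
  moreover have "good_op m ?S" by (intro good_op_sum_ops good_op_descend good_op_T) auto
  ultimately have "lim_eq m (?S (Pi_op m (e_sym n m))) (?S (mlin m (\<lambda>K. if 1 \<in> K then ?h K else 0)))"
    using lim_eq_good[where f = ?S] by blast
  also have "?S (mlin m (\<lambda>K. if 1 \<in> K then ?h K else 0)) = mlin m (\<lambda>I. t_int (card (I \<inter> {1..m})) * ?h I)"
    by (rule sum_descend_T_mlin) (auto simp: card_swap_set)
  also have "\<dots> = scal (embed (t_int (Suc n))) (e_sym (Suc n) m)"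
    unfolding e_sym_eq_mlin scal_mlin by (rule mlin_cong) (auto simp: Int_absorb2)
  finally show ?thesis by (simp add: q)
qed

lemma lim_eq_e_Y_1_power:
  assumes m: "m \<ge> 1"
  shows "lim_eq m ((q_op m (e_Y m 1) ^^ k) (e_sym r m)) (scal (embed (t_fact (k + r) / t_fact r)) (e_sym (k + r) m))"
proof (induction k)
  case 0
  then show ?case by (simp add: lim_eq_refl e_sym_npoly)
next
  case (Suc k)
  let ?E = "q_op m (e_Y m 1)" and ?c = "t_fact (k + r) / t_fact r"
  note g = good_op_e_Y[of m 1]
  have "lim_eq m (?E ((?E ^^ k) (e_sym r m))) (?E (scal (embed ?c) (e_sym (k + r) m)))"
    by (rule lim_eq_good[OF g Suc])
  also have "?E (scal (embed ?c) (e_sym (k + r) m)) = scal (embed ?c) (?E (e_sym (k + r) m))"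
    by (rule good_op_scal[OF g e_sym_npoly])
  also have "lim_eq m \<dots> (scal (embed ?c) (scal (embed (t_int (Suc (k + r)))) (e_sym (Suc (k + r)) m)))"
    by (rule lim_eq_scal[OF lim_eq_e_Y_1[OF m]])
  finally show ?case by (simp add: t_fact_Suc embed_divide mult.commute)
qed

text \<open>At \<open>1/q = 0\<close> the function \<open>e\<^sub>n\<close> is, up to the factor \<open>[n]\<^sub>t!\<close>, the \<open>n\<close>-th \<open>\<star>\<close>-power of \<open>e\<^sub>1\<close>,
  so commutativity reduces multiplication by \<open>e\<^sub>r\<close> to multiplication by \<open>e\<^sub>1\<close>.\<close>

lemma lim_eq_e_Y:
  assumes m: "m \<ge> 1"
  shows "lim_eq m (q_op m (e_Y m r) (e_sym n m))
    (scal (embed (t_fact (n + r) / (t_fact n * t_fact r))) (e_sym (n + r) m))"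
proof -
  let ?E = "q_op m (e_Y m 1)" and ?R = "q_op m (e_Y m r)" and ?u = "1 / t_fact n"
  have P: "(?E ^^ n) 1 = q_op m (e_Y m 1 ^ n) 1"
    by (induction n) (simp_all add: q_op_1 q_op_mult npoly_1)
  have comm: "?R ((?E ^^ n) 1) = (?E ^^ n) (?R 1)"
    using funpow_commute[where V = "npoly m UNIV" and f = ?E and g = ?R and x = 1 and n = n]
    by (simp add: q_op_in npoly_1 q_op_commute)
  have "lim_eq m (scal (embed ?u) ((?E ^^ n) 1)) (e_sym n m)"
    using lim_eq_scal[OF lim_eq_e_Y_1_power[OF m, of n 0], of ?u] by (simp add: e_sym_0 flip: embed_simps(4))
  then have start: "lim_eq m (e_sym n m) (scal (embed ?u) ((?E ^^ n) 1))"
    using npoly_scal_embed[OF stable_null, of "scal (embed ?u) ((?E ^^ n) 1) - e_sym n m" m "-1"]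
    by (auto simp: lim_eq_def scal_uminus scal_def single_uminus)
  have "lim_eq m (?R (e_sym n m)) (?R (scal (embed ?u) ((?E ^^ n) 1)))"
    by (rule lim_eq_good[OF good_op_e_Y start])
  also have "?R (scal (embed ?u) ((?E ^^ n) 1)) = scal (embed ?u) ((?E ^^ n) (e_sym r m))"
    unfolding comm[unfolded q_op_e_Y_1, symmetric]
    by (intro good_op_scal[OF good_op_e_Y] good_op_npoly[OF good_op_funpow[OF good_op_e_Y]] npoly_1 stable_UNIV)
  also have "lim_eq m \<dots> (scal (embed ?u) (scal (embed (t_fact (n + r) / t_fact r)) (e_sym (n + r) m)))"
    by (rule lim_eq_scal[OF lim_eq_e_Y_1_power[OF m]])
  finally show ?thesis by (simp add: embed_divide)
qed

lemma e_qt_eq_q_op: "e_qt \<nu> m = q_op m (prod_list (map (e_Y m) \<nu>)) 1"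
proof (induction \<nu>)
  case Nil
  then show ?case by (simp add: e_qt_def q_op_1)
next
  case (Cons r \<nu>)
  have Y: "prod_list (map (e_Y m) \<nu>) \<in> Y_polys m"
    by (induction \<nu>) (auto intro: Y_polys_1 Y_polys_mult e_Y_in)
  have "e_qt (r # \<nu>) m = star m (q_op m (e_Y m r) 1) (q_op m (prod_list (map (e_Y m) \<nu>)) 1)"
    using Cons by (simp add: e_qt_def q_op_e_Y_1)
  then show ?case using star_q_op[OF e_Y_in Y] by simp
qed

lemma lim_eq_e_qt:
  assumes m: "m \<ge> 1"
  shows "lim_eq m (e_qt \<nu> m) (scal (embed (t_fact (sum_list \<nu>) / t_fact_part \<nu>)) (e_sym (sum_list \<nu>) m))"
proof (induction \<nu>)
  case Nil
  show ?case by (simp add: e_qt_eq_q_op q_op_1 t_fact_part_def lim_eq_refl npoly_1 e_sym_0)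
next
  case (Cons r \<nu>)
  let ?R = "q_op m (e_Y m r)" and ?n = "sum_list \<nu>" and ?c = "t_fact (sum_list \<nu>) / t_fact_part \<nu>"
  have "e_qt (r # \<nu>) m = ?R (e_qt \<nu> m)" by (simp add: e_qt_eq_q_op q_op_mult npoly_1)
  also have "lim_eq m \<dots> (?R (scal (embed ?c) (e_sym ?n m)))"
    by (rule lim_eq_good[OF good_op_e_Y Cons])
  also have "?R (scal (embed ?c) (e_sym ?n m)) = scal (embed ?c) (?R (e_sym ?n m))"
    by (rule good_op_scal[OF good_op_e_Y e_sym_npoly])
  also have "lim_eq m \<dots> (scal (embed ?c) (scal (embed (t_fact (?n + r) / (t_fact ?n * t_fact r))) (e_sym (?n + r) m)))"
    by (rule lim_eq_scal[OF lim_eq_e_Y[OF m]])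
  finally show ?case by (simp add: t_fact_part_def embed_divide add.commute mult_ac)
qed

lemma symfun_lim_e_qt:
  assumes "sum_list \<nu> = n"
  shows "symfun_lim (e_qt \<nu>) (\<lambda>m. scal (t_fact n / t_fact_part \<nu>) (e_sym n m))"
  unfolding symfun_lim_def
proof (intro allI impI)
  fix m :: nat and \<alpha> assume "m \<ge> 1"
  from lim_eq_e_qt[OF this, of \<nu>] show "lim_q_inf (lookup (e_qt \<nu> m) \<alpha>)
      (lookup (scal (t_fact n / t_fact_part \<nu>) (e_sym n m)) \<alpha>)"
    unfolding assms e_sym_eq_mlin scal_mlin by (rule lim_q_inf_lookup) auto
qed

section \<open>Principal specialization\<close>

text \<open>The exponents decrease, so that X_m becomes 1. With ascents counted at the later vertex,
  this order makes the weights of the admissible colors of a new vertex consecutive powers of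
  t.\<close>

definition t_eval :: "nat \<Rightarrow> Qt lpoly \<Rightarrow> Qt" where
  "t_eval m = lext id (\<lambda>\<alpha>. \<Prod>i=1..m. (t_Qt ^ (m - i)) powi lookup \<alpha> i)"

lemma ring_hom_id: "ring_hom id"
  by (rule ring_homI) auto

lemma ring_hom_t_eval: "ring_hom (t_eval m)"
  unfolding t_eval_def
  by (rule lext_ring_hom[OF ring_hom_id]) (auto simp: lookup_add power_int_add prod.distrib)

lemma t_eval_scal: "t_eval m (scal c F) = c * t_eval m F"
proof -
  have "t_eval m (single 0 c) = c"
    by (simp add: t_eval_def lext_single[OF ring_hom_id])
  then show ?thesis by (simp add: scal_def ring_hom_mult[OF ring_hom_t_eval])
qed

lemma t_eval_variable:
  assumes "i \<in> {1..m}"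
  shows "t_eval m (single (single i 1) 1) = t_Qt ^ (m - i)"
proof -
  have "(\<Prod>j=1..m. (t_Qt ^ (m - j)) powi lookup (single i 1) j) =
      (\<Prod>j\<in>{1..m}. if j = i then t_Qt ^ (m - j) else 1)"
    by (intro prod.cong) (auto simp: lookup_single when_def)
  then show ?thesis using assms by (simp add: t_eval_def lext_single[OF ring_hom_id] prod.delta)
qed

definition subset_sum :: "('b \<Rightarrow> 'a::comm_ring_1) \<Rightarrow> 'b set \<Rightarrow> nat \<Rightarrow> 'a" where
  "subset_sum w S r = (\<Sum>A | A \<subseteq> S \<and> card A = r. \<Prod>i\<in>A. w i)"

lemma subset_sum_0: "finite S \<Longrightarrow> subset_sum w S 0 = 1"
proof -
  assume "finite S"
  then have "{A. A \<subseteq> S \<and> card A = 0} = {{}}" by (auto simp: card_eq_0_iff dest: finite_subset)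
  then show ?thesis by (simp add: subset_sum_def)
qed

lemma subset_sum_empty_Suc:
  fixes w :: "'b \<Rightarrow> 'a::comm_ring_1"
  shows "subset_sum w {} (Suc r) = 0"
proof -
  have "{A :: 'b set. A \<subseteq> {} \<and> card A = Suc r} = {}" by auto
  then show ?thesis by (simp only: subset_sum_def sum.empty)
qed

lemma subset_sum_insert:
  assumes "finite S" "x \<notin> S"
  shows "subset_sum w (insert x S) (Suc r) = subset_sum w S (Suc r) + w x * subset_sum w S r"
proof -
  let ?A = "{A. A \<subseteq> S \<and> card A = Suc r}" and ?B = "{A. A \<subseteq> S \<and> card A = r}"
  have fin: "finite A" if "A \<subseteq> S" for A using that assms(1) finite_subset by auto
  have "{A. A \<subseteq> insert x S \<and> card A = Suc r} = ?A \<union> insert x ` ?B"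
  proof (intro set_eqI iffI)
    fix A assume A: "A \<in> {A. A \<subseteq> insert x S \<and> card A = Suc r}"
    show "A \<in> ?A \<union> insert x ` ?B"
    proof (cases "x \<in> A")
      case True
      then have "A = insert x (A - {x})" "A - {x} \<in> ?B" using A by auto
      then show ?thesis by blast
    qed (use A in auto)
  next
    fix A assume "A \<in> ?A \<union> insert x ` ?B"
    then show "A \<in> {A. A \<subseteq> insert x S \<and> card A = Suc r}"
      using assms(2) fin by (auto simp: card_insert_if)
  qed
  moreover have "?A \<inter> insert x ` ?B = {}" using assms(2) by auto
  moreover have "inj_on (insert x) ?B" using assms(2) by (auto simp: inj_on_def)
  moreover have "(\<Prod>i\<in>insert x A. w i) = w x * (\<Prod>i\<in>A. w i)" if "A \<subseteq> S" for A
    using that fin[OF that] assms(2) by (subst prod.insert) auto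
  ultimately show ?thesis unfolding subset_sum_def using assms(1)
    by (simp add: sum.union_disjoint sum.reindex sum_distrib_left)
qed

lemma subset_sum_scale: "subset_sum (\<lambda>i. c * w i) S r = c ^ r * subset_sum w S r"
  unfolding subset_sum_def by (auto simp: prod.distrib sum_distrib_left intro!: sum.cong)

text \<open>The t-binomial theorem with denominators cleared. Going from m to m+1 multiplies the old
  weights by t and adds a weight 1.\<close>

lemma subset_sum_t_powers:
  "subset_sum (\<lambda>i. t_Qt ^ (m - i)) {1..m} r * (\<Prod>i=1..r. 1 - t_Qt ^ i) = (\<Prod>j<r. t_Qt ^ j - t_Qt ^ m)"
proof (induction m arbitrary: r)
  case 0
  show ?case
  proof (cases r)
    case (Suc r')
    have "(\<Prod>j<r. t_Qt ^ j - 1) = 0" using Suc by (intro prod_zero bexI[of _ 0]) auto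
    then show ?thesis using Suc by (simp add: subset_sum_empty_Suc)
  qed (simp add: subset_sum_0)
next
  case (Suc m)
  show ?case
  proof (cases r)
    case 0
    then show ?thesis by (simp add: subset_sum_0)
  next
    case (Suc r')
    let ?g = "\<lambda>r. subset_sum (\<lambda>i. t_Qt ^ (m - i)) {1..m} r" and ?Q = "\<lambda>r. \<Prod>i=1..r. 1 - t_Qt ^ i"
    have "subset_sum (\<lambda>i. t_Qt ^ (Suc m - i)) {1..m} k = t_Qt ^ k * ?g k" for k
    proof -
      have "subset_sum (\<lambda>i. t_Qt ^ (Suc m - i)) {1..m} k = subset_sum (\<lambda>i. t_Qt * t_Qt ^ (m - i)) {1..m} k"
        unfolding subset_sum_def
        by (intro sum.cong prod.cong refl) (auto simp: Suc_diff_le subset_iff)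
      then show ?thesis by (simp add: subset_sum_scale)
    qed
    then have rec: "subset_sum (\<lambda>i. t_Qt ^ (Suc m - i)) {1..Suc m} r =
        t_Qt ^ Suc r' * ?g (Suc r') + t_Qt ^ r' * ?g r'"
      using subset_sum_insert[of "{1..m}" "Suc m" "\<lambda>i. t_Qt ^ (Suc m - i)" r'] Suc
      by (simp add: atLeastAtMostSuc_conv)
    let ?P = "\<Prod>j<r'. t_Qt ^ j - t_Qt ^ m"
    have "subset_sum (\<lambda>i. t_Qt ^ (Suc m - i)) {1..Suc m} r * ?Q r =
        t_Qt ^ Suc r' * (?g (Suc r') * ?Q (Suc r')) + t_Qt ^ r' * (1 - t_Qt ^ Suc r') * (?g r' * ?Q r')"
      unfolding rec using Suc by (simp add: algebra_simps)
    also have "\<dots> = t_Qt ^ Suc r' * (?P * (t_Qt ^ r' - t_Qt ^ m)) + t_Qt ^ r' * (1 - t_Qt ^ Suc r') * ?P"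
      unfolding Suc.IH by simp
    also have "\<dots> = (1 - t_Qt ^ Suc m) * (t_Qt ^ r' * ?P)" by (simp add: algebra_simps)
    also have "t_Qt ^ r' * ?P = (\<Prod>j<r'. t_Qt * (t_Qt ^ j - t_Qt ^ m))" by (simp add: prod.distrib)
    also have "(1 - t_Qt ^ Suc m) * \<dots> = (\<Prod>j<r. t_Qt ^ j - t_Qt ^ Suc m)"
      unfolding Suc prod.lessThan_Suc_shift by (simp add: algebra_simps)
    finally show ?thesis .
  qed
qed

lemma prod_one_minus_t: "(\<Prod>i=1..r. 1 - t_Qt ^ i) = (1 - t_Qt) ^ r * t_fact r"
  by (induction r) (simp_all add: t_fact_Suc t_int_def)

text \<open>With the factor (1 - t)^r the specialization is a polynomial in z = t^m; its constant
  term is t^{r(r-1)/2} / [r]_t!.\<close>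

lemma t_eval_e_sym:
  "(1 - t_Qt) ^ r * t_eval m (e_sym r m) = (\<Prod>j<r. t_Qt ^ j - t_Qt ^ m) / t_fact r"
proof -
  have "t_eval m (e_sym r m) = subset_sum (\<lambda>i. t_Qt ^ (m - i)) {1..m} r"
    unfolding e_sym_def subset_sum_def ring_hom_sum[OF ring_hom_t_eval] ring_hom_prod[OF ring_hom_t_eval]
    by (intro sum.cong prod.cong refl t_eval_variable) auto
  then show ?thesis using subset_sum_t_powers[of m r] unfolding prod_one_minus_t
    by (simp add: field_simps)
qed

lemma t_eval_e_part:
  "(1 - t_Qt) ^ sum_list \<nu> * t_eval m (e_part \<nu> m) =
    prod_list (map (\<lambda>r. \<Prod>j<r. t_Qt ^ j - t_Qt ^ m) \<nu>) / t_fact_part \<nu>"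
  unfolding e_part_def
proof (induction \<nu>)
  case (Cons r \<nu>)
  have "(1 - t_Qt) ^ sum_list (r # \<nu>) * t_eval m (prod_list (map (\<lambda>r. e_sym r m) (r # \<nu>))) =
      ((1 - t_Qt) ^ r * t_eval m (e_sym r m)) * ((1 - t_Qt) ^ sum_list \<nu> * t_eval m (prod_list (map (\<lambda>r. e_sym r m) \<nu>)))"
    by (simp add: power_add ring_hom_mult[OF ring_hom_t_eval])
  then show ?case unfolding Cons t_eval_e_sym by (simp add: t_fact_part_def)
qed (simp add: t_fact_part_def ring_hom_1[OF ring_hom_t_eval])

section \<open>Specialization of chromatic quasisymmetric functions\<close>

text \<open>The weight of giving color x to a new vertex whose earlier neighbours use the colors C:
  one factor for the new ascents, one for the specialized variable.\<close>

definition color_weight :: "nat \<Rightarrow> nat set \<Rightarrow> nat \<Rightarrow> Qt" where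
  "color_weight m C x = t_Qt ^ card {c \<in> C. c < x} * t_Qt ^ (m - x)"

text \<open>For x outside C, the exponent m - x plus the number of elements of C below x equals card
  C plus the number of free colors above x. The weights are therefore t^{card C}, ..., t^{m-1}, each
  once.\<close>

lemma sum_fresh_colors:
  assumes "C \<subseteq> {1..m}"
  shows "(1 - t_Qt) * (\<Sum>x\<in>{1..m} - C. color_weight m C x) =
    t_Qt ^ card C - t_Qt ^ m"
  using assms
proof (induction m arbitrary: C)
  case (Suc m)
  define D where "D = C - {Suc m}"
  have D: "D \<subseteq> {1..m}" using Suc.prems by (auto simp: D_def le_Suc_eq)
  have finD: "finite D" by (rule finite_sub[OF D])
  have eq: "(\<Sum>x\<in>{1..m} - D. color_weight (Suc m) C x) =
      t_Qt * (\<Sum>x\<in>{1..m} - D. color_weight m D x)"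
    unfolding sum_distrib_left
  proof (intro sum.cong refl)
    fix x assume x: "x \<in> {1..m} - D"
    then have "{c \<in> C. c < x} = {c \<in> D. c < x}" by (auto simp: D_def)
    with x show "color_weight (Suc m) C x =
        t_Qt * color_weight m D x"
      by (simp add: color_weight_def Suc_diff_le)
  qed
  show ?case
  proof (cases "Suc m \<in> C")
    case True
    then have "{1..Suc m} - C = {1..m} - D" by (auto simp: D_def le_Suc_eq)
    moreover have "C = insert (Suc m) D" "Suc m \<notin> D" using True by (auto simp: D_def)
    then have "card C = Suc (card D)" using finD by simp
    moreover have "(1 - t_Qt) * (t_Qt * S) = t_Qt * ((1 - t_Qt) * S)" for S by simp
    ultimately show ?thesis unfolding eq by (simp only: eq Suc.IH[OF D]) (simp add: algebra_simps)
  next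
    case False
    then have CD: "C = D" by (auto simp: D_def)
    have "{1..Suc m} - C = insert (Suc m) ({1..m} - D)" using False D by (auto simp: CD)
    moreover have "{c \<in> C. c < Suc m} = D" using D by (auto simp: CD)
    ultimately have "(\<Sum>x\<in>{1..Suc m} - C. color_weight (Suc m) C x) =
        t_Qt ^ card D + t_Qt * (\<Sum>x\<in>{1..m} - D. color_weight m D x)"
      using eq by (simp add: color_weight_def)
    moreover have "(1 - t_Qt) * (b + t_Qt * S) = (1 - t_Qt) * b + t_Qt * ((1 - t_Qt) * S)" for b S
      by (simp add: algebra_simps)
    ultimately show ?thesis by (simp only: Suc.IH[OF D]) (simp add: algebra_simps CD)
  qed
qed simp

lemma t_eval_chromatic_sum:
  assumes "V = {1..n}"
  shows "t_eval m (chromatic V E m) =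
    (\<Sum>\<kappa>\<in>proper_colorings V E m. t_Qt ^ asc E \<kappa> * (\<Prod>v\<in>V. t_Qt ^ (m - \<kappa> v)))"
proof -
  have "t_eval m (\<Prod>v\<in>V. single (single (\<kappa> v) 1) 1) = (\<Prod>v\<in>V. t_Qt ^ (m - \<kappa> v))"
    if "\<kappa> \<in> proper_colorings V E m" for \<kappa>
    unfolding ring_hom_prod[OF ring_hom_t_eval] using that
    by (intro prod.cong refl t_eval_variable) (auto simp: proper_colorings_def)
  then show ?thesis
    unfolding chromatic_def ring_hom_sum[OF ring_hom_t_eval] by (simp add: t_eval_scal)
qed

lemma EE_mono:
  assumes "e \<in> EE n" "1 \<le> i" "i \<le> j" "j \<le> n"
  shows "e i \<le> e j"
  using assms(3,4)
proof (induction j rule: dec_induct)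
  case (step j)
  have "e j \<le> e (j + 1)" using assms step by (auto simp: EE_def)
  then show ?case using step by (simp add: Suc_eq_plus1)
qed simp

text \<open>The earlier neighbours of the vertex \<open>n + 1\<close> form a clique, so they have distinct colors.\<close>

lemma t_eval_chromatic_step:
  assumes e: "e \<in> EE (Suc n)"
  shows "(1 - t_Qt) * t_eval m (chromatic {1..Suc n} (unit_interval_edges (Suc n) e) m) =
    t_eval m (chromatic {1..n} (unit_interval_edges n e) m) *
      (t_Qt ^ nat (int n - e (Suc n)) - t_Qt ^ m)"
proof -
  let ?E = "unit_interval_edges n e" and ?E' = "unit_interval_edges (Suc n) e"
  let ?PC = "proper_colorings {1..n} ?E m" and ?PC' = "proper_colorings {1..Suc n} ?E' m"
  define N where "N = {j \<in> {1..n}. e (Suc n) < int j}"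
  have "\<forall>i\<in>{1..Suc n}. 0 \<le> e i \<and> e i < int i" using e by (simp add: EE_def)
  then have "0 \<le> e (Suc n) \<and> e (Suc n) < int (Suc n)" by (rule bspec) simp
  then have eb: "0 \<le> e (Suc n)" "e (Suc n) \<le> int n" by auto
  have E': "?E' = ?E \<union> (\<lambda>j. (j, Suc n)) ` N"
    by (auto simp: unit_interval_edges_def N_def le_Suc_eq)
  have "N = {nat (e (Suc n)) + 1..n}" using eb by (auto simp: N_def)
  then have cardN: "card N = nat (int n - e (Suc n))" using eb by simp
  have finN: "finite N" by (simp add: N_def)
  \<comment> \<open>Monotonicity gives e k \<le> e (n+1) < j.\<close>
  have clique: "(j, k) \<in> ?E" if "j \<in> N" "k \<in> N" "j < k" for j k
    using that EE_mono[OF e, of k "Suc n"] by (auto simp: N_def unit_interval_edges_def)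
  have inj: "inj_on \<kappa> N" if "\<kappa> \<in> ?PC" for \<kappa>
  proof (rule inj_onI, rule ccontr)
    fix j k assume "j \<in> N" "k \<in> N" "\<kappa> j = \<kappa> k" "j \<noteq> k"
    moreover from this have "(j, k) \<in> ?E \<or> (k, j) \<in> ?E" using clique by (metis nat_neq_iff)
    ultimately show False using that by (auto simp: proper_colorings_def)
  qed
  have sub: "\<kappa> ` N \<subseteq> {1..m}" if "\<kappa> \<in> ?PC" for \<kappa>
    using that by (auto simp: proper_colorings_def N_def PiE_def Pi_def)
  have finE: "finite ?E" by (rule finite_subset[of _ "{1..n} \<times> {1..n}"]) (auto simp: unit_interval_edges_def)
  let ?term = "\<lambda>\<kappa>. t_Qt ^ asc ?E \<kappa> * (\<Prod>v\<in>{1..n}. t_Qt ^ (m - \<kappa> v))"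
  have asc: "asc ?E' (\<kappa>(Suc n := x)) = asc ?E \<kappa> + card {c \<in> \<kappa> ` N. c < x}" if "\<kappa> \<in> ?PC" for \<kappa> x
  proof -
    have in_E: "v \<noteq> Suc n \<and> w \<noteq> Suc n" if "(v, w) \<in> ?E" for v w
      using that by (auto simp: unit_interval_edges_def)
    have N: "Suc n \<notin> N" by (auto simp: N_def)
    have "{(v, w) \<in> ?E'. (\<kappa>(Suc n := x)) v < (\<kappa>(Suc n := x)) w} =
        {(v, w) \<in> ?E. \<kappa> v < \<kappa> w} \<union> (\<lambda>j. (j, Suc n)) ` {j \<in> N. \<kappa> j < x}"
      unfolding E' using in_E N by (auto split: if_splits)
    moreover have "{(v, w) \<in> ?E. \<kappa> v < \<kappa> w} \<inter> (\<lambda>j. (j, Suc n)) ` {j \<in> N. \<kappa> j < x} = {}"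
      using in_E by auto
    moreover have "finite {(v, w) \<in> ?E. \<kappa> v < \<kappa> w}" by (rule finite_subset[OF _ finE]) auto
    moreover have "card ((\<lambda>j. (j, Suc n)) ` {j \<in> N. \<kappa> j < x}) = card {j \<in> N. \<kappa> j < x}"
      by (rule card_image) (auto simp: inj_on_def)
    moreover have "card {j \<in> N. \<kappa> j < x} = card {c \<in> \<kappa> ` N. c < x}"
    proof -
      have "{c \<in> \<kappa> ` N. c < x} = \<kappa> ` {j \<in> N. \<kappa> j < x}" by auto
      then show ?thesis using inj[OF that] by (auto intro!: card_image[symmetric] inj_on_subset[of \<kappa> N])
    qed
    ultimately show ?thesis unfolding asc_def using finN by (simp add: card_Un_disjoint)
  qed
  have "t_eval m (chromatic {1..Suc n} ?E' m) =
      (\<Sum>\<kappa>\<in>?PC'. t_Qt ^ asc ?E' \<kappa> * (\<Prod>v\<in>{1..Suc n}. t_Qt ^ (m - \<kappa> v)))"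
    by (rule t_eval_chromatic_sum[OF refl])
  \<comment> \<open>A proper coloring of n+1 vertices is one of the first n together with a color
    for the last vertex that avoids the colors on \<open>N\<close>.\<close>
  also have "\<dots> = (\<Sum>(\<kappa>, x)\<in>Sigma ?PC (\<lambda>\<kappa>. {1..m} - \<kappa> ` N).
      ?term \<kappa> * color_weight m (\<kappa> ` N) x)"
  proof (rule sum.reindex_bij_witness[of _ "\<lambda>(\<kappa>, x). \<kappa>(Suc n := x)" "\<lambda>\<kappa>. (restrict \<kappa> {1..n}, \<kappa> (Suc n))"])
    fix \<kappa> assume \<kappa>: "\<kappa> \<in> ?PC'"
    then have ext: "\<kappa> \<in> {1..Suc n} \<rightarrow>\<^sub>E {1..m}" and pr: "\<And>v w. (v, w) \<in> ?E' \<Longrightarrow> \<kappa> v \<noteq> \<kappa> w"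
      by (auto simp: proper_colorings_def)
    show upd: "(case (restrict \<kappa> {1..n}, \<kappa> (Suc n)) of (\<kappa>, x) \<Rightarrow> \<kappa>(Suc n := x)) = \<kappa>"
      using ext by (auto simp: fun_eq_iff PiE_def extensional_def restrict_def le_Suc_eq)
    have res: "restrict \<kappa> {1..n} \<in> ?PC"
    proof -
      have "restrict \<kappa> {1..n} \<in> {1..n} \<rightarrow>\<^sub>E {1..m}" using ext by auto
      moreover have "restrict \<kappa> {1..n} v \<noteq> restrict \<kappa> {1..n} w" if "(v, w) \<in> ?E" for v w
        using pr[of v w] that E' by (auto simp: unit_interval_edges_def)
      ultimately show ?thesis unfolding proper_colorings_def by blast
    qed
    have "restrict \<kappa> {1..n} ` N = \<kappa> ` N" by (auto simp: N_def)
    moreover have "\<kappa> j \<noteq> \<kappa> (Suc n)" if "j \<in> N" for j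
      using that by (intro pr) (simp add: E')
    ultimately have "\<kappa> (Suc n) \<notin> restrict \<kappa> {1..n} ` N" by (metis imageE)
    moreover have "\<kappa> (Suc n) \<in> {1..m}" using ext by auto
    ultimately show mem: "(restrict \<kappa> {1..n}, \<kappa> (Suc n)) \<in> Sigma ?PC (\<lambda>\<kappa>. {1..m} - \<kappa> ` N)"
      using res by auto
    have "asc ?E' \<kappa> = asc ?E (restrict \<kappa> {1..n}) + card {c \<in> restrict \<kappa> {1..n} ` N. c < \<kappa> (Suc n)}"
      using asc[OF res, of "\<kappa> (Suc n)"] upd unfolding prod.case by metis
    then show "(case (restrict \<kappa> {1..n}, \<kappa> (Suc n)) of (\<kappa>, x) \<Rightarrow>
        ?term \<kappa> * color_weight m (\<kappa> ` N) x) =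
        t_Qt ^ asc ?E' \<kappa> * (\<Prod>v\<in>{1..Suc n}. t_Qt ^ (m - \<kappa> v))"
      by (simp add: color_weight_def power_add atLeastAtMostSuc_conv mult_ac)
  next
    fix a assume "a \<in> Sigma ?PC (\<lambda>\<kappa>. {1..m} - \<kappa> ` N)"
    then obtain \<kappa> x where a: "a = (\<kappa>, x)" and \<kappa>: "\<kappa> \<in> ?PC" and x: "x \<in> {1..m}" "x \<notin> \<kappa> ` N" by auto
    have ext: "\<kappa> \<in> {1..n} \<rightarrow>\<^sub>E {1..m}" and pr: "\<And>v w. (v, w) \<in> ?E \<Longrightarrow> \<kappa> v \<noteq> \<kappa> w"
      using \<kappa> by (auto simp: proper_colorings_def)
    have "restrict (\<kappa>(Suc n := x)) {1..n} = \<kappa>"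
      using ext by (auto simp: fun_eq_iff PiE_def extensional_def)
    then show "(restrict (case a of (\<kappa>, x) \<Rightarrow> \<kappa>(Suc n := x)) {1..n}, (case a of (\<kappa>, x) \<Rightarrow> \<kappa>(Suc n := x)) (Suc n)) = a"
      by (simp add: a)
    have "\<kappa>(Suc n := x) \<in> {1..Suc n} \<rightarrow>\<^sub>E {1..m}"
      using ext x by (auto simp: PiE_def extensional_def Pi_def le_Suc_eq)
    moreover have "(\<kappa>(Suc n := x)) v \<noteq> (\<kappa>(Suc n := x)) w" if "(v, w) \<in> ?E'" for v w
    proof -
      from that consider "(v, w) \<in> ?E" | "v \<in> N" "w = Suc n" unfolding E' by auto
      then show ?thesis
        using pr[of v w] x(2) by cases (auto simp: unit_interval_edges_def N_def)
    qed
    ultimately show "(case a of (\<kappa>, x) \<Rightarrow> \<kappa>(Suc n := x)) \<in> ?PC'"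
      unfolding a proper_colorings_def prod.case by blast
  qed
  also have "\<dots> = (\<Sum>\<kappa>\<in>?PC. ?term \<kappa> * (\<Sum>x\<in>{1..m} - \<kappa> ` N. color_weight m (\<kappa> ` N) x))"
  proof -
    have "finite ?PC"
      by (rule finite_subset[of _ "{1..n} \<rightarrow>\<^sub>E {1..m}"]) (auto simp: proper_colorings_def intro!: finite_PiE)
    then show ?thesis by (simp add: sum.Sigma sum_distrib_left)
  qed
  finally have "(1 - t_Qt) * t_eval m (chromatic {1..Suc n} ?E' m) =
      (\<Sum>\<kappa>\<in>?PC. ?term \<kappa> * ((1 - t_Qt) * (\<Sum>x\<in>{1..m} - \<kappa> ` N. color_weight m (\<kappa> ` N) x)))"
    by (simp only: sum_distrib_left mult.left_commute)
  also have "\<dots> = (\<Sum>\<kappa>\<in>?PC. ?term \<kappa> * (t_Qt ^ card N - t_Qt ^ m))"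
    by (intro sum.cong refl) (simp only: sum_fresh_colors[OF sub] card_image[OF inj])
  also have "\<dots> = t_eval m (chromatic {1..n} ?E m) * (t_Qt ^ card N - t_Qt ^ m)"
    unfolding t_eval_chromatic_sum[OF refl] sum_distrib_right ..
  finally show ?thesis unfolding cardN .
qed

lemma t_eval_chromatic:
  assumes "e \<in> EE n"
  shows "(1 - t_Qt) ^ n * t_eval m (chromatic {1..n} (unit_interval_edges n e) m) =
    (\<Prod>i=1..n. t_Qt ^ nat (int i - 1 - e i) - t_Qt ^ m)"
  using assms
proof (induction n)
  case 0
  have "proper_colorings {1..0::nat} (unit_interval_edges 0 e) m = {\<lambda>_. undefined}"
    by (auto simp: proper_colorings_def unit_interval_edges_def)
  then show ?case
    unfolding t_eval_chromatic_sum[OF refl] by (simp add: asc_def unit_interval_edges_def)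
next
  case (Suc n)
  have e: "e \<in> EE n" using Suc.prems by (auto simp: EE_def)
  have "(1 - t_Qt) ^ Suc n * t_eval m (chromatic {1..Suc n} (unit_interval_edges (Suc n) e) m) =
      (1 - t_Qt) ^ n * ((1 - t_Qt) * t_eval m (chromatic {1..Suc n} (unit_interval_edges (Suc n) e) m))"
    by (simp add: mult_ac)
  also have "\<dots> = ((1 - t_Qt) ^ n * t_eval m (chromatic {1..n} (unit_interval_edges n e) m)) *
      (t_Qt ^ nat (int n - e (Suc n)) - t_Qt ^ m)"
    unfolding t_eval_chromatic_step[OF Suc.prems] by (simp only: mult.assoc)
  also have "\<dots> = (\<Prod>i=1..Suc n. t_Qt ^ nat (int i - 1 - e i) - t_Qt ^ m)"
    unfolding Suc.IH[OF e] by simp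
  finally show ?case .
qed

lemma part_size_append: "part_size (\<nu> @ [x]) = part_size \<nu> + sum_list \<nu> * x"
proof -
  have "part_size (\<nu> @ [x]) = part_size \<nu> + (\<Sum>i<length \<nu>. \<nu> ! i * x)"
    by (simp add: part_size_def nth_append)
  then show ?thesis by (simp add: sum_list_sum_nth sum_distrib_right atLeast0LessThan)
qed

text \<open>Subtracting the pairs inside the parts from all pairs leaves the pairs between different
  parts; this is how |e_\<nu>| comes out of the constant terms.\<close>

lemma part_size_triangular:
  "part_size \<nu> + sum_list (map (\<lambda>r. \<Sum>{..<r}) \<nu>) = \<Sum>{..<sum_list \<nu>}"
proof (induction \<nu> rule: rev_induct)
  case (snoc x \<nu>)
  have "\<Sum>{..<a + b} = \<Sum>{..<a} + \<Sum>{..<b} + a * b" for a b :: nat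
    by (induction b) auto
  then show ?case using snoc by (simp add: part_size_append)
qed (simp add: part_size_def)

lemma prod_list_t_power: "prod_list (map (\<lambda>r. t_Qt ^ f r) \<nu>) = t_Qt ^ sum_list (map f \<nu>)"
  by (induction \<nu>) (simp_all add: power_add)

text \<open>Both sides are polynomials in \<open>z = t\<^sup>m\<close> that agree for all \<open>m \<ge> 1\<close>; the claim is their value
  at \<open>z = 0\<close>.\<close>

lemma chromatic_coefficients:
  assumes e: "e \<in> EE n"
    and c: "symfun_eq (chromatic {1..n} (unit_interval_edges n e))
      (\<lambda>m. \<Sum>\<nu>\<in>partitions n. scal (c \<nu>) (e_part \<nu> m))"
  shows "(\<Sum>\<nu>\<in>partitions n. t_Qt powi (e_size n e - int (part_size \<nu>)) * (c \<nu> / t_fact_part \<nu>)) = 1"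
proof -
  define k where "k = (\<lambda>i. nat (int i - 1 - e i))"
  define p where "p = (\<Prod>i=1..n. [:t_Qt ^ k i, -1:])"
  define q where "q = (\<Sum>\<nu>\<in>partitions n. smult (c \<nu> / t_fact_part \<nu>)
    (prod_list (map (\<lambda>r. \<Prod>j<r. [:t_Qt ^ j, -1:]) \<nu>)))"
  have hom: "ring_hom (\<lambda>p. poly p z)" for z :: Qt by (rule ring_homI) auto
  have q: "poly q z = (\<Sum>\<nu>\<in>partitions n. c \<nu> * (prod_list (map (\<lambda>r. \<Prod>j<r. t_Qt ^ j - z) \<nu>) / t_fact_part \<nu>))" for z
    by (simp add: q_def poly_sum ring_hom_prod_list[OF hom] comp_def poly_prod)
  have p: "poly p z = (\<Prod>i=1..n. t_Qt ^ k i - z)" for z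
    by (simp add: p_def poly_prod)
  have "poly p (t_Qt ^ m) = poly q (t_Qt ^ m)" if m: "m \<ge> 1" for m
  proof -
    have "poly p (t_Qt ^ m) = (1 - t_Qt) ^ n * t_eval m (\<Sum>\<nu>\<in>partitions n. scal (c \<nu>) (e_part \<nu> m))"
      using t_eval_chromatic[OF e, of m] c m by (simp add: p k_def symfun_eq_def)
    also have "\<dots> = (\<Sum>\<nu>\<in>partitions n. c \<nu> * ((1 - t_Qt) ^ n * t_eval m (e_part \<nu> m)))"
      unfolding ring_hom_sum[OF ring_hom_t_eval] t_eval_scal sum_distrib_left
      by (simp only: mult.left_commute)
    also have "\<dots> = poly q (t_Qt ^ m)"
      unfolding q
    proof (intro sum.cong refl)
      fix \<nu> assume "\<nu> \<in> partitions n"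
      then have "n = sum_list \<nu>" by (simp add: partitions_def)
      then show "c \<nu> * ((1 - t_Qt) ^ n * t_eval m (e_part \<nu> m)) =
          c \<nu> * (prod_list (map (\<lambda>r. \<Prod>j<r. t_Qt ^ j - t_Qt ^ m) \<nu>) / t_fact_part \<nu>)"
        by (simp only: t_eval_e_part)
    qed
    finally show ?thesis .
  qed
  then have "(\<lambda>m. t_Qt ^ m) ` {1..} \<subseteq> {z. poly (p - q) z = 0}" by auto
  moreover have "infinite ((\<lambda>m. t_Qt ^ m) ` {1..})"
    by (subst finite_image_iff) (auto simp: inj_on_def infinite_Ici)
  ultimately have "p - q = 0" using poly_roots_finite[of "p - q"] finite_subset by blast
  then have "poly p 0 = poly q 0" by simp
  then have eq: "t_Qt ^ (\<Sum>i=1..n. k i) =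
      (\<Sum>\<nu>\<in>partitions n. c \<nu> * (t_Qt ^ sum_list (map (\<lambda>r. \<Sum>{..<r}) \<nu>) / t_fact_part \<nu>))"
    by (simp add: p q prod_list_t_power flip: power_sum)
  have "(\<Sum>\<nu>\<in>partitions n. t_Qt powi (e_size n e - int (part_size \<nu>)) * (c \<nu> / t_fact_part \<nu>)) =
      (\<Sum>\<nu>\<in>partitions n. t_Qt powi (- int (\<Sum>i=1..n. k i)) *
        (c \<nu> * (t_Qt ^ sum_list (map (\<lambda>r. \<Sum>{..<r}) \<nu>) / t_fact_part \<nu>)))"
  proof (intro sum.cong refl)
    fix \<nu> assume "\<nu> \<in> partitions n"
    then have n: "sum_list \<nu> = n" by (simp add: partitions_def)
    have "int (\<Sum>i=1..n. k i) = (\<Sum>i=1..n. int i - 1 - e i)"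
      unfolding of_nat_sum using e by (intro sum.cong) (auto simp: k_def EE_def)
    also have "\<dots> = int (\<Sum>{..<n}) - e_size n e"
    proof -
      have "(\<Sum>i=1..n. int i - 1) = int (\<Sum>{..<n})" by (induction n) auto
      then show ?thesis unfolding e_size_def sum_subtractf[of "\<lambda>i. int i - 1"] by simp
    qed
    \<comment> \<open>The k i sum to n(n-1)/2 - |e|, while |e_\<nu>| is n(n-1)/2 minus the
      triangular numbers of the parts; the terms n(n-1)/2 cancel.\<close>
    finally have "e_size n e - int (part_size \<nu>) =
        - int (\<Sum>i=1..n. k i) + int (sum_list (map (\<lambda>r. \<Sum>{..<r}) \<nu>))"
      using part_size_triangular[of \<nu>, unfolded n] by linarith
    then have "t_Qt powi (e_size n e - int (part_size \<nu>)) =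
        t_Qt powi (- int (\<Sum>i=1..n. k i)) * t_Qt ^ sum_list (map (\<lambda>r. \<Sum>{..<r}) \<nu>)"
      by (simp only: power_int_add[OF disjI1] t_Qt_nonzero not_False_eq_True power_int_of_nat)
    then show "t_Qt powi (e_size n e - int (part_size \<nu>)) * (c \<nu> / t_fact_part \<nu>) =
        t_Qt powi (- int (\<Sum>i=1..n. k i)) *
          (c \<nu> * (t_Qt ^ sum_list (map (\<lambda>r. \<Sum>{..<r}) \<nu>) / t_fact_part \<nu>))"
      by simp
  qed
  also have "\<dots> = t_Qt powi (- int (\<Sum>i=1..n. k i)) * t_Qt ^ (\<Sum>i=1..n. k i)"
    unfolding eq by (simp add: sum_distrib_left)
  also have "\<dots> = 1" by (simp add: power_int_minus del: of_nat_sum)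
  finally show ?thesis .
qed

theorem theorem3:
  shows "(\<forall>n\<ge>1. \<forall>e\<in>EE n.
            symfun_lim (X_qt n e)
              (\<lambda>m. scal (t_Qt powi (int (n * (n - 1) div 2) - e_size n e) * t_fact n) (e_sym n m)))
       \<and> (\<forall>n. \<forall>\<nu>\<in>partitions n.
            symfun_lim (e_qt \<nu>) (\<lambda>m. scal (t_fact n / t_fact_part \<nu>) (e_sym n m)))
       \<and> (\<forall>n. \<forall>e\<in>EE n. \<forall>c :: nat list \<Rightarrow> Qt.
            symfun_eq (chromatic {1..n} (unit_interval_edges n e))
              (\<lambda>m. \<Sum>\<nu>\<in>partitions n. scal (c \<nu>) (e_part \<nu> m)) \<longrightarrow>
            (\<Sum>\<nu>\<in>partitions n.
               t_Qt powi (e_size n e - int (part_size \<nu>)) * (c \<nu> / t_fact_part \<nu>)) = 1)"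
  using symfun_lim_X_qt symfun_lim_e_qt chromatic_coefficients by (auto simp: partitions_def)

end
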